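(* Let $\mathfrak{M}$ be a non-quasianalytic weight matrix satisfying $[\mathfrak{M}.1]^{*}_{\mathrm{w}}$ and $[\mathfrak{M}.2]'$. Let $\Omega \subseteq \mathbb{R}^d$ be open, let $V \subseteq \mathbb{R}^{d+1}$ be open such that $V \cap \mathbb{R}^d = \Omega$, and let $\varphi_0,\varphi_1: \Omega \to \mathbb{C}$. Then $\varphi_0,\varphi_1 \in \mathcal{D}^{[\mathfrak{M}]}(\Omega)$ if and only if for all $M \in \mathfrak{M}$ and $h > 0$ (for some $M \in \mathfrak{M}$ and some $h > 0$ in the Roumieu case) there exists $\Phi \in C^2_c(V)$ such that $\Phi_{|\Omega} = \varphi_{0}$, $\partial_y \Phi_{|\Omega} = \varphi_{1}$, and $$\sup_{(x,y) \in V} |\Delta\Phi(x,y)|\, e^{\omega_{M^*}\left(\frac{1}{h|y|}\right)}< \infty.$$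
   Context: Notation: $\mathbb{N}=\{0,1,2,\dots\}$, $\mathbb{Z}_+=\{1,2,\dots\}$. Points of $\mathbb{R}^{d+1}=\mathbb{R}^d\times\mathbb{R}$ are written $(x,y)$; $\mathbb{R}^d$ is identified with $\mathbb{R}^d\times\{0\}$. $\Delta$ is the Laplacian on $\mathbb{R}^{d+1}$. $C^2_c(V)$ is the space of compactly supported $C^2$ functions on $V$. A weight sequence is a sequence $M=(M_p)_{p\in\mathbb{N}}$ of positive numbers with $M_0=1$ such that $m_p:=M_p/M_{p-1}$, $p\in\mathbb{Z}_+$, is increasing (non-strictly) and tends to $\infty$. It is non-quasianalytic if $\sum_{p\ge1}1/m_p<\infty$. Put $M^*_p=M_p/p!$ and $m^*_p=m_p/p$ (similarly $n_p,n_p^*$ for a sequence $N$), and $\omega_{M^*}(t)=\sup_{p\in\mathbb{N}}\log (t^p/M^*_p)$, $t\ge 0$. A weight matrix $\mathfrak{M}$ is a non-empty family of weight sequences that is totally ordered with respect to the pointwise order $\le$. It is non-quasianalytic if each $M\in\mathfrak{M}$ is. Conditions: $(\mathfrak{M}.1)^*_{\mathrm{w}}$: $\forall M\in\mathfrak{M}\ \exists N\in\mathfrak{M}\ \exists C>0\ \forall p\in\mathbb{Z}_+\ \forall 1\le q\le p:\ n^*_q\le Cm^*_p$; $\{\mathfrak{M}.1\}^*_{\mathrm{w}}$: $\forall M\in\mathfrak{M}\ \exists N\in\mathfrak{M}\ \exists C>0\ \forall p\in\mathbb{Z}_+\ \forall 1\le q\le p:\ m^*_q\le Cn^*_p$;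 $(\mathfrak{M}.2)'$: $\forall M\in\mathfrak{M}\ \exists N\in\mathfrak{M}\ \exists C,H>0\ \forall p\in\mathbb{N}:\ N_{p+1}\le CH^pM_p$; $\{\mathfrak{M}.2\}'$: $\forall M\in\mathfrak{M}\ \exists N\in\mathfrak{M}\ \exists C,H>0\ \forall p\in\mathbb{N}:\ M_{p+1}\le CH^pN_p$. Convention: $[\,\cdot\,]$ stands either for $(\,\cdot\,)$ throughout (Beurling case) or for $\{\,\cdot\,\}$ throughout (Roumieu case), also in the names of the conditions. For $K\subset\mathbb{R}^d$ compact, a weight sequence $M$ and $h>0$, $\mathcal{D}^{M,h}_K$ is the space of $\varphi\in C^\infty(\mathbb{R}^d)$ with $\operatorname{supp}\varphi\subseteq K$ and $\sup_{\alpha\in\mathbb{N}^d}\sup_{x\in\mathbb{R}^d}|\varphi^{(\alpha)}(x)|/(h^{|\alpha|}M_{|\alpha|})<\infty$. Put $\mathcal{D}^{(\mathfrak{M})}_K=\bigcap_{M\in\mathfrak{M}}\bigcap_{h>0}\mathcal{D}^{M,h}_K$, $\mathcal{D}^{\{\mathfrak{M}\}}_K=\bigcup_{M\in\mathfrak{M}}\bigcup_{h>0}\mathcal{D}^{M,h}_K$, and $\mathcal{D}^{[\mathfrak{M}]}(\Omega)=\bigcup_{K}\mathcal{D}^{[\mathfrak{M}]}_K$, the union being over all compact $K\subset\Omega$ (functions are identified with their restriction to $\Omega$). The supremum over $V$ is understood over points with $y\neq0$ (finiteness then forces $\Delta\Phi=0$ on $V\cap\mathbb{R}^d$ by continuity).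 *)

theory Defs
  imports "HOL-Analysis.Analysis"
begin

definition dir_deriv ::
    "'a::real_normed_vector \<Rightarrow> ('a \<Rightarrow> 'b::real_normed_vector) \<Rightarrow> 'a \<Rightarrow> 'b" where
  "dir_deriv v f = (\<lambda>x. frechet_derivative f (at x) v)"

(* The class C^k on an open set S; the values of f outside S are irrelevant. *)
fun Ck_on :: "nat \<Rightarrow> 'a::real_normed_vector set \<Rightarrow> ('a \<Rightarrow> 'b::real_normed_vector) \<Rightarrow> bool" where
  "Ck_on 0 S f \<longleftrightarrow> continuous_on S f"
| "Ck_on (Suc k) S f \<longleftrightarrow>
     (\<forall>x\<in>S. f differentiable (at x)) \<and> (\<forall>v. Ck_on k S (dir_deriv v f))"

definition laplacian :: "('a::euclidean_space \<Rightarrow> 'b::real_normed_vector) \<Rightarrow> 'a \<Rightarrow> 'b" where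
  "laplacian f x = (\<Sum>b\<in>Basis. dir_deriv b (dir_deriv b f) x)"

definition supp :: "('a::topological_space \<Rightarrow> 'b::zero) \<Rightarrow> 'a set" where
  "supp f = closure {x. f x \<noteq> 0}"

(* Elements of C^2_c(V) are represented by their extension by zero to the whole space. *)
definition C2c :: "'a::real_normed_vector set \<Rightarrow> ('a \<Rightarrow> complex) set" where
  "C2c V = {f. Ck_on 2 V f \<and> compact (supp f) \<and> supp f \<subseteq> V}"

definition order_of :: "nat ^ 'd \<Rightarrow> nat" where
  "order_of \<alpha> = (\<Sum>i\<in>UNIV. \<alpha> $ i)"

(* The coordinates are differentiated in the order of some list in which each i occurs
   \<alpha> $ i times; for smooth f the result does not depend on the list, by Schwarz's theorem. *)
definition multi_deriv :: "nat ^ 'd \<Rightarrow> (real ^ 'd \<Rightarrow> complex) \<Rightarrow> real ^ 'd \<Rightarrow> complex" where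
  "multi_deriv \<alpha> f =
     foldr (\<lambda>i. dir_deriv (axis i 1)) (SOME is. \<forall>i. count_list is i = \<alpha> $ i) f"

lemma multi_deriv_list_exists:
  fixes \<alpha> :: "nat ^ 'd"
  shows "\<exists>is. \<forall>i. count_list is i = \<alpha> $ i"
proof -
  have "\<exists>is. \<forall>i. count_list is i = (if i \<in> A then \<alpha> $ i else 0)" if "finite A" for A :: "'d set"
    using that
  proof induction
    case empty
    have "\<forall>i. count_list ([] :: 'd list) i = (if i \<in> {} then \<alpha> $ i else 0)" by simp
    then show ?case by blast
  next
    case (insert a A)
    then obtain xs where xs: "\<forall>i. count_list xs i = (if i \<in> A then \<alpha> $ i else 0)" by blast
    have rep: "count_list (replicate n a) i = (if i = a then n else 0)" for n i
      by (induction n) auto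
    have "\<forall>i. count_list (replicate (\<alpha> $ a) a @ xs) i
        = (if i \<in> insert a A then \<alpha> $ i else 0)"
      using xs insert.hyps by (auto simp: rep)
    then show ?case by blast
  qed
  from this[of UNIV] show ?thesis by simp
qed


definition quot_seq :: "(nat \<Rightarrow> real) \<Rightarrow> nat \<Rightarrow> real" where
  "quot_seq M p = M p / M (p - 1)"  (* meaningful for p \<ge> 1 *)

definition quot_seq_star :: "(nat \<Rightarrow> real) \<Rightarrow> nat \<Rightarrow> real" where
  "quot_seq_star M p = quot_seq M p / real p"

definition seq_star :: "(nat \<Rightarrow> real) \<Rightarrow> nat \<Rightarrow> real" where
  "seq_star M p = M p / fact p"

definition weight_sequence :: "(nat \<Rightarrow> real) \<Rightarrow> bool" where
  "weight_sequence M \<longleftrightarrow>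
     (\<forall>p. M p > 0) \<and> M 0 = 1 \<and> mono_on {1..} (quot_seq M) \<and>
     filterlim (quot_seq M) at_top sequentially"

definition non_quasianalytic :: "(nat \<Rightarrow> real) \<Rightarrow> bool" where
  "non_quasianalytic M \<longleftrightarrow> summable (\<lambda>p. 1 / quot_seq M (Suc p))"

(* \<omega>_A(t) for t > 0. For A = seq_star M with M a non-quasianalytic weight sequence
   the supremum is finite: then p / quot_seq M p tends to 0, hence so does t ^ p / A p. *)
definition assoc_fun :: "(nat \<Rightarrow> real) \<Rightarrow> real \<Rightarrow> real" where
  "assoc_fun A t = (SUP p. ln (t ^ p / A p))"

definition weight_matrix :: "(nat \<Rightarrow> real) set \<Rightarrow> bool" where
  "weight_matrix \<MM> \<longleftrightarrow>
     \<MM> \<noteq> {} \<and> (\<forall>M\<in>\<MM>. weight_sequence M) \<and> (\<forall>M\<in>\<MM>. \<forall>N\<in>\<MM>. M \<le> N \<or> N \<le> M)"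

definition nqa_matrix :: "(nat \<Rightarrow> real) set \<Rightarrow> bool" where
  "nqa_matrix \<MM> \<longleftrightarrow> (\<forall>M\<in>\<MM>. non_quasianalytic M)"

(* Suffix B: Beurling case, round brackets; suffix R: Roumieu case, curly brackets. *)

definition M1_star_w_B :: "(nat \<Rightarrow> real) set \<Rightarrow> bool" where
  "M1_star_w_B \<MM> \<longleftrightarrow> (\<forall>M\<in>\<MM>. \<exists>N\<in>\<MM>. \<exists>C>0. \<forall>p\<ge>1. \<forall>q. 1 \<le> q \<and> q \<le> p \<longrightarrow>
     quot_seq_star N q \<le> C * quot_seq_star M p)"

definition M1_star_w_R :: "(nat \<Rightarrow> real) set \<Rightarrow> bool" where
  "M1_star_w_R \<MM> \<longleftrightarrow> (\<forall>M\<in>\<MM>. \<exists>N\<in>\<MM>. \<exists>C>0. \<forall>p\<ge>1. \<forall>q. 1 \<le> q \<and> q \<le> p \<longrightarrow>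
     quot_seq_star M q \<le> C * quot_seq_star N p)"

definition M2_prime_B :: "(nat \<Rightarrow> real) set \<Rightarrow> bool" where
  "M2_prime_B \<MM> \<longleftrightarrow> (\<forall>M\<in>\<MM>. \<exists>N\<in>\<MM>. \<exists>C>0. \<exists>H>0. \<forall>p. N (p + 1) \<le> C * H ^ p * M p)"

definition M2_prime_R :: "(nat \<Rightarrow> real) set \<Rightarrow> bool" where
  "M2_prime_R \<MM> \<longleftrightarrow> (\<forall>M\<in>\<MM>. \<exists>N\<in>\<MM>. \<exists>C>0. \<exists>H>0. \<forall>p. M (p + 1) \<le> C * H ^ p * N p)"

definition DMh :: "(real ^ 'd) set \<Rightarrow> (nat \<Rightarrow> real) \<Rightarrow> real \<Rightarrow> (real ^ 'd \<Rightarrow> complex) set" where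
  "DMh K M h = {\<phi>. (\<forall>k. Ck_on k UNIV \<phi>) \<and> supp \<phi> \<subseteq> K \<and>
     bdd_above (range (\<lambda>(\<alpha>, x). norm (multi_deriv \<alpha> \<phi> x) / (h ^ order_of \<alpha> * M (order_of \<alpha>))))}"

definition DK_B :: "(nat \<Rightarrow> real) set \<Rightarrow> (real ^ 'd) set \<Rightarrow> (real ^ 'd \<Rightarrow> complex) set" where
  "DK_B \<MM> K = (\<Inter>M\<in>\<MM>. \<Inter>h\<in>{0<..}. DMh K M h)"

definition DK_R :: "(nat \<Rightarrow> real) set \<Rightarrow> (real ^ 'd) set \<Rightarrow> (real ^ 'd \<Rightarrow> complex) set" where
  "DK_R \<MM> K = (\<Union>M\<in>\<MM>. \<Union>h\<in>{0<..}. DMh K M h)"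

(* A function on \<Omega> is represented by any total function with the given values on \<Omega>. *)

definition D_B :: "(nat \<Rightarrow> real) set \<Rightarrow> (real ^ 'd) set \<Rightarrow> (real ^ 'd \<Rightarrow> complex) set" where
  "D_B \<MM> \<Omega> = {\<phi>. \<exists>K. compact K \<and> K \<subseteq> \<Omega> \<and> (\<exists>\<psi>\<in>DK_B \<MM> K. \<forall>x\<in>\<Omega>. \<phi> x = \<psi> x)}"

definition D_R :: "(nat \<Rightarrow> real) set \<Rightarrow> (real ^ 'd) set \<Rightarrow> (real ^ 'd \<Rightarrow> complex) set" where
  "D_R \<MM> \<Omega> = {\<phi>. \<exists>K. compact K \<and> K \<subseteq> \<Omega> \<and> (\<exists>\<psi>\<in>DK_R \<MM> K. \<forall>x\<in>\<Omega>. \<phi> x = \<psi> x)}"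

end

theory Submission
  imports
    Defs
    "HOL-Probability.Characteristic_Functions"
    "HOL-Probability.Sinc_Integral"
begin

text \<open>Given \<open>\<Phi>\<close>, Green's identity on the half spaces \<open>\<plusminus>y > 0\<close>, tested against the harmonic functions
  \<open>e\<^bsup>-i x\<cdot>\<xi> \<mp> |\<xi>| y\<^esup>\<close>, expresses the Fourier transforms of \<open>\<phi>0\<close> and \<open>\<phi>1\<close> at \<open>\<xi>\<close> through integrals of
  \<open>\<Delta>\<Phi> e\<^bsup>-|\<xi>| |y|\<^esup>\<close>. Since \<open>e\<^bsup>-|\<xi>| |y|\<^esup> \<le> p! / (|\<xi>| |y|)\<^sup>p\<close> and
  \<open>e\<^bsup>-\<omega>(1/(h|y|))\<^esup> \<le> (h|y|)\<^sup>p M\<^sub>p / p!\<close>, these are at most \<open>C h\<^sup>p M\<^sub>p / |\<xi>|\<^sup>p\<close> for every \<open>p\<close>,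
  and Fourier inversion bounds the derivatives of \<open>\<phi>0\<close> and \<open>\<phi>1\<close>, at the cost of a shift of the index absorbed by
  \<open>[M.2]'\<close>.

  Conversely, the formal solution of the Cauchy problem for \<open>\<Delta>\<close> is \<open>\<Sum>p. b\<^sub>p(x) y\<^sup>p / p!\<close> with
  \<open>b\<^sub>2\<^sub>j = (-\<Delta>)\<^sup>j \<phi>0\<close> and \<open>b\<^sub>2\<^sub>j\<^sub>+\<^sub>1 = (-\<Delta>)\<^sup>j \<phi>1\<close>. Multiplying the \<open>p\<close>-th term by a cut-off at height
  \<open>1 / r\<^sub>p\<close>, where \<open>r\<^sub>p\<close> is proportional to the increasing majorant of \<open>m\<^sup>*\<^sub>p\<close>, makes the series converge. The
  Laplacian telescopes, so only the terms with \<open>r\<^sub>p\<close> comparable to \<open>1 / |y|\<close> survive, and there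
  \<open>[M.1]\<^sup>*\<^sub>w\<close> makes the \<open>p\<close>-th term as small as \<open>e\<^bsup>-\<omega>(1/(h|y|))\<^esup>\<close> up to powers of \<open>|y|\<close>,
  which \<open>[M.2]'\<close> absorbs.\<close>

section \<open>Smooth functions and supports\<close>

text \<open>Each direction loses a fixed number of indices. From \<Phi> to its boundary values the
  loss is 2d, the price of making |\<xi>|^n times a transform integrable over R^d. In the other
  direction it is 4 + 2. The coefficient b_p is needed in C^2, so derivatives up to order p + 2
  enter, while the second y-derivative of its factor leaves only y^(p-2) / (p-2)!; hence index p + 2
  is compared with p - 2. The other two indices pay for a factor y^(-2), which arises because the
  Laplacian mixes the cut-off heights of the indices p - 2 and p. The result is a chain
  \<open>L\<close>, \<open>M\<close>, \<open>N\<close>, \<open>N'\<close>, linked by a shift by 4,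
  the comparison in [M.1]*_w and a shift by 2, with a final radius proportional to the initial one.
  The extension theorem is stated for one such chain; the Beurling case builds it backwards from
  \<open>N'\<close>, the Roumieu case forwards from \<open>L\<close>. The quotients m*_p need not
  increase, so the heights use their running maximum, and [M.1]*_w is precisely a comparison of this
  maximum with a single quotient of the other sequence.\<close>

lemma dir_deriv_eqI: "(f has_derivative f') (at x) \<Longrightarrow> dir_deriv v f x = f' v"
  unfolding dir_deriv_def using frechet_derivative_at by metis

lemma has_derivative_dir_deriv:
  "f differentiable (at x) \<Longrightarrow> (f has_derivative (\<lambda>v. dir_deriv v f x)) (at x)"
  unfolding dir_deriv_def by (simp add: frechet_derivative_works[symmetric])

text \<open>\<open>frechet_derivative\<close> is a choice, so agreement does not depend on
  differentiability: the candidate derivatives of the two functions coincide.\<close>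

lemma dir_deriv_cong_open:
  assumes "open S" "x \<in> S" "\<And>y. y \<in> S \<Longrightarrow> f y = g y"
  shows "dir_deriv v f x = dir_deriv v g x"
proof -
  have "(f has_derivative D) (at x) \<longleftrightarrow> (g has_derivative D) (at x)" for D
    by (rule iffI; erule has_derivative_transform_within_open[OF _ assms(1,2)]; simp add: assms(3))
  then show ?thesis unfolding dir_deriv_def frechet_derivative_def by simp
qed

lemma differentiable_cong_open:
  assumes "open S" "x \<in> S" "\<And>y. y \<in> S \<Longrightarrow> f y = g y" "f differentiable (at x)"
  shows "g differentiable (at x)"
proof -
  obtain D where "(f has_derivative D) (at x)"
    using assms(4) by (auto simp: differentiable_def)
  then have "(g has_derivative D) (at x)"
    by (rule has_derivative_transform_within_open[OF _ assms(1,2)]) (rule assms(3))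
  then show ?thesis by (auto simp: differentiable_def)
qed

lemma Ck_on_cong_open:
  assumes "open S" "\<And>y. y \<in> S \<Longrightarrow> f y = g y" "Ck_on k S f"
  shows "Ck_on k S g"
  using assms(2,3)
proof (induction k arbitrary: f g)
  case 0
  then show ?case by (auto cong: continuous_on_cong)
next
  case (Suc k)
  have "g differentiable (at x)" if "x \<in> S" for x
    by (rule differentiable_cong_open[OF assms(1) that, of f]) (use Suc.prems that in auto)
  moreover have "Ck_on k S (dir_deriv v g)" for v
    by (rule Suc.IH[of "dir_deriv v f"], rule dir_deriv_cong_open[OF assms(1)])
       (use Suc.prems in auto)
  ultimately show ?case by simp
qed

lemma Ck_on_subset: "Ck_on k T f \<Longrightarrow> S \<subseteq> T \<Longrightarrow> Ck_on k S f"
  by (induction k arbitrary: f) (auto intro: continuous_on_subset)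

lemma Ck_on_Un: "open S \<Longrightarrow> open T \<Longrightarrow> Ck_on k S f \<Longrightarrow> Ck_on k T f \<Longrightarrow> Ck_on k (S \<union> T) f"
  by (induction k arbitrary: f) (auto intro: continuous_on_open_Un)

lemma dir_deriv_const [simp]: "dir_deriv v (\<lambda>x. c) = (\<lambda>x. 0)"
  by (auto intro!: dir_deriv_eqI derivative_eq_intros)

lemma Ck_on_const [simp]: "Ck_on k S (\<lambda>x. c)"
  by (induction k arbitrary: c) auto

lemma dir_deriv_add:
  "f differentiable (at x) \<Longrightarrow> g differentiable (at x) \<Longrightarrow>
    dir_deriv v (\<lambda>x. f x + g x) x = dir_deriv v f x + dir_deriv v g x"
  by (intro dir_deriv_eqI has_derivative_add has_derivative_dir_deriv)

lemma dir_deriv_cmult: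
  fixes f :: "'a::real_normed_vector \<Rightarrow> 'b::real_normed_algebra"
  shows "f differentiable (at x) \<Longrightarrow> dir_deriv v (\<lambda>x. c * f x) x = c * dir_deriv v f x"
  by (rule dir_deriv_eqI[OF has_derivative_mult_right[OF has_derivative_dir_deriv]])

lemma Ck_on_add:
  "open S \<Longrightarrow> Ck_on k S f \<Longrightarrow> Ck_on k S g \<Longrightarrow> Ck_on k S (\<lambda>x. f x + g x)"
proof (induction k arbitrary: f g)
  case (Suc k)
  have "Ck_on k S (dir_deriv v (\<lambda>x. f x + g x))" for v
    by (rule Ck_on_cong_open[OF Suc.prems(1) _ Suc.IH[of "dir_deriv v f" "dir_deriv v g"]])
       (use Suc.prems in \<open>auto simp: dir_deriv_add\<close>)
  with Suc.prems show ?case by auto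
qed (auto intro: continuous_intros)

lemma Ck_on_cmult:
  fixes f :: "'a::real_normed_vector \<Rightarrow> 'b::real_normed_algebra"
  shows "open S \<Longrightarrow> Ck_on k S f \<Longrightarrow> Ck_on k S (\<lambda>x. c * f x)"
proof (induction k arbitrary: f)
  case (Suc k)
  have "Ck_on k S (dir_deriv v (\<lambda>x. c * f x))" for v
    by (rule Ck_on_cong_open[OF Suc.prems(1) _ Suc.IH[of "dir_deriv v f"]])
       (use Suc.prems in \<open>auto simp: dir_deriv_cmult\<close>)
  with Suc.prems show ?case by (auto intro!: derivative_intros)
qed (auto intro: continuous_intros)

definition smooth :: "('a::real_normed_vector \<Rightarrow> 'b::real_normed_vector) \<Rightarrow> bool" where
  "smooth f \<longleftrightarrow> (\<forall>k. Ck_on k UNIV f)"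

lemma smooth_differentiable: "smooth f \<Longrightarrow> f differentiable (at x)"
  unfolding smooth_def using Ck_on.simps(2)[of 0 UNIV f] by blast

lemma smooth_dir_deriv: "smooth f \<Longrightarrow> smooth (dir_deriv v f)"
  unfolding smooth_def using Ck_on.simps(2) by blast

lemma smooth_continuous: "smooth f \<Longrightarrow> continuous_on UNIV f"
  unfolding smooth_def using Ck_on.simps(1) by blast

lemma smooth_const: "smooth (\<lambda>x. c)"
  by (simp add: smooth_def)

lemma smooth_add: "smooth f \<Longrightarrow> smooth g \<Longrightarrow> smooth (\<lambda>x. f x + g x)"
  by (simp add: smooth_def Ck_on_add)

lemma smooth_cmult:
  fixes f :: "'a::real_normed_vector \<Rightarrow> 'b::real_normed_algebra"
  shows "smooth f \<Longrightarrow> smooth (\<lambda>x. c * f x)"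
  by (simp add: smooth_def Ck_on_cmult)

lemma smooth_sum: "(\<And>i. i \<in> I \<Longrightarrow> smooth (f i)) \<Longrightarrow> smooth (\<lambda>x. \<Sum>i\<in>I. f i x)"
  by (induction I rule: infinite_finite_induct) (auto intro: smooth_const smooth_add)

lemma dir_deriv_sum:
  "(\<And>i. i \<in> I \<Longrightarrow> f i differentiable (at x)) \<Longrightarrow>
    dir_deriv v (\<lambda>x. \<Sum>i\<in>I. f i x) x = (\<Sum>i\<in>I. dir_deriv v (f i) x)"
  by (intro dir_deriv_eqI has_derivative_sum has_derivative_dir_deriv)

lemma dir_deriv_Basis:
  fixes f :: "'a::euclidean_space \<Rightarrow> 'b::real_normed_vector"
  assumes "f differentiable (at x)"
  shows "dir_deriv v f x = (\<Sum>b\<in>Basis. (v \<bullet> b) *\<^sub>R dir_deriv b f x)"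
proof -
  interpret bounded_linear "\<lambda>v. dir_deriv v f x"
    using has_derivative_dir_deriv[OF assms] by (rule has_derivative_bounded_linear)
  have "dir_deriv v f x = dir_deriv (\<Sum>b\<in>Basis. (v \<bullet> b) *\<^sub>R b) f x"
    by (simp add: euclidean_representation)
  also have "\<dots> = (\<Sum>b\<in>Basis. (v \<bullet> b) *\<^sub>R dir_deriv b f x)"
    by (simp only: sum scaleR)
  finally show ?thesis .
qed

lemma norm_dir_deriv_le:
  fixes f :: "'a::euclidean_space \<Rightarrow> 'b::real_normed_vector" and B :: real
  assumes "f differentiable (at x)" "\<And>b. b \<in> Basis \<Longrightarrow> norm (dir_deriv b f x) \<le> B"
  shows "norm (dir_deriv v f x) \<le> DIM('a) * B * norm v"
proof -
  have "norm (dir_deriv v f x) \<le> (\<Sum>b\<in>(Basis::'a set). norm ((v \<bullet> b) *\<^sub>R dir_deriv b f x))"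
    unfolding dir_deriv_Basis[OF assms(1), of v] by (rule norm_sum)
  also have "\<dots> \<le> (\<Sum>b\<in>(Basis::'a set). norm v * B)"
    by (intro sum_mono) (auto intro!: mult_mono assms simp: Basis_le_norm)
  finally show ?thesis by (simp add: mult_ac)
qed

section \<open>Supports and extension by zero\<close>

lemma dir_deriv_eq_0_outside_supp:
  assumes "x \<notin> supp f"
  shows "dir_deriv v f x = 0"
proof -
  have "dir_deriv v f x = dir_deriv v (\<lambda>x. 0) x"
    by (rule dir_deriv_cong_open[of "- supp f"])
       (use assms closure_subset[of "{x. f x \<noteq> 0}"] in \<open>auto simp: supp_def\<close>)
  then show ?thesis by simp
qed

lemma closed_supp: "closed (supp f)"
  by (simp add: supp_def)

lemma eq_0_outside_supp: "x \<notin> supp f \<Longrightarrow> f x = 0"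
  using closure_subset[of "{x. f x \<noteq> 0}"] by (auto simp: supp_def)

lemma supp_subsetI: "closed K \<Longrightarrow> (\<And>x. x \<notin> K \<Longrightarrow> f x = 0) \<Longrightarrow> supp f \<subseteq> K"
  unfolding supp_def by (intro closure_minimal) auto

lemma supp_mult:
  fixes f g :: "'a::topological_space \<Rightarrow> 'b::mult_zero"
  shows "supp (\<lambda>x. f x * g x) \<subseteq> supp f"
  by (rule supp_subsetI) (simp_all add: closed_supp eq_0_outside_supp)

lemma supp_dir_deriv: "supp (dir_deriv v f) \<subseteq> supp f"
  by (rule supp_subsetI) (auto simp: closed_supp dir_deriv_eq_0_outside_supp)

lemma compact_supp_subset: "compact K \<Longrightarrow> supp f \<subseteq> K \<Longrightarrow> compact (supp f)"
  by (metis closed_supp compact_Int_closed inf.absorb_iff2)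

lemma dir_deriv_0: "f differentiable (at x) \<Longrightarrow> dir_deriv 0 f x = 0"
  using linear_0[OF has_derivative_linear[OF has_derivative_dir_deriv]] .

lemma supp_laplacian: "supp (laplacian f) \<subseteq> supp f"
proof (rule supp_subsetI[OF closed_supp])
  fix x assume "x \<notin> supp f"
  then have "x \<notin> supp (dir_deriv v f)" for v using supp_dir_deriv by blast
  then show "laplacian f x = 0" by (simp add: laplacian_def dir_deriv_eq_0_outside_supp)
qed

lemma laplacian_prod:
  fixes \<Phi> :: "'a::euclidean_space \<times> real \<Rightarrow> 'b::real_normed_vector"
  shows "laplacian \<Phi> z = (\<Sum>b\<in>Basis. dir_deriv (b, 0) (dir_deriv (b, 0) \<Phi>) z) +
    dir_deriv (0, 1) (dir_deriv (0, 1) \<Phi>) z"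
proof -
  have "inj_on (\<lambda>b::'a. (b, 0::real)) Basis" by (auto intro!: inj_onI)
  then show ?thesis
    unfolding laplacian_def Basis_prod_def
    by (subst sum.union_disjoint) (auto simp: sum.reindex)
qed

text \<open>\<open>V\<close> and the complement of the support are open and cover the space, and
  \<open>f\<close> is zero on the latter. Thus elements of \<open>C2c V\<close> may be treated as
  C^2 functions on the whole space.\<close>

lemma Ck_on_extend:
  assumes "open V" "Ck_on k V f" "supp f \<subseteq> V"
  shows "Ck_on k UNIV f"
proof -
  have "Ck_on k (- supp f) f"
    by (rule Ck_on_cong_open[of _ "\<lambda>x. 0"]) (auto simp: eq_0_outside_supp closed_supp open_Compl)
  then have "Ck_on k (V \<union> - supp f) f"
    using assms by (intro Ck_on_Un) (auto simp: closed_supp open_Compl)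
  moreover have "V \<union> - supp f = UNIV" using assms(3) by auto
  ultimately show ?thesis by simp
qed

section \<open>Fourier transforms of compactly supported functions\<close>

lemma integrable_compact_supp:
  fixes f :: "'a::euclidean_space \<Rightarrow> 'b::{banach, second_countable_topology}"
  assumes "continuous_on UNIV f" "compact (supp f)"
  shows "integrable lborel f"
proof -
  have "integrable lborel (\<lambda>x. indicator (supp f) x *\<^sub>R f x)"
    using assms by (intro borel_integrable_compact) (auto intro: continuous_on_subset)
  moreover have "indicator (supp f) x *\<^sub>R f x = f x" for x
    by (auto simp: indicator_def eq_0_outside_supp)
  ultimately show ?thesis by simp
qed

lemma bounded_compact_supp:
  fixes f :: "'a::real_normed_vector \<Rightarrow> 'b::real_normed_vector"
  assumes "continuous_on UNIV f" "compact (supp f)"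
  obtains B where "B > 0" "\<And>x. norm (f x) \<le> B"
proof -
  have "bounded (f ` supp f)"
    using assms by (intro compact_imp_bounded compact_continuous_image) (auto intro: continuous_on_subset)
  then obtain B where "B > 0" and B: "\<And>x. x \<in> supp f \<Longrightarrow> norm (f x) \<le> B"
    unfolding bounded_pos by auto
  then have "norm (f x) \<le> B" for x
    by (cases "x \<in> supp f") (auto simp: eq_0_outside_supp)
  with \<open>B > 0\<close> that show ?thesis by blast
qed

lemma integral_shift:
  fixes f :: "'a::euclidean_space \<Rightarrow> 'b::{banach, second_countable_topology}"
  assumes "f \<in> borel_measurable borel"
  shows "(LINT x|lborel. f (t + x)) = (LINT x|lborel. f x)"
proof -
  have "(LINT x|lborel. f x) = (LINT x|distr lborel borel ((+) t). f x)"
    by (simp add: lborel_distr_plus)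
  also have "\<dots> = (LINT x|lborel. f (t + x))"
    using assms by (subst integral_distr) auto
  finally show ?thesis by simp
qed

text \<open>The derivative is the bounded limit of difference quotients, whose integrals vanish by
  translation invariance.\<close>

lemma integral_dir_deriv_eq_0:
  fixes f :: "'a::euclidean_space \<Rightarrow> 'b::euclidean_space"
  assumes diff: "\<And>x. f differentiable (at x)" and cont: "continuous_on UNIV (dir_deriv v f)"
    and supp: "compact (supp f)"
  shows "(LINT x|lborel. dir_deriv v f x) = 0"
proof -
  define q where "q n x = (n + 1) *\<^sub>R (f (x + (1 / (n + 1)) *\<^sub>R v) - f x)" for n :: nat and x
  have contf: "continuous_on UNIV f"
    using diff by (auto intro!: continuous_at_imp_continuous_on differentiable_imp_continuous_within)
  have [measurable]: "f \<in> borel_measurable borel" "dir_deriv v f \<in> borel_measurable borel"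
    using contf cont by (auto intro: borel_measurable_continuous_onI)
  have csd: "compact (supp (dir_deriv v f))"
    using compact_supp_subset[OF supp supp_dir_deriv] .
  obtain B where "B > 0" and B: "\<And>x. norm (dir_deriv v f x) \<le> B"
    using bounded_compact_supp[OF cont csd] by blast
  \<comment> \<open>All points from which a step t v with 0 <= t <= 1 reaches the support. Every
    \<open>q n\<close> vanishes off \<open>K\<close>, which gives an integrable dominating
    function.\<close>
  define K where "K = (\<lambda>(x, t). x - t *\<^sub>R v) ` (supp f \<times> {0..1::real})"
  have "compact K" unfolding K_def
    by (intro compact_continuous_image compact_Times supp)
       (auto intro!: continuous_intros simp: case_prod_beta)
  have line: "((\<lambda>t. f (x + t *\<^sub>R v)) has_vector_derivative dir_deriv v f (x + t *\<^sub>R v)) (at t)"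
    for x t
  proof -
    have "((\<lambda>t. f (x + t *\<^sub>R v)) has_derivative (\<lambda>h. dir_deriv (h *\<^sub>R v) f (x + t *\<^sub>R v))) (at t)"
      by (rule has_derivative_compose[OF _ has_derivative_dir_deriv[OF diff], of "\<lambda>t. x + t *\<^sub>R v"])
         (auto intro!: derivative_eq_intros)
    moreover have "dir_deriv (h *\<^sub>R v) f y = h *\<^sub>R dir_deriv v f y" for h y
      using has_derivative_dir_deriv[OF diff[of y]]
      by (intro linear_scale) (auto dest: has_derivative_linear)
    ultimately show ?thesis by (simp add: has_vector_derivative_def)
  qed
  have lip: "norm (f (x + t *\<^sub>R v) - f x) \<le> B * t" if "t \<ge> 0" for x t
  proof -
    have "norm (f (x + t *\<^sub>R v) - f (x + 0 *\<^sub>R v)) \<le> B * norm (t - 0)"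
      by (rule differentiable_bound[of "{0..t}" "\<lambda>t. f (x + t *\<^sub>R v)"
            "\<lambda>t h. h *\<^sub>R dir_deriv v f (x + t *\<^sub>R v)"])
         (use that line B \<open>B > 0\<close> in \<open>auto simp: has_vector_derivative_def mult.commute[of B]
            intro: has_derivative_at_withinI intro!: onorm_bound mult_left_mono\<close>)
    then show ?thesis using that by simp
  qed
  have qbound: "norm (q n x) \<le> B * indicator K x" for n x
  proof (cases "x \<in> K")
    case True
    have "norm (q n x) = (n + 1) * norm (f (x + (1 / (n + 1)) *\<^sub>R v) - f x)"
      unfolding q_def by simp
    also have "\<dots> \<le> (n + 1) * (B * (1 / (n + 1)))"
      using lip[of "1 / (real n + 1)" x] by (intro mult_left_mono) (auto simp: add.commute)
    finally have "norm (q n x) \<le> (n + 1) * (B * (1 / (n + 1)))" .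
    then show ?thesis using True by simp
  next
    case False
    have nin: "x + t *\<^sub>R v \<notin> supp f" if "t \<in> {0..1}" for t
    proof
      assume "x + t *\<^sub>R v \<in> supp f"
      then have "x \<in> K" unfolding K_def using that
        by (intro image_eqI[of _ _ "(x + t *\<^sub>R v, t)"]) auto
      with False show False by simp
    qed
    show ?thesis
      using nin[of 0] nin[of "1 / (real n + 1)"] False
      by (simp add: q_def eq_0_outside_supp add.commute)
  qed
  have "(\<lambda>n. LINT x|lborel. q n x) \<longlonglongrightarrow> (LINT x|lborel. dir_deriv v f x)"
  proof (rule integral_dominated_convergence[where w = "\<lambda>x. B * indicator K x"])
    show "integrable lborel (\<lambda>x. B * indicat_real K x)"
      using \<open>compact K\<close> emeasure_bounded_finite[OF compact_imp_bounded[OF \<open>compact K\<close>]]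
      by (intro integrable_mult_right integrable_real_indicator) (auto intro: borel_compact)
    show "AE x in lborel. (\<lambda>n. q n x) \<longlonglongrightarrow> dir_deriv v f x"
    proof (rule AE_I2)
      fix x
      let ?D = "dir_deriv v f x"
      have "((\<lambda>t. norm (f (x + t *\<^sub>R v) - f x - t *\<^sub>R ?D) / norm t) \<longlongrightarrow> 0) (at 0)"
        using line[of x 0] unfolding has_vector_derivative_def has_derivative_at by simp
      moreover have "norm (f (x + t *\<^sub>R v) - f x - t *\<^sub>R ?D) / norm t =
          norm ((f (x + t *\<^sub>R v) - f x) /\<^sub>R t - ?D)" if "t \<noteq> 0" for t
      proof -
        have "(f (x + t *\<^sub>R v) - f x) /\<^sub>R t - ?D = (f (x + t *\<^sub>R v) - f x - t *\<^sub>R ?D) /\<^sub>R t"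
          using that by (simp add: scaleR_diff_right)
        then show ?thesis by (simp add: divide_inverse mult.commute)
      qed
      ultimately have "((\<lambda>t. norm ((f (x + t *\<^sub>R v) - f x) /\<^sub>R t - ?D)) \<longlongrightarrow> 0) (at 0)"
        by (rule Lim_transform_within[OF _ zero_less_one]) auto
      then have "((\<lambda>t. (f (x + t *\<^sub>R v) - f x) /\<^sub>R t) \<longlongrightarrow> ?D) (at 0)"
        by (rule LIM_zero_cancel[OF tendsto_norm_zero_cancel])
      moreover have "filterlim (\<lambda>n. 1 / (real n + 1)) (at 0) sequentially"
        unfolding filterlim_at using LIMSEQ_inverse_real_of_nat
        by (auto simp: inverse_eq_divide add.commute)
      ultimately have "(\<lambda>n. (f (x + (1 / (real n + 1)) *\<^sub>R v) - f x) /\<^sub>R (1 / (real n + 1))) \<longlonglongrightarrow> ?D"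
        by (rule filterlim_compose)
      then show "(\<lambda>n. q n x) \<longlonglongrightarrow> ?D" by (simp add: q_def add.commute)
    qed
  qed (use qbound in \<open>auto simp: q_def\<close>)
  moreover have "(LINT x|lborel. q n x) = 0" for n
  proof -
    have i: "integrable lborel f" by (rule integrable_compact_supp[OF contf supp])
    have "integrable lborel (\<lambda>x. f (t + x))" for t
    proof -
      have "integrable (distr lborel borel ((+) t)) f" using i by (simp add: lborel_distr_plus)
      then show ?thesis by (subst (asm) integrable_distr_eq) auto
    qed
    then have "(LINT x|lborel. q n x) = (n + 1) *\<^sub>R ((LINT x|lborel. f ((1 / (n + 1)) *\<^sub>R v + x)) - (LINT x|lborel. f x))"
      unfolding q_def using i by (simp add: add.commute[of _ "_ *\<^sub>R v"])
    then show ?thesis by (simp add: integral_shift)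
  qed
  ultimately show ?thesis by (simp add: LIMSEQ_const_iff)
qed

text \<open>Unnormalised: the inversion formula carries the whole factor (2 pi)^d.\<close>

definition ft :: "('a::euclidean_space \<Rightarrow> complex) \<Rightarrow> 'a \<Rightarrow> complex" where
  "ft f \<xi> = (LINT x|lborel. f x * cis (- (x \<bullet> \<xi>)))"

lemma borel_measurable_cis [measurable (raw)]:
  "f \<in> borel_measurable M \<Longrightarrow> (\<lambda>x. cis (f x)) \<in> borel_measurable M"
  using borel_measurable_continuous_onI[OF continuous_on_cis[OF continuous_on_id]]
  by (rule measurable_compose[rotated])

lemma has_derivative_cis_inner:
  "((\<lambda>x. cis (x \<bullet> a)) has_derivative (\<lambda>h. \<i> * of_real (h \<bullet> a) * cis (x \<bullet> a))) (at x within S)"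
  by (auto intro!: derivative_eq_intros simp: scaleR_conv_of_real)

text \<open>Integration by parts: the derivative of f(x) e^(-i x . \<xi>) along \<open>v\<close> has
  integral zero, and the product rule isolates the two transforms.\<close>

lemma ft_dir_deriv:
  fixes f :: "'a::euclidean_space \<Rightarrow> complex"
  assumes diff: "\<And>x. f differentiable (at x)" and cont: "continuous_on UNIV (dir_deriv v f)"
    and supp: "compact (supp f)"
  shows "ft (dir_deriv v f) \<xi> = \<i> * of_real (v \<bullet> \<xi>) * ft f \<xi>"
proof -
  define g where "g x = f x * cis (x \<bullet> (- \<xi>))" for x
  have dg: "(g has_derivative (\<lambda>h. f x * (\<i> * of_real (h \<bullet> - \<xi>) * cis (x \<bullet> - \<xi>)) +
      dir_deriv h f x * cis (x \<bullet> - \<xi>))) (at x)" for x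
    unfolding g_def
    by (intro has_derivative_mult has_derivative_dir_deriv diff has_derivative_cis_inner)
  have eq: "dir_deriv v g = (\<lambda>x. dir_deriv v f x * cis (- (x \<bullet> \<xi>)) - \<i> * of_real (v \<bullet> \<xi>) * (f x * cis (- (x \<bullet> \<xi>))))"
    using dir_deriv_eqI[OF dg] by (auto simp: algebra_simps)
  have contf: "continuous_on UNIV f"
    using diff by (auto intro!: continuous_at_imp_continuous_on differentiable_imp_continuous_within)
  have "supp g \<subseteq> supp f"
    by (rule supp_subsetI) (auto simp: g_def eq_0_outside_supp closed_supp)
  with supp have "compact (supp g)" by (rule compact_supp_subset)
  then have "(LINT x|lborel. dir_deriv v g x) = 0"
  proof (intro integral_dir_deriv_eq_0)
    show "g differentiable (at x)" for x using dg by (auto simp: differentiable_def)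
    show "continuous_on UNIV (dir_deriv v g)" unfolding eq by (intro continuous_intros cont contf)
  qed
  moreover have "integrable lborel (\<lambda>x. f x * cis (- (x \<bullet> \<xi>)))"
    by (intro integrable_compact_supp continuous_intros contf compact_supp_subset[OF supp] supp_subsetI)
       (auto simp: closed_supp eq_0_outside_supp)
  moreover have "integrable lborel (\<lambda>x. dir_deriv v f x * cis (- (x \<bullet> \<xi>)))"
    by (intro integrable_compact_supp continuous_intros cont compact_supp_subset[OF supp] supp_subsetI)
       (auto simp: closed_supp dir_deriv_eq_0_outside_supp)
  ultimately show ?thesis by (simp add: eq ft_def)
qed

lemma borel_measurable_ft [measurable]:
  assumes [measurable]: "f \<in> borel_measurable borel"
  shows "ft f \<in> borel_measurable borel"
  unfolding ft_def[abs_def] by measurable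

lemma norm_ft_le:
  shows "norm (ft f \<xi>) \<le> (LINT x|lborel. norm (f x))"
  unfolding ft_def by (rule order.trans[OF integral_norm_bound]) (simp add: norm_mult)

lemma ft_diff:
  assumes "integrable lborel f" "integrable lborel g"
  shows "ft (\<lambda>x. f x - g x) \<xi> = ft f \<xi> - ft g \<xi>"
proof -
  have "integrable lborel (\<lambda>x. f x * cis (- (x \<bullet> \<xi>)))" if "integrable lborel f" for f
    by (rule Bochner_Integration.integrable_bound[OF that]) (use that in \<open>auto simp: norm_mult\<close>)
  with assms show ?thesis by (simp add: ft_def left_diff_distrib)
qed

section \<open>Fourier inversion\<close>

text \<open>Lebesgue measure on a Euclidean space is the image of the product measure over
  \<open>Basis\<close>, so tensor products integrate factor by factor.\<close>

lemma
  fixes f :: "'a::euclidean_space \<Rightarrow> real \<Rightarrow> 'b::{real_normed_field, banach, second_countable_topology}"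
  assumes "\<And>b. b \<in> Basis \<Longrightarrow> integrable lborel (f b)"
  shows integrable_prod_Basis: "integrable lborel (\<lambda>x. \<Prod>b\<in>Basis. f b (x \<bullet> b))"
    and integral_prod_Basis:
      "(LINT x|lborel. (\<Prod>b\<in>Basis. f b (x \<bullet> b))) = (\<Prod>b\<in>Basis. LINT t|lborel. f b t)"
proof -
  interpret product_sigma_finite "\<lambda>b::'a. lborel :: real measure" ..
  have [measurable]: "f b \<in> borel_measurable borel" if "b \<in> Basis" for b
    using borel_measurable_integrable[OF assms[OF that]] by simp
  have meas: "(\<lambda>x. \<Prod>b\<in>Basis. f b (x \<bullet> b)) \<in> borel_measurable borel"
    by (intro borel_measurable_prod) measurable
  have eq: "(\<Prod>b\<in>Basis. f b ((\<Sum>i\<in>Basis. g i *\<^sub>R i) \<bullet> b)) = (\<Prod>b\<in>Basis. f b (g b))" for g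
    by (intro prod.cong refl) simp
  show "integrable lborel (\<lambda>x. \<Prod>b\<in>Basis. f b (x \<bullet> b))"
    unfolding lborel_eq[where 'a='a]
    by (subst integrable_distr_eq[OF _ meas]) (auto simp: eq intro!: product_integrable_prod assms)
  show "(LINT x|lborel. (\<Prod>b\<in>Basis. f b (x \<bullet> b))) = (\<Prod>b\<in>Basis. LINT t|lborel. f b t)"
    unfolding lborel_eq[where 'a='a]
    by (subst integral_distr[OF _ meas]) (auto simp: eq product_integral_prod assms)
qed

section \<open>Gaussian regularisation\<close>

lemma integral_affine:
  fixes g :: "'a::euclidean_space \<Rightarrow> 'b::{banach, second_countable_topology}"
  assumes [measurable]: "g \<in> borel_measurable borel" and "c > 0"
  shows "(LINT x|lborel. g x) = c ^ DIM('a) *\<^sub>R (LINT x|lborel. g (t + c *\<^sub>R x))"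
proof -
  have "(LINT x|lborel. g x) =
      (LINT x|density (distr lborel borel (\<lambda>x. t + c *\<^sub>R x)) (\<lambda>_. ennreal (\<bar>c\<bar> ^ DIM('a))). g x)"
    using assms(2) by (subst lborel_affine[of c t]) (auto simp: ennreal_power)
  also have "\<dots> = c ^ DIM('a) *\<^sub>R (LINT x|lborel. g (t + c *\<^sub>R x))"
    using assms(2) by (subst integral_density) (auto simp: integral_distr)
  finally show ?thesis .
qed

text \<open>Kept as a product over \<open>Basis\<close>, so that its integrals reduce to the
  one-dimensional normal distribution.\<close>

definition gauss :: "'a::euclidean_space \<Rightarrow> real" where
  "gauss x = (\<Prod>b\<in>Basis. std_normal_density (x \<bullet> b))"

text \<open>The Fourier transform of \<open>gauss\<close>, by
  \<open>integral_cis_gauss\<close>.\<close>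

definition gauss_hat :: "'a::euclidean_space \<Rightarrow> real" where
  "gauss_hat x = (\<Prod>b\<in>Basis. exp (- ((x \<bullet> b)\<^sup>2) / 2))"

lemma integrable_gauss: "integrable lborel gauss"
  unfolding gauss_def[abs_def] by (rule integrable_prod_Basis) simp

lemma gauss_nonneg: "0 \<le> gauss x"
  unfolding gauss_def by (intro prod_nonneg) simp

lemma gauss_le: "gauss (x::'a) \<le> gauss (0::'a::euclidean_space)"
  unfolding gauss_def
  by (intro prod_mono) (auto simp: std_normal_density_def divide_right_mono)

lemma gauss_0: "gauss (0::'a::euclidean_space) = (1 / sqrt (2 * pi)) ^ DIM('a)"
  by (simp add: gauss_def std_normal_density_def)

lemma continuous_on_gauss: "continuous_on S gauss"
  unfolding gauss_def std_normal_density_def by (intro continuous_intros) auto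

lemma borel_measurable_gauss [measurable]: "gauss \<in> borel_measurable borel"
  by (intro borel_measurable_continuous_onI continuous_on_gauss)

lemma gauss_hat_eq: "gauss_hat (x::'a::euclidean_space) = sqrt (2 * pi) ^ DIM('a) * gauss x"
  by (simp add: gauss_hat_def gauss_def std_normal_density_def prod_dividef)

lemma gauss_hat_nonneg: "0 \<le> gauss_hat x"
  unfolding gauss_hat_def by (intro prod_nonneg) simp

lemma borel_measurable_gauss_hat [measurable]: "gauss_hat \<in> borel_measurable borel"
  unfolding gauss_hat_eq[abs_def] by measurable

lemma integral_gauss: "(LINT x|lborel. gauss x) = 1"
  unfolding gauss_def by (subst integral_prod_Basis) auto

lemma cis_inner: "cis (x \<bullet> y) = (\<Prod>b\<in>Basis. cis ((x \<bullet> b) * (y \<bullet> b)))"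
  by (subst euclidean_inner) (simp add: cis_conv_exp exp_sum[symmetric] sum_distrib_left)

lemma std_normal_char:
  "(LINT t|lborel. cis (s * t) * of_real (std_normal_density t)) = of_real (exp (- (s\<^sup>2) / 2))"
proof -
  have "char std_normal_distribution s = (LINT t|lborel. std_normal_density t *\<^sub>R cis (s * t))"
    unfolding char_def
    by (subst integral_density) (auto simp: cis_conv_exp)
  then show ?thesis
    by (simp add: char_std_normal_distribution scaleR_conv_of_real mult.commute)
qed

lemma integral_cis_gauss:
  "(LINT y|lborel. cis (x \<bullet> y) * of_real (gauss y)) = of_real (gauss_hat x)"
proof -
  have "(LINT y|lborel. cis (x \<bullet> y) * of_real (gauss y)) =
      (LINT y|lborel. (\<Prod>b\<in>Basis. cis ((x \<bullet> b) * (y \<bullet> b)) * of_real (std_normal_density (y \<bullet> b))))"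
    by (simp add: cis_inner gauss_def prod.distrib)
  also have "\<dots> = (\<Prod>b\<in>Basis. LINT t|lborel. cis ((x \<bullet> b) * t) * of_real (std_normal_density t))"
    by (rule integral_prod_Basis[where f = "\<lambda>b t. cis ((x \<bullet> b) * t) * of_real (std_normal_density t)"],
        rule Bochner_Integration.integrable_bound[of _ std_normal_density])
       (auto simp: norm_mult)
  finally show ?thesis by (simp add: std_normal_char gauss_hat_def)
qed

text \<open>The factor gauss(\<epsilon> \<xi>) makes the double integral absolutely convergent, so
  Fubini applies; the inner integral is then the transform of a Gaussian.\<close>

lemma gauss_regularized_inversion:
  fixes f :: "'a::euclidean_space \<Rightarrow> complex"
  assumes cont: "continuous_on UNIV f" and supp: "compact (supp f)" and "\<epsilon> > 0"
  shows "(LINT \<xi>|lborel. ft f \<xi> * cis (x \<bullet> \<xi>) * of_real (gauss (\<epsilon> *\<^sub>R \<xi>))) =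
    (LINT z|lborel. f (x + \<epsilon> *\<^sub>R z) * of_real (gauss_hat z))"
proof -
  have f[measurable]: "f \<in> borel_measurable borel"
    using cont by (rule borel_measurable_continuous_onI)
  define h where "h z = f (x + \<epsilon> *\<^sub>R z)" for z
  have h[measurable]: "h \<in> borel_measurable borel" unfolding h_def by measurable
  have hint: "integrable lborel h"
  proof (rule integrable_compact_supp)
    show "continuous_on UNIV h" unfolding h_def
      by (rule continuous_on_compose2[OF cont]) (auto intro!: continuous_intros)
    have "supp h \<subseteq> (\<lambda>y. (1 / \<epsilon>) *\<^sub>R (y - x)) ` supp f"
    proof (rule supp_subsetI)
      show "closed ((\<lambda>y. (1 / \<epsilon>) *\<^sub>R (y - x)) ` supp f)"
        by (intro compact_imp_closed compact_continuous_image supp) (intro continuous_intros)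
      fix z assume "z \<notin> (\<lambda>y. (1 / \<epsilon>) *\<^sub>R (y - x)) ` supp f"
      then have "x + \<epsilon> *\<^sub>R z \<notin> supp f"
        using \<open>\<epsilon> > 0\<close> by (auto simp: image_iff dest!: bspec[of _ _ "x + \<epsilon> *\<^sub>R z"])
      then show "h z = 0" by (simp add: h_def eq_0_outside_supp)
    qed
    then show "compact (supp h)"
      by (rule compact_supp_subset[rotated])
         (intro compact_continuous_image supp, intro continuous_intros)
  qed
  \<comment> \<open>\<open>h\<close> is \<open>f\<close> seen from x at scale \<epsilon>. This
    absorbs both the phase at x and the dilation into a plain transform of \<open>h\<close>.\<close>
  have scale: "ft f \<xi> * cis (x \<bullet> \<xi>) = \<epsilon> ^ DIM('a) *\<^sub>R ft h (\<epsilon> *\<^sub>R \<xi>)" for \<xi>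
  proof -
    have "ft f \<xi> = \<epsilon> ^ DIM('a) *\<^sub>R (LINT z|lborel. h z * cis (- ((x + \<epsilon> *\<^sub>R z) \<bullet> \<xi>)))"
      unfolding ft_def h_def using \<open>\<epsilon> > 0\<close> by (subst integral_affine[where c = \<epsilon> and t = x]) auto
    also have "(LINT z|lborel. h z * cis (- ((x + \<epsilon> *\<^sub>R z) \<bullet> \<xi>))) = 
        (LINT z|lborel. cis (- (x \<bullet> \<xi>)) * (h z * cis (- (z \<bullet> (\<epsilon> *\<^sub>R \<xi>)))))"
      by (intro Bochner_Integration.integral_cong) (auto simp: inner_add_left cis_mult algebra_simps)
    also have "\<dots> = cis (- (x \<bullet> \<xi>)) * ft h (\<epsilon> *\<^sub>R \<xi>)"
      unfolding ft_def by (rule integral_mult_right_zero)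
    finally show ?thesis by (simp add: cis_mult scaleR_conv_of_real mult.assoc flip: mult.commute[of "cis (- (x \<bullet> \<xi>))"])
  qed
  have "(LINT \<xi>|lborel. ft f \<xi> * cis (x \<bullet> \<xi>) * of_real (gauss (\<epsilon> *\<^sub>R \<xi>))) =
      \<epsilon> ^ DIM('a) *\<^sub>R (LINT \<xi>|lborel. ft h (0 + \<epsilon> *\<^sub>R \<xi>) * of_real (gauss (0 + \<epsilon> *\<^sub>R \<xi>)))"
    by (simp add: scale)
  also have "\<dots> = (LINT \<eta>|lborel. ft h \<eta> * of_real (gauss \<eta>))"
    using \<open>\<epsilon> > 0\<close> by (subst (2) integral_affine[where c = \<epsilon> and t = 0]) auto
  also have "\<dots> = (LINT \<eta>|lborel. (LINT z|lborel. h z * cis (- (z \<bullet> \<eta>)) * of_real (gauss \<eta>)))"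
    unfolding ft_def by simp
  also have "\<dots> = (LINT z|lborel. (LINT \<eta>|lborel. h z * cis (- (z \<bullet> \<eta>)) * of_real (gauss \<eta>)))"
  proof (rule lborel_pair.Fubini_integral)
    have "integrable (lborel \<Otimes>\<^sub>M lborel) (\<lambda>(z, \<eta>). norm (h z) * gauss \<eta>)"
      using hint by (intro lborel_pair.Fubini_integrable) (auto simp: gauss_nonneg integrable_gauss)
    then show "integrable (lborel \<Otimes>\<^sub>M lborel) (\<lambda>(z, \<eta>). h z * cis (- (z \<bullet> \<eta>)) * complex_of_real (gauss \<eta>))"
      by (rule Bochner_Integration.integrable_bound) (auto simp: norm_mult gauss_nonneg)
  qed
  also have "\<dots> = (LINT z|lborel. h z * of_real (gauss_hat (- z)))"
    by (simp add: integral_cis_gauss[symmetric] mult.assoc)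
  finally show ?thesis by (simp add: h_def gauss_hat_def)
qed

text \<open>Let \<epsilon> tend to 0 in the regularised identity. The left side is dominated by the
  integrable \<open>ft f\<close>, the right side by a bound of \<open>f\<close> times
  \<open>gauss_hat\<close>.\<close>

lemma ft_inversion:
  fixes f :: "'a::euclidean_space \<Rightarrow> complex"
  assumes cont: "continuous_on UNIV f" and supp: "compact (supp f)" and int: "integrable lborel (ft f)"
  shows "(LINT \<xi>|lborel. ft f \<xi> * cis (x \<bullet> \<xi>)) = (2 * pi) ^ DIM('a) * f x"
proof -
  have f[measurable]: "f \<in> borel_measurable borel"
    using cont by (rule borel_measurable_continuous_onI)
  define e where "e n = 1 / (real n + 1)" for n
  have e: "e \<longlonglongrightarrow> 0" "\<And>n. e n > 0"
    using LIMSEQ_inverse_real_of_nat by (auto simp: e_def[abs_def] inverse_eq_divide add.commute)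
  obtain B where "B > 0" and B: "\<And>x. norm (f x) \<le> B"
    using bounded_compact_supp[OF cont supp] by blast
  have "(\<lambda>n. LINT \<xi>|lborel. ft f \<xi> * cis (x \<bullet> \<xi>) * of_real (gauss (e n *\<^sub>R \<xi>)))
      \<longlonglongrightarrow> (LINT \<xi>|lborel. ft f \<xi> * cis (x \<bullet> \<xi>) * of_real (gauss (0::'a)))"
  proof (rule integral_dominated_convergence[where w = "\<lambda>\<xi>. norm (ft f \<xi>) * gauss (0::'a)"])
    show "AE \<xi> in lborel. (\<lambda>n. ft f \<xi> * cis (x \<bullet> \<xi>) * of_real (gauss (e n *\<^sub>R \<xi>)))
        \<longlonglongrightarrow> ft f \<xi> * cis (x \<bullet> \<xi>) * of_real (gauss (0::'a))"
    proof (rule AE_I2)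
      fix \<xi> :: 'a
      have "(\<lambda>n. e n *\<^sub>R \<xi>) \<longlonglongrightarrow> 0" using tendsto_scaleR[OF e(1) tendsto_const[of \<xi>]] by simp
      then have "(\<lambda>n. gauss (e n *\<^sub>R \<xi>)) \<longlonglongrightarrow> gauss (0::'a)"
        by (intro continuous_on_tendsto_compose[OF continuous_on_gauss[of UNIV]]) auto
      then show "(\<lambda>n. ft f \<xi> * cis (x \<bullet> \<xi>) * of_real (gauss (e n *\<^sub>R \<xi>)))
          \<longlonglongrightarrow> ft f \<xi> * cis (x \<bullet> \<xi>) * of_real (gauss (0::'a))"
        by (intro tendsto_intros)
    qed
  qed (use int in \<open>auto simp: norm_mult gauss_nonneg gauss_le intro!: mult_left_mono\<close>)
  moreover have "(\<lambda>n. LINT z|lborel. f (x + e n *\<^sub>R z) * of_real (gauss_hat z))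
      \<longlonglongrightarrow> (LINT z|lborel. f x * of_real (gauss_hat (z::'a)))"
  proof (rule integral_dominated_convergence[where w = "\<lambda>z. B * gauss_hat z"])
    show "AE z in lborel. (\<lambda>n. f (x + e n *\<^sub>R z) * of_real (gauss_hat z)) \<longlonglongrightarrow> f x * of_real (gauss_hat z)"
    proof (rule AE_I2)
      fix z :: 'a
      have "(\<lambda>n. x + e n *\<^sub>R z) \<longlonglongrightarrow> x + 0 *\<^sub>R z" by (intro tendsto_intros e)
      then have "(\<lambda>n. f (x + e n *\<^sub>R z)) \<longlonglongrightarrow> f x"
        by (intro continuous_on_tendsto_compose[OF cont]) auto
      then show "(\<lambda>n. f (x + e n *\<^sub>R z) * of_real (gauss_hat z)) \<longlonglongrightarrow> f x * of_real (gauss_hat z)"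
        by (intro tendsto_intros)
    qed
    show "integrable lborel (\<lambda>z::'a. B * gauss_hat z)"
      by (simp add: gauss_hat_eq integrable_gauss)
  qed (use B in \<open>auto simp: norm_mult gauss_hat_nonneg intro!: mult_right_mono\<close>)
  ultimately have "(LINT \<xi>|lborel. ft f \<xi> * cis (x \<bullet> \<xi>) * of_real (gauss (0::'a))) =
      (LINT z|lborel. f x * of_real (gauss_hat (z::'a)))"
    unfolding gauss_regularized_inversion[OF cont supp e(2)] by (rule LIMSEQ_unique)
  moreover have "(LINT z|lborel. gauss_hat (z::'a)) = sqrt (2 * pi) ^ DIM('a)"
    unfolding gauss_hat_eq by (simp add: integral_gauss)
  then have "(LINT z|lborel. f x * of_real (gauss_hat (z::'a))) = f x * of_real (sqrt (2 * pi) ^ DIM('a))"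
    by (simp flip: of_real_power)
  ultimately have *: "(LINT \<xi>|lborel. ft f \<xi> * cis (x \<bullet> \<xi>)) * of_real (gauss (0::'a)) =
      f x * of_real (sqrt (2 * pi) ^ DIM('a))"
    by simp
  \<comment> \<open>s = (2 pi)^(d/2) is both the inverse of gauss(0) and the integral of
    \<open>gauss_hat\<close>, so the limit identity produces the constant s * s = (2 pi)^d.\<close>
  define s where "s = complex_of_real (sqrt (2 * pi) ^ DIM('a))"
  have "gauss (0::'a) * sqrt (2 * pi) ^ DIM('a) = 1"
    unfolding gauss_0 power_mult_distrib[symmetric] by simp
  then have 1: "of_real (gauss (0::'a)) * s = 1"
    unfolding s_def of_real_mult[symmetric] by simp
  have "sqrt (2 * pi) ^ DIM('a) * sqrt (2 * pi) ^ DIM('a) = (2 * pi) ^ DIM('a)"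
    unfolding power_mult_distrib[symmetric] by simp
  then have 2: "s * s = (2 * pi) ^ DIM('a)"
    unfolding s_def of_real_mult[symmetric] by simp
  have "(LINT \<xi>|lborel. ft f \<xi> * cis (x \<bullet> \<xi>)) =
      (LINT \<xi>|lborel. ft f \<xi> * cis (x \<bullet> \<xi>)) * (of_real (gauss (0::'a)) * s)"
    unfolding 1 by simp
  also have "\<dots> = f x * s * s"
    unfolding mult.assoc[symmetric] * s_def[symmetric] by simp
  also have "\<dots> = (2 * pi) ^ DIM('a) * f x"
    unfolding mult.assoc 2 by (rule mult.commute)
  finally show ?thesis .
qed

text \<open>Uniqueness of the transform; it is the source of the symmetry of iterated derivatives in
  \<open>iter_deriv_cong\<close>.\<close>

lemma ft_eq_0_imp_eq_0:
  fixes f :: "'a::euclidean_space \<Rightarrow> complex"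
  assumes "continuous_on UNIV f" "compact (supp f)" "\<And>\<xi>. ft f \<xi> = 0"
  shows "f x = 0"
proof -
  have "ft f = (\<lambda>_. 0)" using assms(3) by auto
  then show ?thesis using ft_inversion[OF assms(1,2), of x] by simp
qed

section \<open>Rapidly decaying densities and iterated derivatives\<close>

text \<open>A condition on moments alone: this is what differentiation under the integral sign in
  \<open>ift\<close> consumes.\<close>

definition rapidly_decaying :: "('a::euclidean_space \<Rightarrow> complex) \<Rightarrow> bool" where
  "rapidly_decaying g \<longleftrightarrow> g \<in> borel_measurable borel \<and>
     (\<forall>k. integrable lborel (\<lambda>\<xi>. norm \<xi> ^ k * norm (g \<xi>)))"

definition ift :: "('a::euclidean_space \<Rightarrow> complex) \<Rightarrow> 'a \<Rightarrow> complex" where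
  "ift g x = (LINT \<xi>|lborel. g \<xi> * cis (x \<bullet> \<xi>))"

lemma rapidly_decaying_mult:
  assumes "rapidly_decaying g"
  shows "rapidly_decaying (\<lambda>\<xi>. \<i> * of_real (v \<bullet> \<xi>) * g \<xi>)"
proof -
  have [measurable]: "g \<in> borel_measurable borel" using assms by (simp add: rapidly_decaying_def)
  have "integrable lborel (\<lambda>\<xi>. norm \<xi> ^ k * norm (\<i> * of_real (v \<bullet> \<xi>) * g \<xi>))" for k
  proof (rule Bochner_Integration.integrable_bound)
    show "integrable lborel (\<lambda>\<xi>. norm v * (norm \<xi> ^ Suc k * norm (g \<xi>)))"
      using assms unfolding rapidly_decaying_def by (intro integrable_mult_right) blast
    show "AE \<xi> in lborel. norm (norm \<xi> ^ k * norm (\<i> * of_real (v \<bullet> \<xi>) * g \<xi>)) \<le>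
        norm (norm v * (norm \<xi> ^ Suc k * norm (g \<xi>)))"
    proof (rule AE_I2)
      fix \<xi> :: 'a
      have "(norm \<xi> ^ k * norm (g \<xi>)) * \<bar>v \<bullet> \<xi>\<bar> \<le> (norm \<xi> ^ k * norm (g \<xi>)) * (norm v * norm \<xi>)"
        by (intro mult_left_mono Cauchy_Schwarz_ineq2) auto
      then show "norm (norm \<xi> ^ k * norm (\<i> * of_real (v \<bullet> \<xi>) * g \<xi>)) \<le>
          norm (norm v * (norm \<xi> ^ Suc k * norm (g \<xi>)))"
        by (simp add: norm_mult abs_mult mult_ac)
    qed
  qed measurable
  then show ?thesis unfolding rapidly_decaying_def by auto
qed

lemma rapidly_decaying_integrable:
  assumes "rapidly_decaying g"
  shows "integrable lborel (\<lambda>\<xi>. g \<xi> * cis (x \<bullet> \<xi>))"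
proof (rule Bochner_Integration.integrable_bound)
  have [measurable]: "g \<in> borel_measurable borel" using assms by (simp add: rapidly_decaying_def)
  show "integrable lborel (\<lambda>\<xi>. norm \<xi> ^ 0 * norm (g \<xi>))"
    using assms unfolding rapidly_decaying_def by blast
  show "(\<lambda>\<xi>. g \<xi> * cis (x \<bullet> \<xi>)) \<in> borel_measurable lborel" by measurable
qed (simp add: norm_mult)

lemma norm_cis_minus_linear: "norm (cis t - 1 - \<i> * of_real t) \<le> t\<^sup>2"
proof -
  have "norm (cis t - 1 - \<i> * of_real t) \<le> t\<^sup>2 / 2"
    using iexp_approx1[of t 1] by (simp add: cis_conv_exp numeral_2_eq_2 diff_diff_eq)
  then show ?thesis by (rule order.trans) simp
qed

text \<open>The remainder |cis t - 1 - i t| <= t^2 at t = h . \<xi> leaves an error C |h|^2, where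
  \<open>C\<close> is the second absolute moment of \<open>g\<close>.\<close>

lemma has_derivative_ift:
  assumes "rapidly_decaying g"
  shows "(ift g has_derivative (\<lambda>h. ift (\<lambda>\<xi>. \<i> * of_real (h \<bullet> \<xi>) * g \<xi>) x)) (at x)"
proof -
  let ?D = "\<lambda>h. ift (\<lambda>\<xi>. \<i> * of_real (h \<bullet> \<xi>) * g \<xi>) x"
  have [measurable]: "g \<in> borel_measurable borel" using assms by (simp add: rapidly_decaying_def)
  have mom: "integrable lborel (\<lambda>\<xi>. norm \<xi> ^ k * norm (g \<xi>))" for k
    using assms by (auto simp: rapidly_decaying_def)
  note int = rapidly_decaying_integrable[OF rapidly_decaying_mult[OF assms]]
  note int0 = rapidly_decaying_integrable[OF assms]
  define C where "C = (LINT \<xi>|lborel. norm \<xi> ^ 2 * norm (g \<xi>))"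
  have lin: "linear ?D"
  proof (rule linearI)
    show "?D (h + k) = ?D h + ?D k" for h k
      unfolding ift_def
      by (subst Bochner_Integration.integral_add[symmetric]) (use int in \<open>auto simp: algebra_simps\<close>)
    show "?D (r *\<^sub>R h) = r *\<^sub>R ?D h" for r h
      unfolding ift_def
      by (subst integral_scaleR_right[symmetric]) (auto simp: scaleR_conv_of_real mult_ac)
  qed
  have est: "norm (ift g (x + h) - ift g x - ?D h) \<le> C * norm h ^ 2" for h
  proof -
    have "ift g (x + h) - ift g x - ?D h =
        (LINT \<xi>|lborel. g \<xi> * cis (x \<bullet> \<xi>) * (cis (h \<bullet> \<xi>) - 1 - \<i> * of_real (h \<bullet> \<xi>)))"
      unfolding ift_def
      apply (subst Bochner_Integration.integral_diff[symmetric], rule int0, rule int0)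
      apply (subst Bochner_Integration.integral_diff[symmetric], intro Bochner_Integration.integrable_diff int0, rule int)
      apply (auto simp: inner_add_left cis_mult[symmetric] algebra_simps intro!: Bochner_Integration.integral_cong)
      done
    also have "norm \<dots> \<le> (LINT \<xi>|lborel. norm h ^ 2 * (norm \<xi> ^ 2 * norm (g \<xi>)))"
    proof (rule order.trans[OF integral_norm_bound], rule integral_mono[OF integrable_norm])
      show "integrable lborel (\<lambda>\<xi>. g \<xi> * cis (x \<bullet> \<xi>) * (cis (h \<bullet> \<xi>) - 1 - \<i> * of_real (h \<bullet> \<xi>)))"
        using Bochner_Integration.integrable_diff[OF Bochner_Integration.integrable_diff[OF int0[of "x + h"] int0[of x]] int[of h x]]
        by (simp add: inner_add_left cis_mult[symmetric] algebra_simps)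
      show "integrable lborel (\<lambda>\<xi>. (norm h)\<^sup>2 * ((norm \<xi>)\<^sup>2 * norm (g \<xi>)))"
        using mom[of 2] by simp
      fix \<xi> :: 'a
      have "norm (cis (h \<bullet> \<xi>) - 1 - \<i> * of_real (h \<bullet> \<xi>)) \<le> (h \<bullet> \<xi>)\<^sup>2" by (rule norm_cis_minus_linear)
      also have "\<dots> \<le> (norm h * norm \<xi>)\<^sup>2"
        using Cauchy_Schwarz_ineq2[of h \<xi>] by (simp add: abs_le_square_iff[symmetric])
      finally have "norm (g \<xi>) * norm (cis (h \<bullet> \<xi>) - 1 - \<i> * of_real (h \<bullet> \<xi>)) \<le> norm (g \<xi>) * (norm h * norm \<xi>)\<^sup>2"
        by (intro mult_left_mono) auto
      then show "cmod (g \<xi> * cis (x \<bullet> \<xi>) * (cis (h \<bullet> \<xi>) - 1 - \<i> * of_real (h \<bullet> \<xi>)))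
          \<le> (norm h)\<^sup>2 * ((norm \<xi>)\<^sup>2 * norm (g \<xi>))"
        by (simp add: norm_mult power_mult_distrib mult_ac)
    qed
    finally show ?thesis by (simp add: C_def mult.commute)
  qed
  have "((\<lambda>h. norm (ift g (x + h) - ift g x - ?D h) / norm h) \<longlongrightarrow> 0) (at 0)"
  proof (rule tendsto_sandwich[where f = "\<lambda>_. 0" and h = "\<lambda>h. C * norm h"])
    show "\<forall>\<^sub>F h in at 0. norm (ift g (x + h) - ift g x - ?D h) / norm h \<le> C * norm h"
      using est by (intro always_eventually) (auto simp: divide_le_eq power2_eq_square mult.assoc)
    show "((\<lambda>h. C * norm h) \<longlongrightarrow> 0) (at (0::'a))"
      using tendsto_mult_right_zero[OF tendsto_norm_zero[OF tendsto_ident_at]] by auto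
  qed auto
  with lin show ?thesis
    unfolding has_derivative_at by (simp add: linear_conv_bounded_linear)
qed

lemma dir_deriv_ift: "rapidly_decaying g \<Longrightarrow> dir_deriv v (ift g) = ift (\<lambda>\<xi>. \<i> * of_real (v \<bullet> \<xi>) * g \<xi>)"
  by (rule ext) (rule dir_deriv_eqI[OF has_derivative_ift])

text \<open>A derivative of \<open>ift g\<close> is again \<open>ift\<close> of a rapidly decaying
  density, so the induction on \<open>k\<close> leaves \<open>g\<close> arbitrary.\<close>

lemma smooth_ift: 
  assumes "rapidly_decaying g"
  shows "smooth (ift g)"
proof -
  have d: "ift g differentiable (at x)" if "rapidly_decaying g" for g :: "'a \<Rightarrow> complex" and x
    using has_derivative_ift[OF that] by (auto simp: differentiable_def)
  have "Ck_on k UNIV (ift g)" for k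
    using assms
  proof (induction k arbitrary: g)
    case 0
    then show ?case using d
      by (auto intro!: continuous_at_imp_continuous_on differentiable_imp_continuous_within)
  next
    case (Suc k)
    then show ?case using d by (auto simp: dir_deriv_ift rapidly_decaying_mult)
  qed
  then show ?thesis by (simp add: smooth_def)
qed

lemma norm_ift_le: "norm (ift g x) \<le> (LINT \<xi>|lborel. norm (g \<xi>))"
  unfolding ift_def by (rule order.trans[OF integral_norm_bound]) (simp add: norm_mult)

text \<open>Iterated partial derivatives along a list of coordinates; by \<open>iter_deriv_cong\<close> only the
  number of occurrences of each coordinate matters.\<close>

definition iter_deriv :: "'d list \<Rightarrow> (real ^ 'd \<Rightarrow> complex) \<Rightarrow> real ^ 'd::finite \<Rightarrow> complex" where
  "iter_deriv is f = foldr (\<lambda>i. dir_deriv (axis i 1)) is f"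

lemma iter_deriv_Nil [simp]: "iter_deriv [] f = f"
  and iter_deriv_Cons [simp]: "iter_deriv (i # is) f = dir_deriv (axis i 1) (iter_deriv is f)"
  by (simp_all add: iter_deriv_def)

lemma iter_deriv_append: "iter_deriv (is @ js) f = iter_deriv is (iter_deriv js f)"
  by (simp add: iter_deriv_def)

lemma smooth_iter_deriv: "smooth f \<Longrightarrow> smooth (iter_deriv is f)"
  by (induction "is") (auto intro: smooth_dir_deriv)

lemma supp_iter_deriv: "supp (iter_deriv is f) \<subseteq> supp f"
  by (induction "is") (use supp_dir_deriv in \<open>auto 4 3\<close>)

lemma ft_iter_deriv:
  assumes "smooth f" "compact (supp f)"
  shows "ft (iter_deriv is f) \<xi> = (\<Prod>i\<leftarrow>is. \<i> * of_real (\<xi> $ i)) * ft f \<xi>"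
proof (induction "is")
  case (Cons i "is")
  have "ft (dir_deriv (axis i 1) (iter_deriv is f)) \<xi> =
      \<i> * of_real (axis i 1 \<bullet> \<xi>) * ft (iter_deriv is f) \<xi>"
    using smooth_iter_deriv[OF assms(1)] compact_supp_subset[OF assms(2) supp_iter_deriv]
    by (intro ft_dir_deriv smooth_differentiable smooth_continuous smooth_dir_deriv) auto
  then show ?case using Cons by (simp add: inner_axis' mult.assoc)
qed simp

lemma prod_list_eq_count:
  "(\<And>i. count_list is i = count_list js i) \<Longrightarrow> (\<Prod>i\<leftarrow>is. f i) = (\<Prod>i\<leftarrow>js. f i :: 'b::comm_monoid_mult)"
proof -
  assume a: "\<And>i. count_list is i = count_list js i"
  have "mset is = mset js" by (rule multiset_eqI) (simp add: a count_mset)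
  then show ?thesis by (metis mset_map prod_mset_prod_list)
qed

text \<open>Schwarz's theorem by Fourier uniqueness: on both sides the transform of \<open>f\<close>
  is multiplied by the same factors i \<xi>_k, up to their order.\<close>

lemma iter_deriv_cong:
  assumes "smooth f" "compact (supp f)" "\<And>i. count_list is i = count_list js i"
  shows "iter_deriv is f = iter_deriv js f"
proof
  fix x
  let ?g = "\<lambda>x. iter_deriv is f x - iter_deriv js f x"
  have c: "continuous_on UNIV (iter_deriv is f)" for "is"
    by (intro smooth_continuous smooth_iter_deriv assms)
  have i: "integrable lborel (iter_deriv is f)" for "is"
    by (intro integrable_compact_supp c compact_supp_subset[OF assms(2) supp_iter_deriv])
  have "?g x = 0"
  proof (rule ft_eq_0_imp_eq_0[of ?g])
    show "continuous_on UNIV ?g" by (intro continuous_intros c)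
    have "iter_deriv is f y = 0" if "y \<notin> supp f" for y "is"
      using that supp_iter_deriv[of "is" f] by (intro eq_0_outside_supp) auto
    then have "supp ?g \<subseteq> supp f"
      by (intro supp_subsetI) (simp_all add: closed_supp)
    then show "compact (supp ?g)" by (rule compact_supp_subset[OF assms(2)])
    show "ft ?g \<xi> = 0" for \<xi>
      by (simp add: ft_diff[OF i i] ft_iter_deriv[OF assms(1,2)] prod_list_eq_count[OF assms(3)])
  qed
  then show "iter_deriv is f x = iter_deriv js f x" by simp
qed

lemma order_of_count_list:
  assumes "\<And>i. count_list is i = \<alpha> $ i"
  shows "order_of \<alpha> = length is"
proof -
  have "(\<Sum>i\<in>UNIV. count_list is i) = length is" by (rule sum_count_set) auto
  then show ?thesis using assms by (simp add: order_of_def)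
qed

lemma multi_deriv_eq_iter_deriv:
  "\<exists>is. multi_deriv \<alpha> f = iter_deriv is f \<and> length is = order_of \<alpha>"
proof -
  let ?is = "SOME is. \<forall>i. count_list is i = \<alpha> $ i"
  have "\<forall>i. count_list ?is i = \<alpha> $ i"
    using multi_deriv_list_exists by (rule someI_ex)
  then show ?thesis
    unfolding multi_deriv_def iter_deriv_def using order_of_count_list by metis
qed

text \<open>The list that \<open>SOME\<close> picks inside \<open>multi_deriv\<close> has the same
  counts as the given one and hence the same derivative. This allows all estimates to be made with
  lists.\<close>

lemma iter_deriv_eq_multi_deriv:
  assumes "smooth f" "compact (supp f)"
  shows "\<exists>\<alpha>. iter_deriv is f = multi_deriv \<alpha> f \<and> order_of \<alpha> = length is"
proof -
  define \<alpha> where "\<alpha> = (\<chi> i. count_list is i)"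
  let ?js = "SOME js. \<forall>i. count_list js i = \<alpha> $ i"
  have "\<forall>i. count_list ?js i = \<alpha> $ i"
    using multi_deriv_list_exists by (rule someI_ex)
  then have "iter_deriv is f = iter_deriv ?js f"
    by (intro iter_deriv_cong assms) (simp add: \<alpha>_def)
  moreover have "order_of \<alpha> = length is"
    by (rule order_of_count_list) (simp add: \<alpha>_def)
  ultimately show ?thesis by (auto simp: multi_deriv_def iter_deriv_def)
qed

lemma iter_deriv_ift:
  assumes "rapidly_decaying g"
  shows "iter_deriv is (ift g) = ift (\<lambda>\<xi>. (\<Prod>i\<leftarrow>is. \<i> * of_real (\<xi> $ i)) * g \<xi>) \<and>
    rapidly_decaying (\<lambda>\<xi>. (\<Prod>i\<leftarrow>is. \<i> * of_real (\<xi> $ i)) * g \<xi>)"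
proof (induction "is")
  case (Cons i "is")
  let ?g = "\<lambda>\<xi>. (\<Prod>i\<leftarrow>is. \<i> * of_real (\<xi> $ i)) * g \<xi>"
  have "(\<lambda>\<xi>. \<i> * of_real (axis i 1 \<bullet> \<xi>) * ?g \<xi>) =
      (\<lambda>\<xi>. (\<Prod>i\<leftarrow>i # is. \<i> * of_real (\<xi> $ i)) * g \<xi>)"
    by (simp add: inner_axis' mult.assoc)
  with Cons show ?case
    using dir_deriv_ift[of ?g "axis i 1"] rapidly_decaying_mult[of ?g "axis i 1"] by simp
qed (use assms in auto)

lemma norm_iter_deriv_ift_le:
  assumes "rapidly_decaying g"
  shows "norm (iter_deriv is (ift g) x) \<le> (LINT \<xi>|lborel. norm \<xi> ^ length is * norm (g \<xi>))"
proof -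
  have le: "norm (\<Prod>i\<leftarrow>is. \<i> * of_real (\<xi> $ i)) \<le> norm \<xi> ^ length is" for \<xi> :: "real ^ 'a"
    by (induction "is") (auto simp: norm_mult intro!: mult_mono component_le_norm_cart)
  have "norm (iter_deriv is (ift g) x) \<le> (LINT \<xi>|lborel. norm ((\<Prod>i\<leftarrow>is. \<i> * of_real (\<xi> $ i)) * g \<xi>))"
    unfolding conjunct1[OF iter_deriv_ift[OF assms]] by (rule norm_ift_le)
  also have "\<dots> \<le> (LINT \<xi>|lborel. norm \<xi> ^ length is * norm (g \<xi>))"
  proof (rule integral_mono)
    show "integrable lborel (\<lambda>\<xi>. norm ((\<Prod>i\<leftarrow>is. \<i> * of_real (\<xi> $ i)) * g \<xi>))"
      using iter_deriv_ift[OF assms, of "is"] unfolding rapidly_decaying_def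
      by (auto dest!: spec[of _ "0::nat"])
    show "integrable lborel (\<lambda>\<xi>. norm \<xi> ^ length is * norm (g \<xi>))"
      using assms unfolding rapidly_decaying_def by auto
  qed (auto simp: norm_mult le intro!: mult_right_mono)
  finally show ?thesis .
qed

section \<open>Boundary values of functions with small Laplacian\<close>

text \<open>A product of one-dimensional Cauchy densities up to constants: integrable factor by
  factor, and a majorant of (1 + |\<xi>|^2)^(-d). This exponent d is the origin of the shift by
  2d.\<close>

definition cauchy_weight :: "'a::euclidean_space \<Rightarrow> real" where
  "cauchy_weight \<xi> = (\<Prod>b\<in>Basis. inverse (1 + (\<xi> \<bullet> b)\<^sup>2))"

lemma integrable_cauchy_weight: "integrable lborel cauchy_weight"
  unfolding cauchy_weight_def[abs_def]
  using integrable_inverse_1_plus_square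
  by (intro integrable_prod_Basis) (simp add: set_integrable_def)

lemma cauchy_weight_pos: "cauchy_weight \<xi> > 0"
  unfolding cauchy_weight_def by (intro prod_pos) (simp add: add_pos_nonneg)

lemma cauchy_weight_ge: "inverse ((1 + (norm \<xi>)\<^sup>2) ^ DIM('a)) \<le> cauchy_weight (\<xi>::'a::euclidean_space)"
proof -
  have "inverse ((1 + (norm \<xi>)\<^sup>2) ^ DIM('a)) = (\<Prod>b\<in>(Basis::'a set). inverse (1 + (norm \<xi>)\<^sup>2))"
    by (simp add: power_inverse)
  also have "\<dots> \<le> cauchy_weight \<xi>"
    unfolding cauchy_weight_def
  proof (rule prod_mono, rule conjI)
    fix b :: 'a assume "b \<in> Basis"
    then have "(\<xi> \<bullet> b)\<^sup>2 \<le> (norm \<xi>)\<^sup>2"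
      using Basis_le_norm[of b \<xi>] by (simp add: abs_le_square_iff[symmetric])
    then show "inverse (1 + (norm \<xi>)\<^sup>2) \<le> inverse (1 + (\<xi> \<bullet> b)\<^sup>2)"
      by (intro le_imp_inverse_le) (auto simp: add_pos_nonneg)
  qed auto
  finally show ?thesis .
qed

text \<open>Multiplication by (1 + |\<xi>|^2)^d costs at most 2^d on the unit ball and 2^d
  |\<xi>|^(2d) outside. These match the two assumed bounds, and \<open>cauchy_weight\<close> makes
  the quotient integrable.\<close>

lemma
  fixes g :: "'a::euclidean_space \<Rightarrow> complex"
  assumes [measurable]: "g \<in> borel_measurable borel"
    and A: "\<And>\<xi>. norm (g \<xi>) \<le> A" "\<And>\<xi>. norm \<xi> ^ (n + 2 * DIM('a)) * norm (g \<xi>) \<le> A'"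
  shows integrable_moment: "integrable lborel (\<lambda>\<xi>. norm \<xi> ^ n * norm (g \<xi>))"
    and integral_moment_le: "(LINT \<xi>|lborel. norm \<xi> ^ n * norm (g \<xi>)) \<le>
      2 ^ DIM('a) * (A + A') * (LINT \<xi>|lborel. cauchy_weight (\<xi>::'a))"
proof -
  let ?C = "2 ^ DIM('a) * (A + A')"
  have A0: "0 \<le> A" using A(1)[of 0] norm_ge_zero order.trans by blast
  have A0': "0 \<le> A'" using A(2)[of 0] order.trans[OF _ A(2)[of 0]] by simp
  have bound: "norm \<xi> ^ n * norm (g \<xi>) \<le> ?C * cauchy_weight \<xi>" for \<xi>
  proof -
    let ?w = "(1 + (norm \<xi>)\<^sup>2) ^ DIM('a)"
    have w: "?w > 0" by (simp add: add_pos_nonneg)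
    have "norm \<xi> ^ n * norm (g \<xi>) * ?w \<le> ?C"
    proof (cases "norm \<xi> \<le> 1")
      case True
      have "norm \<xi> ^ n * norm (g \<xi>) * ?w \<le> 1 * A * 2 ^ DIM('a)"
        using True A(1)[of \<xi>] A0 by (intro mult_mono power_mono) (auto simp: power_le_one)
      also have "\<dots> \<le> ?C" using A0' by simp
      finally show ?thesis .
    next
      case False
      then have "1 \<le> (norm \<xi>)\<^sup>2" by simp
      then have "?w \<le> (2 * (norm \<xi>)\<^sup>2) ^ DIM('a)" by (intro power_mono) auto
      then have "norm \<xi> ^ n * norm (g \<xi>) * ?w \<le> norm \<xi> ^ n * norm (g \<xi>) * (2 * (norm \<xi>)\<^sup>2) ^ DIM('a)"
        by (intro mult_left_mono) auto
      also have "\<dots> = 2 ^ DIM('a) * (norm \<xi> ^ (n + 2 * DIM('a)) * norm (g \<xi>))"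
        by (simp add: power_mult_distrib power_add power_mult[symmetric] mult_ac)
      also have "\<dots> \<le> 2 ^ DIM('a) * A'" using A(2) by (intro mult_left_mono) auto
      also have "\<dots> \<le> ?C" using A0 by simp
      finally show ?thesis .
    qed
    then have "norm \<xi> ^ n * norm (g \<xi>) \<le> ?C * inverse ?w"
      using w by (simp add: field_simps)
    also have "\<dots> \<le> ?C * cauchy_weight \<xi>"
      using A0 A0' cauchy_weight_ge[of \<xi>] by (intro mult_left_mono) auto
    finally show ?thesis .
  qed
  have iw: "integrable lborel (\<lambda>\<xi>. ?C * cauchy_weight (\<xi>::'a))"
    by (intro integrable_mult_right integrable_cauchy_weight)
  show i: "integrable lborel (\<lambda>\<xi>. norm \<xi> ^ n * norm (g \<xi>))"
    by (rule Bochner_Integration.integrable_bound[OF iw])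
       (use bound in \<open>auto intro!: AE_I2 order.trans[OF bound] abs_ge_self\<close>)
  have "(LINT \<xi>|lborel. norm \<xi> ^ n * norm (g \<xi>)) \<le> (LINT \<xi>|lborel. ?C * cauchy_weight (\<xi>::'a))"
    by (rule integral_mono[OF i iw]) (rule bound)
  then show "(LINT \<xi>|lborel. norm \<xi> ^ n * norm (g \<xi>)) \<le> ?C * (LINT \<xi>|lborel. cauchy_weight (\<xi>::'a))"
    by simp
qed

text \<open>By inversion \<open>f\<close> is, up to a constant, \<open>ift\<close> of its transform,
  and a derivative of order n is bounded by the n-th moment. Making this moment finite consumes 2d
  further powers of |\<xi>|.\<close>

lemma ft_decay_imp_smooth:
  fixes f :: "real ^ 'd \<Rightarrow> complex"
  assumes cont: "continuous_on UNIV f" and supp: "compact (supp f)"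
    and A: "\<And>p \<xi>. norm \<xi> ^ p * norm (ft f \<xi>) \<le> A p"
  shows "smooth f"
    and "norm (iter_deriv is f x) \<le>
      2 ^ CARD('d) * (LINT \<xi>|lborel. cauchy_weight (\<xi>::real ^ 'd)) * (A 0 + A (length is + 2 * CARD('d)))"
proof -
  let ?c = "complex_of_real ((2 * pi) ^ CARD('d))"
  define g where "g \<xi> = ft f \<xi> / ?c" for \<xi>
  have [measurable]: "f \<in> borel_measurable borel" using cont by (rule borel_measurable_continuous_onI)
  have gm[measurable]: "g \<in> borel_measurable borel" unfolding g_def by measurable
  \<comment> \<open>Since the constant is at least 1, dividing by it preserves the bounds
    \<open>A p\<close>.\<close>
  have "1 \<le> (2 * pi) ^ CARD('d)" using pi_gt3 by (intro one_le_power) auto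
  then have c1: "norm ?c \<ge> 1" unfolding norm_of_real by linarith
  have gle: "norm (g \<xi>) \<le> norm (ft f \<xi>)" for \<xi>
  proof -
    have "norm (ft f \<xi>) / norm ?c \<le> norm (ft f \<xi>) / 1" using c1 by (intro divide_left_mono) auto
    then show ?thesis unfolding g_def norm_divide by simp
  qed
  have gA: "norm \<xi> ^ p * norm (g \<xi>) \<le> A p" for p \<xi>
    by (rule order.trans[OF mult_left_mono[OF gle] A]) simp
  have "rapidly_decaying g"
    unfolding rapidly_decaying_def using gm gA[of _ 0] gA by (auto intro!: integrable_moment)
  have "integrable lborel (ft f)"
  proof -
    have "integrable lborel (\<lambda>\<xi>. norm \<xi> ^ 0 * norm (ft f \<xi>))"
      by (rule integrable_moment[of _ "A 0" 0]) (use A[of _ 0] A in auto)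
    then show ?thesis by (subst integrable_norm_iff[symmetric]) auto
  qed
  then have "f = ift g"
    using ft_inversion[OF cont supp] by (auto simp: ift_def g_def fun_eq_iff)
  show "smooth f" unfolding \<open>f = ift g\<close> by (rule smooth_ift) fact
  have "norm (iter_deriv is f x) \<le> (LINT \<xi>|lborel. norm \<xi> ^ length is * norm (g \<xi>))"
    unfolding \<open>f = ift g\<close> by (rule norm_iter_deriv_ift_le) fact
  also have "\<dots> \<le> 2 ^ DIM(real ^ 'd) * (A 0 + A (length is + 2 * CARD('d))) *
      (LINT \<xi>|lborel. cauchy_weight (\<xi>::real ^ 'd))"
    by (rule integral_moment_le) (use gA[of _ 0] gA in auto)
  finally show "norm (iter_deriv is f x) \<le>
      2 ^ CARD('d) * (LINT \<xi>|lborel. cauchy_weight (\<xi>::real ^ 'd)) * (A 0 + A (length is + 2 * CARD('d)))"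
    by (simp add: mult_ac)
qed

section \<open>Slices, Fubini on strips and Green's identity\<close>

lemma
  fixes F :: "'a::euclidean_space \<times> real \<Rightarrow> 'b::real_normed_vector"
  assumes "continuous_on UNIV F" "compact (supp F)"
  shows continuous_on_slice: "continuous_on UNIV (\<lambda>x. F (x, y))"
    and compact_supp_slice: "compact (supp (\<lambda>x. F (x, y)))"
proof -
  show "continuous_on UNIV (\<lambda>x. F (x, y))"
    by (rule continuous_on_compose2[OF assms(1)]) (auto intro!: continuous_intros)
  have c: "compact (fst ` supp F)"
    by (intro compact_continuous_image assms continuous_intros)
  have "supp (\<lambda>x. F (x, y)) \<subseteq> fst ` supp F"
    by (rule supp_subsetI[OF compact_imp_closed[OF c]]) (metis eq_0_outside_supp fst_conv image_eqI)
  then show "compact (supp (\<lambda>x. F (x, y)))" by (rule compact_supp_subset[OF c])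
qed

lemma Ck_on_SucD2:
  assumes "Ck_on (Suc (Suc k)) S f"
  shows "x \<in> S \<Longrightarrow> f differentiable (at x)"
    and "x \<in> S \<Longrightarrow> dir_deriv v f differentiable (at x)"
    and "Ck_on k S (dir_deriv w (dir_deriv v f))"
  using assms by auto

lemma dir_deriv_slice1:
  assumes "F differentiable (at (x, y))"
  shows "(\<lambda>x. F (x, y)) differentiable (at x)"
    and "dir_deriv v (\<lambda>x. F (x, y)) x = dir_deriv (v, 0) F (x, y)"
proof -
  have "((\<lambda>x. (x, y)) has_derivative (\<lambda>v. (v, 0))) (at x)"
    by (intro has_derivative_Pair has_derivative_ident has_derivative_const)
  then have "((\<lambda>x. F (x, y)) has_derivative (\<lambda>v. dir_deriv (v, 0) F (x, y))) (at x)"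
    using has_derivative_compose[of "\<lambda>x. (x, y)" "\<lambda>v. (v, 0)" x UNIV F "\<lambda>v. dir_deriv v F (x, y)"]
      has_derivative_dir_deriv[OF assms] by auto
  then show "(\<lambda>x. F (x, y)) differentiable (at x)"
    "dir_deriv v (\<lambda>x. F (x, y)) x = dir_deriv (v, 0) F (x, y)"
    by (auto simp: differentiable_def intro: dir_deriv_eqI)
qed

lemma has_vector_derivative_slice2:
  fixes F :: "'a::real_normed_vector \<times> real \<Rightarrow> 'b::real_normed_vector"
  assumes "F differentiable (at (x, y))"
  shows "((\<lambda>y. F (x, y)) has_vector_derivative dir_deriv (0, 1) F (x, y)) (at y within S)"
proof -
  have d: "(F has_derivative (\<lambda>v. dir_deriv v F (x, y))) (at (x, y))"
    by (rule has_derivative_dir_deriv[OF assms])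
  have "((\<lambda>y. (x, y)) has_derivative (\<lambda>t. (0, t))) (at y within S)"
    by (intro has_derivative_Pair has_derivative_ident has_derivative_const)
  then have "((\<lambda>y. F (x, y)) has_derivative (\<lambda>t. dir_deriv (0, t) F (x, y))) (at y within S)"
    using has_derivative_compose[of "\<lambda>y. (x, y)" "\<lambda>t. (0, t)" y S F "\<lambda>v. dir_deriv v F (x, y)"]
      d by auto
  moreover have "dir_deriv (0, t) F (x, y) = t *\<^sub>R dir_deriv (0, 1) F (x, y)" for t
    using linear_scale[OF has_derivative_linear[OF d], of t "(0, 1)"] by simp
  then have "(\<lambda>t. dir_deriv (0, t) F (x, y)) = (\<lambda>t. t *\<^sub>R dir_deriv (0, 1) F (x, y))" by (rule ext)
  ultimately show ?thesis unfolding has_vector_derivative_def by (rule has_derivative_eq_rhs)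
qed

lemma Fubini_strip:
  fixes F :: "'a::euclidean_space \<times> real \<Rightarrow> complex"
  assumes "continuous_on UNIV F" "compact (supp F)"
  shows "(LINT y|lborel. (LINT x|lborel. indicator {a..b} y *\<^sub>R F (x, y))) =
    (LINT x|lborel. (LINT y|lborel. indicator {a..b} y *\<^sub>R F (x, y)))"
proof (rule lborel_pair.Fubini_integral)
  have i: "integrable (lborel \<Otimes>\<^sub>M lborel) F"
    using integrable_compact_supp[OF assms] by (simp add: lborel_prod)
  then have [measurable]: "F \<in> borel_measurable (lborel \<Otimes>\<^sub>M lborel)" by simp
  have "(\<lambda>z. indicator {a..b} (snd z) *\<^sub>R F z) \<in> borel_measurable (lborel \<Otimes>\<^sub>M lborel)"
    by measurable
  then have "(\<lambda>(x, y). indicator {a..b} y *\<^sub>R F (x, y)) \<in> borel_measurable (lborel \<Otimes>\<^sub>M lborel)"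
    by (simp add: case_prod_beta)
  with i show "integrable (lborel \<Otimes>\<^sub>M lborel) (\<lambda>(x, y). indicator {a..b} y *\<^sub>R F (x, y))"
    by (rule Bochner_Integration.integrable_bound) (auto simp: indicator_def)
qed

text \<open>Green's identity on a strip, tested against the harmonic function
  \<open>e\<^bsup>-i x\<cdot>\<xi> - s y\<^esup>\<close>, \<open>s = \<plusminus>|\<xi>|\<close>.\<close>

lemma green_strip:
  fixes \<Phi> :: "'a::euclidean_space \<times> real \<Rightarrow> complex"
  assumes C2: "Ck_on 2 UNIV \<Phi>" and supp: "compact (supp \<Phi>)" and s: "s\<^sup>2 = (norm \<xi>)\<^sup>2" and "a \<le> b"
  defines "T \<equiv> \<lambda>y. (ft (\<lambda>x. dir_deriv (0, 1) \<Phi> (x, y)) \<xi> + of_real s * ft (\<lambda>x. \<Phi> (x, y)) \<xi>) * exp (- of_real (s * y))"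
  shows "(LINT y|lborel. indicator {a..b} y *\<^sub>R
      (LINT x|lborel. laplacian \<Phi> (x, y) * cis (- (x \<bullet> \<xi>)) * exp (- of_real (s * y)))) = T b - T a"
proof -
  have C2': "Ck_on (Suc (Suc 0)) UNIV \<Phi>" using C2 by (simp add: numeral_2_eq_2)
  note d = Ck_on_SucD2(1,2)[OF C2', OF UNIV_I]
  have c2: "continuous_on UNIV (dir_deriv w (dir_deriv v \<Phi>))" for v w
    using Ck_on_SucD2(3)[OF C2'] by simp
  have c1: "continuous_on UNIV (dir_deriv v \<Phi>)" for v
    by (intro continuous_at_imp_continuous_on ballI differentiable_imp_continuous_within d(2))
  have c0: "continuous_on UNIV \<Phi>"
    using d(1) by (auto intro!: continuous_at_imp_continuous_on differentiable_imp_continuous_within)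
  have s1: "compact (supp (dir_deriv v \<Phi>))" for v
    by (rule compact_supp_subset[OF supp supp_dir_deriv])
  have s2: "compact (supp (dir_deriv w (dir_deriv v \<Phi>)))" for v w
    by (rule compact_supp_subset[OF s1 supp_dir_deriv])
  \<comment> \<open>Adding and subtracting s^2 \<Phi> splits the Laplacian. Under the transform in x
    the x-Laplacian acts as -|\<xi>|^2 = -s^2, so \<open>P\<close> disappears; \<open>Q\<close>
    becomes an exact y-derivative after multiplication by e^(-s y).\<close>
  define Q where "Q z = dir_deriv (0, 1) (dir_deriv (0, 1) \<Phi>) z - of_real (s\<^sup>2) * \<Phi> z" for z
  define P where "P z = (\<Sum>b\<in>Basis. dir_deriv (b, 0) (dir_deriv (b, 0) \<Phi>) z) + of_real (s\<^sup>2) * \<Phi> z" for z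
  define w where "w y = exp (- of_real (s * y) :: complex)" for y
  have PQ: "laplacian \<Phi> z = P z + Q z" for z by (simp add: laplacian_prod P_def Q_def)
  have cP: "continuous_on UNIV P" and cQ: "continuous_on UNIV Q"
    unfolding P_def Q_def by (intro continuous_intros c0 c2)+
  have sP: "supp P \<subseteq> supp \<Phi>" and sQ: "supp Q \<subseteq> supp \<Phi>"
  proof -
    have "dir_deriv w (dir_deriv v \<Phi>) z = 0" if "z \<notin> supp \<Phi>" for v w z
      using that supp_dir_deriv[of v \<Phi>] by (intro dir_deriv_eq_0_outside_supp) auto
    then show "supp P \<subseteq> supp \<Phi>" "supp Q \<subseteq> supp \<Phi>"
      by (intro supp_subsetI closed_supp; simp add: P_def Q_def eq_0_outside_supp)+
  qed
  have int: "integrable lborel (\<lambda>x. F (x, y) * cis (- (x \<bullet> \<xi>)))"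
    if "continuous_on UNIV F" "compact (supp F)" for F and y :: real
    using continuous_on_slice[OF that, of y] compact_supp_slice[OF that, of y]
    by (intro integrable_compact_supp continuous_intros compact_supp_subset[OF _ supp_mult])
  have ftP: "(LINT x|lborel. P (x, y) * cis (- (x \<bullet> \<xi>))) = 0" for y
  proof -
    let ?f = "\<lambda>x. \<Phi> (x, y)"
    have *: "(LINT x|lborel. dir_deriv (b, 0) (dir_deriv (b, 0) \<Phi>) (x, y) * cis (- (x \<bullet> \<xi>))) =
        - of_real ((b \<bullet> \<xi>)\<^sup>2) * ft ?f \<xi>" for b
    proof -
      have 1: "dir_deriv b ?f = (\<lambda>x. dir_deriv (b, 0) \<Phi> (x, y))"
        using d(1) by (auto simp: dir_deriv_slice1)
      have 2: "dir_deriv b (\<lambda>x. dir_deriv (b, 0) \<Phi> (x, y)) = (\<lambda>x. dir_deriv (b, 0) (dir_deriv (b, 0) \<Phi>) (x, y))"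
        using d(2) by (auto simp: dir_deriv_slice1)
      have "ft (dir_deriv b (\<lambda>x. dir_deriv (b, 0) \<Phi> (x, y))) \<xi> =
          \<i> * of_real (b \<bullet> \<xi>) * ft (\<lambda>x. dir_deriv (b, 0) \<Phi> (x, y)) \<xi>"
        by (rule ft_dir_deriv)
           (auto simp: 2 intro!: dir_deriv_slice1 d continuous_on_slice compact_supp_slice c1 c2 s1 s2)
      moreover have "ft (dir_deriv b ?f) \<xi> = \<i> * of_real (b \<bullet> \<xi>) * ft ?f \<xi>"
        by (rule ft_dir_deriv)
           (auto simp: 1 intro!: dir_deriv_slice1 d continuous_on_slice compact_supp_slice c0 c1 supp s1)
      ultimately show ?thesis
        unfolding 1 2 by (simp add: ft_def power2_eq_square mult_ac)
    qed
    have n: "(\<Sum>b\<in>Basis. (b \<bullet> \<xi>)\<^sup>2) = s\<^sup>2"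
      unfolding s by (subst euclidean_inner[of \<xi> \<xi>, folded power2_norm_eq_inner]) 
        (simp add: power2_eq_square inner_commute)
    have "(LINT x|lborel. P (x, y) * cis (- (x \<bullet> \<xi>))) =
        (\<Sum>b\<in>Basis. LINT x|lborel. dir_deriv (b, 0) (dir_deriv (b, 0) \<Phi>) (x, y) * cis (- (x \<bullet> \<xi>))) +
        of_real (s\<^sup>2) * ft ?f \<xi>"
      unfolding P_def ft_def distrib_right sum_distrib_right mult.assoc
      by (subst Bochner_Integration.integral_add)
         (use c0 c2 s2 supp in \<open>auto intro!: Bochner_Integration.integrable_sum integrable_mult_right int
            Bochner_Integration.integral_sum\<close>)
    also have "\<dots> = 0"
      unfolding * n[symmetric] by (simp add: sum_negf sum_distrib_right[symmetric])
    finally show ?thesis .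
  qed
  have "(LINT x|lborel. laplacian \<Phi> (x, y) * cis (- (x \<bullet> \<xi>)) * w y) =
      (LINT x|lborel. Q (x, y) * cis (- (x \<bullet> \<xi>)) * w y)" for y
    unfolding PQ distrib_right
    by (subst Bochner_Integration.integral_add)
       (auto intro!: integrable_mult_left int cP cQ compact_supp_subset[OF supp] sP sQ simp: ftP)
  then have "(LINT y|lborel. indicator {a..b} y *\<^sub>R
        (LINT x|lborel. laplacian \<Phi> (x, y) * cis (- (x \<bullet> \<xi>)) * w y)) =
      (LINT y|lborel. indicator {a..b} y *\<^sub>R (LINT x|lborel. Q (x, y) * cis (- (x \<bullet> \<xi>)) * w y))"
    by (simp only:)
  also have "\<dots> = (LINT y|lborel. (LINT x|lborel. indicator {a..b} y *\<^sub>R (Q (x, y) * cis (- (x \<bullet> \<xi>)) * w y)))"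
    by simp
  also have "\<dots> = (LINT x|lborel. (LINT y|lborel. indicator {a..b} y *\<^sub>R (Q (x, y) * cis (- (x \<bullet> \<xi>)) * w y)))"
  proof -
    let ?F = "\<lambda>z. Q z * cis (- (fst z \<bullet> \<xi>)) * w (snd z)"
    have "continuous_on UNIV ?F" unfolding w_def by (intro continuous_intros cQ)
    moreover have "compact (supp ?F)"
      by (rule compact_supp_subset[OF supp])
         (rule order.trans[OF supp_mult order.trans[OF supp_mult sQ]])
    ultimately show ?thesis using Fubini_strip[of ?F a b] by simp
  qed
  also have "\<dots> = (LINT x|lborel. cis (- (x \<bullet> \<xi>)) *
      ((dir_deriv (0, 1) \<Phi> (x, b) + of_real s * \<Phi> (x, b)) * w b - (dir_deriv (0, 1) \<Phi> (x, a) + of_real s * \<Phi> (x, a)) * w a))"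
  proof (rule Bochner_Integration.integral_cong[OF refl])
    fix x
    have "(LINT y|lborel. indicator {a..b} y *\<^sub>R (Q (x, y) * w y)) =
        (dir_deriv (0, 1) \<Phi> (x, b) + of_real s * \<Phi> (x, b)) * w b - (dir_deriv (0, 1) \<Phi> (x, a) + of_real s * \<Phi> (x, a)) * w a"
    \<comment> \<open>The antiderivative is (d_y \<Phi> + s \<Phi>) e^(-s y); the mixed terms s d_y
      \<Phi> cancel in its derivative.\<close>
    proof (rule integral_FTC_Icc[OF \<open>a \<le> b\<close>])
      fix y
      have dw: "(w has_vector_derivative - of_real s * w y) (at y within {a..b})"
        unfolding w_def of_real_mult
        by (rule has_vector_derivative_eq_rhs[OF has_vector_derivative_real_field[of "\<lambda>z. exp (- (of_real s * z))"]])
           (auto intro!: derivative_eq_intros)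
      show "((\<lambda>y. (dir_deriv (0, 1) \<Phi> (x, y) + of_real s * \<Phi> (x, y)) * w y) has_vector_derivative
          Q (x, y) * w y) (at y within {a..b})"
        by (rule has_vector_derivative_eq_rhs[OF has_vector_derivative_mult[OF has_vector_derivative_add[OF
                has_vector_derivative_slice2[OF d(2)] has_vector_derivative_mult_right[OF
                has_vector_derivative_slice2[OF d(1)]]] dw]])
           (simp add: Q_def power2_eq_square algebra_simps)
    next
      show "continuous_on {a..b} (\<lambda>y. Q (x, y) * w y)"
        unfolding w_def by (intro continuous_intros continuous_on_compose2[OF cQ]) auto
    qed
    then show "(LINT y|lborel. indicator {a..b} y *\<^sub>R (Q (x, y) * cis (- (x \<bullet> \<xi>)) * w y)) =
        cis (- (x \<bullet> \<xi>)) * ((dir_deriv (0, 1) \<Phi> (x, b) + of_real s * \<Phi> (x, b)) * w b -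
          (dir_deriv (0, 1) \<Phi> (x, a) + of_real s * \<Phi> (x, a)) * w a)"
      using integral_mult_right_zero[of lborel "cis (- (x \<bullet> \<xi>))" "\<lambda>y. indicator {a..b} y *\<^sub>R (Q (x, y) * w y)"]
      by (simp add: mult_ac)
  qed
  also have "\<dots> = T b - T a"
  proof -
    have i0: "integrable lborel (\<lambda>x. \<Phi> (x, y) * cis (- (x \<bullet> \<xi>)))"
      and i1: "integrable lborel (\<lambda>x. dir_deriv (0, 1) \<Phi> (x, y) * cis (- (x \<bullet> \<xi>)))" for y
      by (intro int c0 c1 supp s1)+
    have "T y = (LINT x|lborel. (dir_deriv (0, 1) \<Phi> (x, y) * cis (- (x \<bullet> \<xi>)) +
        of_real s * (\<Phi> (x, y) * cis (- (x \<bullet> \<xi>)))) * w y)" for y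
      unfolding T_def ft_def w_def using i0[of y] i1[of y] by simp
    then show ?thesis
      using i0 i1
      by (simp add: Bochner_Integration.integral_diff[symmetric] algebra_simps del: Bochner_Integration.integral_diff Bochner_Integration.integral_add integral_mult_right_zero integral_mult_left_zero)
  qed
  finally show ?thesis unfolding w_def .
qed

lemma power_div_fact_le_exp:
  fixes t :: real
  assumes "0 \<le> t"
  shows "t ^ p / fact p \<le> exp t"
proof -
  have "(\<Sum>n\<in>{p}. t ^ n /\<^sub>R fact n) \<le> (\<Sum>n. t ^ n /\<^sub>R fact n)"
    using assms by (intro sum_le_suminf summable_exp_generic) auto
  then show ?thesis by (simp add: exp_def divide_inverse mult.commute)
qed

text \<open>Let v and u be the transforms of the trace and of the normal derivative. The upper strip
  with s = |\<xi>| controls u + |\<xi>| v, the lower strip with s = -|\<xi>| controls u - |\<xi>| v;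
  sum and difference separate them. The factor |\<xi>| in front of v explains
  \<open>Suc p\<close>.\<close>

lemma boundary_ft_estimate:
  fixes \<Phi> :: "'a::euclidean_space \<times> real \<Rightarrow> complex"
  assumes C2: "Ck_on 2 UNIV \<Phi>" and supp: "compact (supp \<Phi>)"
    and D: "\<And>p x y. y \<noteq> 0 \<Longrightarrow> norm (laplacian \<Phi> (x, y)) \<le> D p * (\<bar>y\<bar> ^ p / fact p)"
  obtains B where "B > 0"
    and "\<And>p \<xi>. norm \<xi> ^ p * norm (ft (\<lambda>x. dir_deriv (0, 1) \<Phi> (x, 0)) \<xi>) \<le> B * D p"
    and "\<And>p \<xi>. norm \<xi> ^ Suc p * norm (ft (\<lambda>x. \<Phi> (x, 0)) \<xi>) \<le> B * D p"
proof -
  have D0: "D p \<ge> 0" for p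
  proof -
    \<comment> \<open>At y = 1 the assumed bound has a positive cofactor, which forces the sign of
      \<open>D p\<close>.\<close>
    have "0 \<le> D p * (\<bar>1\<bar> ^ p / fact p)"
      by (rule order.trans[OF norm_ge_zero D[of 1 undefined]]) simp
    then show ?thesis using fact_gt_zero[of p, where 'a=real] by (simp add: zero_le_divide_iff)
  qed
  obtain R where "R > 0" and R: "\<forall>z\<in>supp \<Phi>. norm z \<le> R"
    using compact_imp_bounded[OF supp] by (auto simp: bounded_pos)
  have R1: "norm x \<le> R" and R2: "\<bar>y\<bar> \<le> R" if "(x, y) \<in> supp \<Phi>" for x y
    using bspec[OF R that] norm_fst_le[of x y] norm_snd_le[of y x] by auto
  have lap0: "laplacian \<Phi> z = 0" if "z \<notin> supp \<Phi>" for z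
    using that supp_laplacian[of \<Phi>] by (intro eq_0_outside_supp) auto
  define vol where "vol = measure lborel (cball (0::'a) R)"
  define T where "T s y \<xi> = (ft (\<lambda>x. dir_deriv (0, 1) \<Phi> (x, y)) \<xi> + of_real s * ft (\<lambda>x. \<Phi> (x, y)) \<xi>) *
      exp (- of_real (s * y))" for s y and \<xi> :: 'a
  \<comment> \<open>The height R + 1 of the strip times the volume of a ball containing the
    x-projection of the support; the last 1 ensures positivity.\<close>
  define B where "B = (R + 1) * vol + 1"
  have key: "norm \<xi> ^ p * norm (T s b \<xi> - T s a \<xi>) \<le> B * D p"
    if s: "\<bar>s\<bar> = norm \<xi>" and ab: "b = a + (R + 1)" "\<And>y. y \<in> {a..b} \<Longrightarrow> s * y \<ge> 0" for s a b p \<xi>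
  proof -
    let ?in = "\<lambda>y. (LINT x|lborel. laplacian \<Phi> (x, y) * cis (- (x \<bullet> \<xi>)) * exp (- of_real (s * y)))"
    have inner: "norm \<xi> ^ p * norm (?in y) \<le> D p * vol" if y: "y \<in> {a..b}" "y \<noteq> 0" for y
    proof -
      have "norm (laplacian \<Phi> (x, y) * cis (- (x \<bullet> \<xi>)) * exp (- of_real (s * y))) \<le>
          indicator (cball 0 R) x * (D p * (\<bar>y\<bar> ^ p / fact p) * exp (- (s * y)))" for x
      proof (cases "x \<in> cball 0 R")
        case True
        then show ?thesis using mult_right_mono[OF D[OF y(2), of x p], of "exp (- (s * y))"]
          by (simp add: norm_mult)
      next
        case False
        then have "(x, y) \<notin> supp \<Phi>" using R1 by auto
        then show ?thesis using False by (simp add: lap0)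
      qed
      then have "norm (?in y) \<le> (LINT x|lborel. indicator (cball (0::'a) R) x * (D p * (\<bar>y\<bar> ^ p / fact p) * exp (- (s * y))))"
        using emeasure_bounded_finite[OF bounded_cball[of "0::'a" R]] D0
        by (intro order.trans[OF integral_norm_bound] integral_mono_AE')
           (auto intro!: integrable_mult_left integrable_real_indicator)
      also have "\<dots> = D p * vol * ((\<bar>y\<bar> ^ p / fact p) * exp (- (s * y)))"
        unfolding vol_def by simp
      finally have "norm \<xi> ^ p * norm (?in y) \<le> norm \<xi> ^ p * (D p * vol * ((\<bar>y\<bar> ^ p / fact p) * exp (- (s * y))))"
        by (intro mult_left_mono) auto
      also have "\<dots> = D p * vol * (((norm \<xi> * \<bar>y\<bar>) ^ p / fact p) * exp (- (norm \<xi> * \<bar>y\<bar>)))"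
      proof -
        have "norm \<xi> * \<bar>y\<bar> = s * y"
          using ab(2)[OF y(1)] unfolding s[symmetric] abs_mult[symmetric] by simp
        then show ?thesis by (simp add: power_mult_distrib[symmetric] mult_ac)
      qed
      also have "\<dots> \<le> D p * vol * (exp (norm \<xi> * \<bar>y\<bar>) * exp (- (norm \<xi> * \<bar>y\<bar>)))"
        using D0[of p] by (intro mult_left_mono mult_right_mono power_div_fact_le_exp) (auto simp: vol_def)
      also have "\<dots> = D p * vol" by (simp flip: exp_add)
      finally show ?thesis .
    qed
    have "a \<le> b" using ab \<open>R > 0\<close> by simp
    have s2: "s\<^sup>2 = (norm \<xi>)\<^sup>2" using s by (metis power2_abs)
    have "T s b \<xi> - T s a \<xi> = (LINT y|lborel. indicator {a..b} y *\<^sub>R ?in y)"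
      unfolding T_def using green_strip[OF C2 supp s2 \<open>a \<le> b\<close>] by simp
    then have "norm \<xi> ^ p * norm (T s b \<xi> - T s a \<xi>) = norm (LINT y|lborel. norm \<xi> ^ p *\<^sub>R (indicator {a..b} y *\<^sub>R ?in y))"
      by (simp only: integral_scaleR_right norm_scaleR power_abs abs_norm_cancel)
    also have "\<dots> \<le> (LINT y|lborel. indicator {a..b} y * (D p * vol))"
    proof (intro order.trans[OF integral_norm_bound] integral_mono_AE')
      \<comment> \<open>The Laplacian is bounded only for y \<noteq> 0, and the excluded height is a
        null set.\<close>
      show "AE y in lborel. norm (norm \<xi> ^ p *\<^sub>R (indicator {a..b} y *\<^sub>R ?in y)) \<le> indicator {a..b} y * (D p * vol)"
        using AE_lborel_singleton[of "0::real"]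
      proof eventually_elim
        case (elim y)
        then show ?case using inner[of y] by (auto simp: indicator_def)
      qed
    qed (use D0 in \<open>auto simp: vol_def emeasure_lborel_Icc_eq
        intro!: integrable_mult_left integrable_real_indicator\<close>)
    also have "\<dots> = (b - a) * (D p * vol)" using \<open>a \<le> b\<close> by simp
    also have "\<dots> \<le> B * D p" using D0[of p] unfolding B_def ab by (simp add: algebra_simps)
    finally show ?thesis .
  qed
  \<comment> \<open>The height R + 1 lies beyond the support, so of the two boundary terms only the
    one at y = 0 survives.\<close>
  have T0: "T s y \<xi> = 0" if "\<bar>y\<bar> = R + 1" for s y \<xi>
  proof -
    have "(x, y) \<notin> supp \<Phi>" for x using R2[of x y] that by auto
    then show ?thesis by (simp add: T_def ft_def eq_0_outside_supp dir_deriv_eq_0_outside_supp)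
  qed
  show ?thesis
  proof (rule that[of B])
    show "B > 0" using \<open>R > 0\<close> unfolding B_def vol_def by (simp add: add_nonneg_pos)
    fix p and \<xi> :: 'a
    let ?k = "norm \<xi>"
    let ?u = "ft (\<lambda>x. dir_deriv (0, 1) \<Phi> (x, 0)) \<xi>" and ?v = "of_real ?k * ft (\<lambda>x. \<Phi> (x, 0)) \<xi>"
    have 1: "?k ^ p * norm (?u + ?v) \<le> B * D p"
      using key[of ?k \<xi> "R + 1" 0 p] T0[of "R + 1" ?k \<xi>] \<open>R > 0\<close> by (simp add: T_def norm_minus_commute) 
    have 2: "?k ^ p * norm (?u - ?v) \<le> B * D p"
      using key[of "- ?k" \<xi> 0 "- (R + 1)" p] T0[of "- (R + 1)" "- ?k" \<xi>] \<open>R > 0\<close>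
      by (simp add: T_def mult_nonneg_nonpos)
    have "norm (2 * ?u) \<le> norm (?u + ?v) + norm (?u - ?v)"
      using norm_triangle_ineq[of "?u + ?v" "?u - ?v"] by simp
    then have "?k ^ p * (2 * norm ?u) \<le> ?k ^ p * (norm (?u + ?v) + norm (?u - ?v))"
      by (intro mult_left_mono) (auto simp: norm_mult)
    with 1 2 show "?k ^ p * norm ?u \<le> B * D p" by (simp add: distrib_left)
    have "norm (2 * ?v) \<le> norm (?u + ?v) + norm (?u - ?v)"
      using norm_triangle_ineq4[of "?u + ?v" "?u - ?v"] by simp
    then have "?k ^ p * (2 * norm ?v) \<le> ?k ^ p * (norm (?u + ?v) + norm (?u - ?v))"
      by (intro mult_left_mono) (auto simp: norm_mult)
    with 1 2 show "?k ^ Suc p * norm (ft (\<lambda>x. \<Phi> (x, 0)) \<xi>) \<le> B * D p"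
      by (simp add: distrib_left norm_mult mult_ac)
  qed
qed

section \<open>Weight sequences\<close>

lemma weight_sequenceD:
  assumes "weight_sequence M"
  shows "M p > 0" "M 0 = 1" "p \<ge> 1 \<Longrightarrow> p \<le> q \<Longrightarrow> quot_seq M p \<le> quot_seq M q"
    and "quot_seq M p > 0" "seq_star M p > 0" "seq_star M 0 = 1"
    and "p \<ge> 1 \<Longrightarrow> quot_seq_star M p > 0"
    and "seq_star M (Suc p) = quot_seq_star M (Suc p) * seq_star M p"
proof -
  have pos: "M p > 0" for p using assms by (simp add: weight_sequence_def)
  show "M p > 0" by (rule pos)
  show "quot_seq M p > 0" and "seq_star M p > 0" and "p \<ge> 1 \<Longrightarrow> quot_seq_star M p > 0"
    by (simp_all add: quot_seq_def seq_star_def quot_seq_star_def pos)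
  show "p \<ge> 1 \<Longrightarrow> p \<le> q \<Longrightarrow> quot_seq M p \<le> quot_seq M q"
    using assms by (auto simp: weight_sequence_def mono_on_def)
  show "M 0 = 1" and "seq_star M 0 = 1" using assms by (auto simp: weight_sequence_def seq_star_def)
  show "seq_star M (Suc p) = quot_seq_star M (Suc p) * seq_star M p"
    using less_imp_neq[OF pos[of p]] by (simp add: seq_star_def quot_seq_star_def quot_seq_def del: of_nat_Suc)
qed

text \<open>As the quotients increase, the part of the convergent series between P and n is at least
  (n - P) / m_n, and n >= 2P + 1 gives n - P >= n/2. So n / m_n inherits the smallness of the
  tails.\<close>

lemma non_quasianalytic_imp_quot_seq_star_at_top:
  assumes M: "weight_sequence M" and nqa: "non_quasianalytic M"
  shows "filterlim (quot_seq_star M) at_top sequentially"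
  unfolding filterlim_at_top_gt[where c = 0]
proof (intro allI impI)
  fix Z :: real assume "Z > 0"
  define e where "e = 1 / (2 * Z)"
  have "e > 0" using \<open>Z > 0\<close> by (simp add: e_def)
  then obtain P where P: "\<And>m n. m \<ge> P \<Longrightarrow> norm (\<Sum>k=m..<n. 1 / quot_seq M (Suc k)) < e"
    using nqa unfolding non_quasianalytic_def summable_Cauchy by blast
  have "Z \<le> quot_seq_star M n" if n: "n \<ge> 2 * P + 1" for n
  proof -
    have m: "quot_seq M n > 0" by (rule weight_sequenceD[OF M])
    have "(\<Sum>k=P..<n. 1 / quot_seq M n) \<le> (\<Sum>k=P..<n. 1 / quot_seq M (Suc k))"
      using weight_sequenceD(4)[OF M] m
      by (intro sum_mono divide_left_mono weight_sequenceD(3)[OF M] mult_pos_pos) auto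
    also have "\<dots> \<le> norm (\<Sum>k=P..<n. 1 / quot_seq M (Suc k))" by simp
    also have "\<dots> < e" by (rule P) simp
    finally have "(real n - real P) / quot_seq M n < e" using n by (simp add: of_nat_diff)
    then have "2 * Z * (real n - real P) < quot_seq M n"
      using m \<open>Z > 0\<close> by (simp add: e_def field_simps)
    moreover have "Z * real n \<le> 2 * Z * (real n - real P)"
      using n \<open>Z > 0\<close> by (simp add: algebra_simps mult_left_mono flip: of_nat_mult) 
    ultimately show ?thesis using n by (simp add: quot_seq_star_def field_simps)
  qed
  then show "\<forall>\<^sub>F n in sequentially. Z \<le> quot_seq_star M n"
    unfolding eventually_sequentially by blast
qed

text \<open>All but finitely many quotients are at least 1, and the remaining ones are
  positive.\<close>

lemma quot_seq_star_lower_bound: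
  assumes M: "weight_sequence M" and nqa: "non_quasianalytic M"
  obtains \<nu> where "\<nu> > 0" "\<And>p. p \<ge> 1 \<Longrightarrow> \<nu> \<le> quot_seq_star M p"
proof -
  have "\<forall>\<^sub>F p in sequentially. 1 \<le> quot_seq_star M p"
    using non_quasianalytic_imp_quot_seq_star_at_top[OF assms] by (auto simp: filterlim_at_top)
  then obtain P where P: "\<And>p. p \<ge> P \<Longrightarrow> 1 \<le> quot_seq_star M p"
    by (auto simp: eventually_sequentially)
  define \<nu> where "\<nu> = Min (insert 1 (quot_seq_star M ` {1..P}))"
  have "\<nu> > 0" unfolding \<nu>_def using weight_sequenceD(7)[OF M] by (subst Min_gr_iff) auto
  moreover have "\<nu> \<le> quot_seq_star M p" if "p \<ge> 1" for p
  proof (cases "p \<ge> P")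
    case True
    have "\<nu> \<le> 1" unfolding \<nu>_def by (rule Min_le) auto
    then show ?thesis using P[OF True] by simp
  next
    case False
    then show ?thesis unfolding \<nu>_def using that by (intro Min_le) auto
  qed
  ultimately show ?thesis using that by blast
qed

text \<open>The ratio of consecutive terms is t / m*_(p+1), eventually at most 1, so the terms are
  bounded by the maximum of an initial segment. This makes the supremum in \<open>assoc_fun\<close>
  finite.\<close>

lemma power_div_seq_star_bounded:
  assumes M: "weight_sequence M" and nqa: "non_quasianalytic M" and "t > 0"
  obtains B where "B > 0" "\<And>p. t ^ p / seq_star M p \<le> B"
proof -
  have "\<forall>\<^sub>F p in sequentially. t \<le> quot_seq_star M p"
    using non_quasianalytic_imp_quot_seq_star_at_top[OF assms(1,2)] by (auto simp: filterlim_at_top)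
  then obtain P where P: "\<And>p. p \<ge> P \<Longrightarrow> t \<le> quot_seq_star M p"
    by (auto simp: eventually_sequentially)
  define f where "f p = t ^ p / seq_star M p" for p
  have fpos: "f p > 0" for p using weight_sequenceD(5)[OF M] \<open>t > 0\<close> by (simp add: f_def)
  have step: "f (Suc p) \<le> f p" if "p \<ge> P" for p
  proof -
    have "f (Suc p) = f p * (t / quot_seq_star M (Suc p))"
      by (simp add: f_def weight_sequenceD(8)[OF M] mult_ac)
    also have "\<dots> \<le> f p * 1"
      using fpos[of p] P[of "Suc p"] that weight_sequenceD(7)[OF M, of "Suc p"]
      by (intro mult_left_mono) auto
    finally show ?thesis by simp
  qed
  define B where "B = Max (f ` {..P})"
  have B: "f p \<le> B" if "p \<le> P" for p unfolding B_def using that by (intro Max_ge) auto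
  have "f p \<le> B" for p
  proof (cases "p \<le> P")
    case False
    then have "P \<le> p" by simp
    then have "f p \<le> f P" by (induction rule: dec_induct) (use step order.trans in \<open>auto\<close>)
    then show ?thesis using B[of P] by simp
  qed (rule B)
  moreover have "B > 0" using B[of 0] fpos[of 0] by simp
  ultimately show ?thesis using that by (auto simp: f_def)
qed

text \<open>Finiteness matters here: \<open>SUP\<close> over a set of reals that is not bounded
  above need not be an upper bound.\<close>

lemma exp_assoc_fun_ge:
  assumes M: "weight_sequence M" and nqa: "non_quasianalytic M" and "t > 0"
  shows "t ^ p / seq_star M p \<le> exp (assoc_fun (seq_star M) t)"
proof -
  obtain B where "B > 0" and B: "\<And>p. t ^ p / seq_star M p \<le> B"
    using power_div_seq_star_bounded[OF assms] by blast
  have pos: "t ^ p / seq_star M p > 0" for p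
    using weight_sequenceD(5)[OF M] \<open>t > 0\<close> by simp
  have "ln (t ^ p / seq_star M p) \<le> assoc_fun (seq_star M) t"
    unfolding assoc_fun_def
    by (rule cSUP_upper) (use B pos in \<open>auto intro!: bdd_aboveI2[of _ _ "ln B"] ln_mono\<close>)
  then show ?thesis using pos[of p] by (metis exp_le_cancel_iff exp_ln)
qed

text \<open>The form in which a family of bounds, one for each p, turns into a bound with the
  exponential weight.\<close>

lemma mult_exp_assoc_fun_le:
  assumes M: "weight_sequence M" and "t > 0" and "X \<ge> 0"
    and C: "\<And>p. X * t ^ p \<le> C * seq_star M p"
  shows "X * exp (assoc_fun (seq_star M) t) \<le> C"
proof (cases "X = 0")
  case True
  then show ?thesis using C[of 0] weight_sequenceD(6)[OF M] by simp
next
  case False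
  with \<open>X \<ge> 0\<close> have "X > 0" by simp
  have pos: "seq_star M p > 0" for p by (rule weight_sequenceD[OF M])
  have "C > 0" using C[of 0] \<open>X > 0\<close> weight_sequenceD(6)[OF M] by simp
  have "ln (t ^ p / seq_star M p) \<le> ln (C / X)" for p
    using C[of p] pos[of p] \<open>X > 0\<close> \<open>C > 0\<close> \<open>t > 0\<close> by (intro ln_mono) (simp_all add: field_simps)
  then have "assoc_fun (seq_star M) t \<le> ln (C / X)"
    unfolding assoc_fun_def by (intro cSUP_least) auto
  then have "exp (assoc_fun (seq_star M) t) \<le> C / X"
    using \<open>X > 0\<close> \<open>C > 0\<close> by (simp add: ln_ge_iff)
  then show ?thesis using \<open>X > 0\<close> by (simp add: field_simps)
qed

text \<open>Common form of \<open>L\<close> applications of [M.2]'. The relation composes, whereas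
  the quantifiers differ: in the Beurling case \<open>M\<close> is found for a given
  \<open>N\<close>, in the Roumieu case \<open>N\<close> for a given \<open>M\<close>.\<close>

definition shift_dominated :: "nat \<Rightarrow> (nat \<Rightarrow> real) \<Rightarrow> (nat \<Rightarrow> real) \<Rightarrow> bool" where
  "shift_dominated L M N \<longleftrightarrow> (\<exists>C>0. \<exists>H>0. \<forall>p. M (p + L) \<le> C * H ^ p * N p)"

lemma shift_dominated_0: "shift_dominated 0 M M"
  unfolding shift_dominated_def by (intro exI[of _ 1] conjI) auto

lemma shift_dominated_trans:
  assumes "shift_dominated K M N" "shift_dominated L N P"
  shows "shift_dominated (K + L) M P"
proof -
  obtain C H where CH: "C > 0" "H > 0" "\<And>p. M (p + K) \<le> C * H ^ p * N p"
    using assms(1) by (auto simp: shift_dominated_def)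
  obtain C' H' where CH': "C' > 0" "H' > 0" "\<And>p. N (p + L) \<le> C' * H' ^ p * P p"
    using assms(2) by (auto simp: shift_dominated_def)
  have "M (p + (K + L)) \<le> (C * H ^ L * C') * (H * H') ^ p * P p" for p
  proof -
    have "M (p + (K + L)) \<le> C * H ^ (p + L) * N (p + L)"
      using CH(3)[of "p + L"] by (simp add: add_ac)
    also have "\<dots> \<le> C * H ^ (p + L) * (C' * H' ^ p * P p)"
      using CH CH' by (intro mult_left_mono) auto
    finally show ?thesis by (simp add: power_add power_mult_distrib mult_ac)
  qed
  then show ?thesis unfolding shift_dominated_def using CH CH'
    by (intro exI[of _ "C * H ^ L * C'"] exI[of _ "H * H'"] conjI) auto
qed

lemma M2_prime_B_shift:
  assumes "M2_prime_B \<MM>" "N \<in> \<MM>"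
  shows "\<exists>M\<in>\<MM>. shift_dominated L M N"
proof (induction L)
  case 0
  then show ?case using assms(2) shift_dominated_0 by blast
next
  case (Suc L)
  then obtain M where M: "M \<in> \<MM>" "shift_dominated L M N" by blast
  obtain M' where "M' \<in> \<MM>" "shift_dominated 1 M' M"
    using assms(1) M(1) unfolding M2_prime_B_def shift_dominated_def by blast
  then show ?case using shift_dominated_trans[of 1 M' M L N] M(2) by auto
qed

lemma M2_prime_R_shift:
  assumes "M2_prime_R \<MM>" "M \<in> \<MM>"
  shows "\<exists>N\<in>\<MM>. shift_dominated L M N"
proof (induction L)
  case 0
  then show ?case using assms(2) shift_dominated_0 by blast
next
  case (Suc L)
  then obtain N where N: "N \<in> \<MM>" "shift_dominated L M N" by blast
  obtain N' where "N' \<in> \<MM>" "shift_dominated 1 N N'"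
    using assms(1) N(1) unfolding M2_prime_R_def shift_dominated_def by blast
  then show ?case using shift_dominated_trans[of L M N 1 N'] N(2) by auto
qed

text \<open>The running maximum of m*_1, ..., m*_(p+1); the \<open>Suc\<close> keeps the set
  non-empty at p = 0.\<close>

definition max_quot :: "(nat \<Rightarrow> real) \<Rightarrow> nat \<Rightarrow> real" where
  "max_quot M p = Max (quot_seq_star M ` {1..Suc p})"

lemma max_quot_ge: "1 \<le> j \<Longrightarrow> j \<le> Suc p \<Longrightarrow> quot_seq_star M j \<le> max_quot M p"
  unfolding max_quot_def by (intro Max_ge) auto

lemma max_quot_mono: "p \<le> q \<Longrightarrow> max_quot M p \<le> max_quot M q"
  unfolding max_quot_def by (intro Max_mono) auto

lemma max_quot_pos: "weight_sequence M \<Longrightarrow> max_quot M p > 0"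
  using max_quot_ge[of 1 p M] weight_sequenceD(7)[of M 1] by simp

text \<open>M*_n is M*_q times the n - q quotients m*_(q+1), ..., m*_n, each below the running
  maximum.\<close>

lemma seq_star_le_max_quot:
  assumes M: "weight_sequence M" and "q \<le> n"
  shows "seq_star M n \<le> seq_star M q * max_quot M n ^ (n - q)"
proof -
  have "k \<le> n \<Longrightarrow> seq_star M k \<le> seq_star M q * max_quot M n ^ (k - q)" if "q \<le> k" for k
    using that
  proof (induction k rule: dec_induct)
    case (step k)
    have "seq_star M (Suc k) = quot_seq_star M (Suc k) * seq_star M k" by (rule weight_sequenceD[OF M])
    also have "\<dots> \<le> max_quot M n * (seq_star M q * max_quot M n ^ (k - q))"
      using step weight_sequenceD(5)[OF M, of k] max_quot_pos[OF M, of n]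
      by (intro mult_mono max_quot_ge) auto
    also have "\<dots> = seq_star M q * max_quot M n ^ (Suc k - q)"
      using step by (simp add: Suc_diff_le mult_ac)
    finally show ?case .
  qed simp
  from this[of n] assms(2) show ?thesis by simp
qed

text \<open>The cut-off scale \<open>1 / (A max_quot M n)\<close> is chosen such that \<open>n\<close> is a nearly
  optimal order of truncation at height \<open>y\<close>.\<close>

lemma truncation_estimate:
  assumes M: "weight_sequence M" and N: "weight_sequence N" and nqaN: "non_quasianalytic N"
    and rel: "\<And>p q. 1 \<le> q \<Longrightarrow> q \<le> p \<Longrightarrow> quot_seq_star M q \<le> C1 * quot_seq_star N p"
    and C1: "C1 > 0" and A: "A > 0"
    and N': "\<And>p. N (p + 2) \<le> C2 * H2 ^ p * N' p" "weight_sequence N'" "C2 > 0" "H2 > 0"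
  obtains c where "c > 0"
    and "\<And>n q y. 0 < y \<Longrightarrow> y < 1 \<Longrightarrow> A * max_quot M n * y \<le> 1 \<Longrightarrow> 1 \<le> 2 * A * max_quot M (n + 2) * y \<Longrightarrow>
      (A / 2) ^ n * seq_star M n * y ^ n \<le> c * (1 / 2) ^ n * (2 * A * C1 * H2 * y) ^ q * seq_star N' q"
proof -
  obtain \<nu> where "\<nu> > 0" and \<nu>: "\<And>p. p \<ge> 1 \<Longrightarrow> \<nu> \<le> quot_seq_star N p"
    using quot_seq_star_lower_bound[OF N nqaN] by blast
  \<comment> \<open>The 2 matches the one in the hypothesis on max_quot M (n + 2), so that the late
    quotients of \<open>D\<close> below are at least 1.\<close>
  define h1 where "h1 = 2 * A * C1"
  have "h1 > 0" using A C1 by (simp add: h1_def)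
  \<comment> \<open>\<open>\<kappa> * y\<close> is a lower bound for every quotient D (q + 1) / D q;
    the minimum with 1 keeps it at most 1.\<close>
  define \<kappa> where "\<kappa> = min 1 (h1 * \<nu>)"
  have \<kappa>: "\<kappa> > 0" "\<kappa> \<le> 1" "\<kappa> \<le> h1 * \<nu>" using \<open>h1 > 0\<close> \<open>\<nu> > 0\<close> by (auto simp: \<kappa>_def)
  have MN: "seq_star M q \<le> C1 ^ q * seq_star N q" for q
  proof (induction q)
    case (Suc q)
    have "seq_star M (Suc q) = quot_seq_star M (Suc q) * seq_star M q" by (rule weight_sequenceD[OF M])
    also have "\<dots> \<le> (C1 * quot_seq_star N (Suc q)) * (C1 ^ q * seq_star N q)"
      using Suc weight_sequenceD(5,7)[OF M] C1 weight_sequenceD(7)[OF N, of "Suc q"]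
      by (intro mult_mono rel) (auto simp: less_imp_le)
    finally show ?case by (simp add: weight_sequenceD(8)[OF N] mult_ac)
  qed (simp add: weight_sequenceD(6)[OF M] weight_sequenceD(6)[OF N])
  have maxN: "max_quot M n \<le> C1 * quot_seq_star N p" if "p \<ge> Suc n" for n p
    unfolding max_quot_def using rel that by (subst Max_le_iff) auto
  have main: "(A / 2) ^ n * seq_star M n * y ^ n \<le> (1 / 2) ^ n * (1 / (\<kappa> * y)\<^sup>2) * ((h1 * y) ^ q * seq_star N q)"
    if y: "0 < y" "y < 1" and 1: "A * max_quot M n * y \<le> 1" and 2: "1 \<le> 2 * A * max_quot M (n + 2) * y" for n q y
  proof -
    let ?\<mu> = "max_quot M n"
    \<comment> \<open>The target without its constants. For q <= n the left side is at most 2^(-n) D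
      q directly; for q > n it is compared with D n, which must not be much larger than D q.\<close>
    define D where "D q = (h1 * y) ^ q * seq_star N q" for q
    have Dpos: "D q > 0" for q using \<open>h1 > 0\<close> y weight_sequenceD(5)[OF N] by (simp add: D_def)
    have \<kappa>y: "0 < \<kappa> * y" "\<kappa> * y \<le> 1" using \<kappa> y by (auto simp: mult_le_one)
    have ge1: "1 \<le> 1 / (\<kappa> * y)\<^sup>2" using \<kappa>y by (auto simp: power_le_one le_divide_eq)
    have low: "(A / 2) ^ n * seq_star M n * y ^ n \<le> (1 / 2) ^ n * D q" if "q \<le> n" for q
    proof -
      have "(A / 2) ^ n * seq_star M n * y ^ n \<le> (A / 2) ^ n * (seq_star M q * ?\<mu> ^ (n - q)) * y ^ n"
        using seq_star_le_max_quot[OF M that] A y by (intro mult_left_mono mult_right_mono) auto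
      also have "\<dots> = (1 / 2) ^ n * ((A * y) ^ q * seq_star M q * (A * ?\<mu> * y) ^ (n - q))"
      proof -
        have "(A * y) ^ n = (A * y) ^ q * (A * y) ^ (n - q)" using that by (simp flip: power_add)
        moreover have "(A / 2) ^ n * (seq_star M q * ?\<mu> ^ (n - q)) * y ^ n
            = (1 / 2) ^ n * (seq_star M q * ?\<mu> ^ (n - q)) * (A * y) ^ n"
          by (simp add: power_divide power_mult_distrib)
        ultimately show ?thesis by (simp add: power_mult_distrib mult_ac)
      qed
      also have "\<dots> \<le> (1 / 2) ^ n * ((A * y) ^ q * (C1 ^ q * seq_star N q) * 1)"
        using A y MN[of q] 1 max_quot_pos[OF M, of n] weight_sequenceD(5)[OF M, of q]
        by (intro mult_left_mono mult_mono power_le_one) (auto simp: less_imp_le)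
      also have "\<dots> = (1 / 2) ^ n * ((A * y * C1) ^ q * seq_star N q)"
        by (simp add: power_mult_distrib mult_ac)
      also have "\<dots> \<le> (1 / 2) ^ n * D q"
        unfolding D_def h1_def using A y C1 weight_sequenceD(5)[OF N, of q]
        by (intro mult_left_mono mult_right_mono power_mono) auto
      finally show ?thesis .
    qed
    have Dstep: "D (Suc q) = (h1 * y * quot_seq_star N (Suc q)) * D q" for q
      by (simp add: D_def weight_sequenceD(8)[OF N] mult_ac)
    have s1: "\<kappa> * y * D q \<le> D (Suc q)" for q
    proof -
      have "\<kappa> * y \<le> h1 * \<nu> * y" using \<kappa> y by (intro mult_right_mono) auto
      also have "\<dots> \<le> h1 * quot_seq_star N (Suc q) * y"
        using \<nu>[of "Suc q"] \<open>h1 > 0\<close> y by (intro mult_left_mono mult_right_mono) auto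
      finally show ?thesis unfolding Dstep using Dpos[of q] by (intro mult_right_mono) (auto simp: mult_ac)
    qed
    have s2: "D q \<le> D (Suc q)" if "q \<ge> n + 2" for q
    proof -
      have "1 \<le> 2 * A * max_quot M (n + 2) * y" by (rule 2)
      also have "\<dots> \<le> 2 * A * (C1 * quot_seq_star N (Suc q)) * y"
        using maxN[of "n + 2" "Suc q"] that A y by (intro mult_left_mono mult_right_mono) auto
      finally have "1 * D q \<le> (h1 * y * quot_seq_star N (Suc q)) * D q"
        using Dpos[of q] by (intro mult_right_mono) (auto simp: h1_def mult_ac)
      then show ?thesis by (simp add: Dstep)
    qed
    \<comment> \<open>\<open>D\<close> increases from n + 2 on. The two steps from n to n + 2 are
      not governed by the hypothesis on y; each may lose a factor \<kappa> y, whence (\<kappa>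
      y)^(-2).\<close>
    have high: "D n \<le> (1 / (\<kappa> * y)\<^sup>2) * D q" if "q > n" for q
    proof -
      have a: "\<kappa> * y * D n \<le> D (n + 1)" using s1[of n] by simp
      then have "\<kappa> * y * (\<kappa> * y * D n) \<le> \<kappa> * y * D (n + 1)" using \<kappa>y by (intro mult_left_mono) auto
      also have "\<dots> \<le> D (n + 2)" using s1[of "n + 1"] by simp
      finally have b: "(\<kappa> * y)\<^sup>2 * D n \<le> D (n + 2)" by (simp add: power2_eq_square mult_ac)
      have "(\<kappa> * y)\<^sup>2 * D n \<le> D q"
      proof (cases "q = n + 1")
        case True
        have "(\<kappa> * y)\<^sup>2 * D n \<le> \<kappa> * y * D n"
          using \<kappa>y Dpos[of n] by (intro mult_right_mono) (auto simp: power2_eq_square mult_left_le)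
        then show ?thesis using a True by simp
      next
        case False
        then have "n + 2 \<le> q" using that by simp
        then show ?thesis
          by (induction q rule: dec_induct) (use b s2 order.trans in \<open>auto\<close>)
      qed
      moreover have "(\<kappa> * y)\<^sup>2 > 0" using \<kappa>y(1) by (rule zero_less_power)
      ultimately show ?thesis by (simp add: le_divide_eq mult.commute)
    qed
    show ?thesis
    proof (cases "q \<le> n")
      case True
      have "(1 / 2) ^ n * 1 \<le> (1 / 2) ^ n * (1 / (\<kappa> * y)\<^sup>2)"
        by (rule mult_left_mono[OF ge1]) simp
      then have "(1 / 2) ^ n * D q \<le> (1 / 2) ^ n * (1 / (\<kappa> * y)\<^sup>2) * D q"
        using Dpos[of q] by (intro mult_right_mono) auto
      then show ?thesis using low[OF True] by (simp add: D_def)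
    next
      case False
      then have "(1 / 2) ^ n * D n \<le> (1 / 2) ^ n * ((1 / (\<kappa> * y)\<^sup>2) * D q)"
        using high[of q] by (intro mult_left_mono) auto
      then show ?thesis using low[of n] by (simp add: D_def)
    qed
  qed
  \<comment> \<open>\<open>main\<close> is applied at q + 2: the two additional powers of h1 y
    cancel (\<kappa> y)^(-2) up to this constant, and N*_(q+2) is bounded by N'*_q through the shift
    by two.\<close>
  define c where "c = h1\<^sup>2 * C2 / \<kappa>\<^sup>2"
  show ?thesis
  proof (rule that[of c])
    show "c > 0" using \<open>h1 > 0\<close> \<kappa> N' by (simp add: c_def)
    fix n q and y :: real
    assume y: "0 < y" "y < 1" and *: "A * max_quot M n * y \<le> 1" "1 \<le> 2 * A * max_quot M (n + 2) * y"
    have "seq_star N (q + 2) \<le> C2 * H2 ^ q * seq_star N' q"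
    proof -
      have "seq_star N (q + 2) \<le> C2 * H2 ^ q * N' q / fact (q + 2)"
        unfolding seq_star_def using N'(1)[of q] by (intro divide_right_mono) auto
      also have "\<dots> \<le> C2 * H2 ^ q * N' q / fact q"
        using N' weight_sequenceD(1)[OF N'(2), of q]
        by (intro divide_left_mono fact_mono) (auto simp: less_imp_le)
      finally show ?thesis by (simp add: seq_star_def)
    qed
    then have "(h1 * y) ^ (q + 2) * seq_star N (q + 2) \<le> (h1 * y) ^ (q + 2) * (C2 * H2 ^ q * seq_star N' q)"
      using \<open>h1 > 0\<close> y by (intro mult_left_mono) auto
    then have "(1 / 2) ^ n * (1 / (\<kappa> * y)\<^sup>2) * ((h1 * y) ^ (q + 2) * seq_star N (q + 2)) \<le>
        (1 / 2) ^ n * (1 / (\<kappa> * y)\<^sup>2) * ((h1 * y) ^ (q + 2) * (C2 * H2 ^ q * seq_star N' q))"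
      by (rule mult_left_mono) simp
    also have "\<dots> = c * (1 / 2) ^ n * (2 * A * C1 * H2 * y) ^ q * seq_star N' q"
      using y \<kappa> by (simp add: c_def h1_def power_add power_mult_distrib power2_eq_square field_simps)
    finally show "(A / 2) ^ n * seq_star M n * y ^ n \<le> c * (1 / 2) ^ n * (2 * A * C1 * H2 * y) ^ q * seq_star N' q"
      using main[OF y *, of "q + 2"] by linarith
  qed
qed

section \<open>Cut-off Taylor coefficients\<close>

text \<open>The tails of \<open>c\<close> give convergence of the derivatives that is uniform in x
  and relative to |v|, which is what differentiating a series termwise requires.\<close>

lemma
  fixes f :: "nat \<Rightarrow> 'a::real_normed_vector \<Rightarrow> 'b::banach"
  assumes diff: "\<And>n x. f n differentiable (at x)"
    and bound: "\<And>n x v. norm (dir_deriv v (f n) x) \<le> c n * norm v"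
    and c: "summable c" and sm: "\<And>x. summable (\<lambda>n. f n x)"
  shows differentiable_series: "(\<lambda>x. \<Sum>n. f n x) differentiable (at x)"
    and dir_deriv_series: "dir_deriv v (\<lambda>x. \<Sum>n. f n x) x = (\<Sum>n. dir_deriv v (f n) x)"
proof -
  have sd: "summable (\<lambda>n. dir_deriv v (f n) x)" for v x
    by (rule summable_comparison_test'[OF summable_mult2[OF c, of "norm v"]]) (rule bound)
  have "\<exists>g. \<forall>x\<in>UNIV. (\<lambda>n. f n x) sums (g x) \<and> (g has_derivative (\<lambda>v. \<Sum>n. dir_deriv v (f n) x)) (at x within UNIV)"
  proof (rule has_derivative_series[OF convex_UNIV])
    fix n and x :: 'a
    show "(f n has_derivative (\<lambda>v. dir_deriv v (f n) x)) (at x within UNIV)"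
      by (rule has_derivative_dir_deriv[OF diff])
  next
    fix e :: real assume "e > 0"
    then obtain N where N: "\<And>n. n \<ge> N \<Longrightarrow> norm (\<Sum>i. c (i + n)) < e"
      using suminf_exist_split[OF _ c] by blast
    show "\<forall>\<^sub>F n in sequentially. \<forall>x\<in>UNIV. \<forall>v.
        norm ((\<Sum>i<n. dir_deriv v (f i) x) - (\<Sum>n. dir_deriv v (f n) x)) \<le> e * norm v"
      unfolding eventually_sequentially
    proof (intro exI[of _ N] allI impI ballI)
      fix n and v x :: 'a assume "n \<ge> N"
      have cn: "summable (\<lambda>i. c (i + n) * norm v)"
        by (intro summable_mult2 summable_ignore_initial_segment c)
      have "norm ((\<Sum>i<n. dir_deriv v (f i) x) - (\<Sum>n. dir_deriv v (f n) x)) =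
          norm (\<Sum>i. dir_deriv v (f (i + n)) x)"
        by (simp add: suminf_minus_initial_segment[OF sd] norm_minus_commute)
      also have "\<dots> \<le> (\<Sum>i. c (i + n) * norm v)"
        by (rule norm_suminf_le[OF _ cn]) (rule bound)
      also have "\<dots> = (\<Sum>i. c (i + n)) * norm v"
        by (rule suminf_mult2[symmetric]) (intro summable_ignore_initial_segment c)
      also have "\<dots> \<le> e * norm v"
        using N[OF \<open>n \<ge> N\<close>] by (intro mult_right_mono) auto
      finally show "norm ((\<Sum>i<n. dir_deriv v (f i) x) - (\<Sum>n. dir_deriv v (f n) x)) \<le> e * norm v" .
    qed
  next
    show "(\<lambda>n. f n 0) sums (\<Sum>n. f n 0)" by (rule summable_sums[OF sm])
  qed auto
  then obtain g where g: "\<And>x. (\<lambda>n. f n x) sums (g x)"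
    and dg: "\<And>x. (g has_derivative (\<lambda>v. \<Sum>n. dir_deriv v (f n) x)) (at x)"
    by auto
  have "g = (\<lambda>x. \<Sum>n. f n x)" using g sums_unique by blast
  with dg show "(\<lambda>x. \<Sum>n. f n x) differentiable (at x)"
    "dir_deriv v (\<lambda>x. \<Sum>n. f n x) x = (\<Sum>n. dir_deriv v (f n) x)"
    by (auto simp: differentiable_def intro: dir_deriv_eqI)
qed

lemma continuous_on_series:
  fixes f :: "nat \<Rightarrow> 'a::topological_space \<Rightarrow> 'b::banach"
  assumes "\<And>n. continuous_on UNIV (f n)" "\<And>n x. norm (f n x) \<le> c n" "summable c"
  shows "continuous_on UNIV (\<lambda>x. \<Sum>n. f n x)"
proof (rule uniform_limit_theorem[of _ _ sequentially])
  show "\<forall>\<^sub>F n in sequentially. continuous_on UNIV (\<lambda>x. \<Sum>i<n. f i x)"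
    by (intro always_eventually allI continuous_on_sum assms)
  show "uniform_limit UNIV (\<lambda>n x. \<Sum>i<n. f i x) (\<lambda>x. \<Sum>n. f n x) sequentially"
    by (rule Weierstrass_m_test[OF _ assms(3)]) (rule assms)
qed simp

text \<open>The delicate point is u = 0, where the difference quotient is at most |h|^(k+1) in
  absolute value.\<close>

lemma has_real_derivative_max_power:
  "((\<lambda>u. max 0 u ^ (k + 2)) has_real_derivative (real (k + 2) * max 0 u ^ (k + 1))) (at u)"
proof -
  consider "u > 0" | "u < 0" | "u = 0" by linarith
  then show ?thesis
  proof cases
    case 1
    have "((\<lambda>u. u ^ (k + 2)) has_real_derivative (real (k + 2) * max 0 u ^ (k + 1))) (at u)"
      using DERIV_pow[of "k + 2" u] 1 by (simp add: max_def)
    then show ?thesis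
      by (rule has_field_derivative_transform_within_open[of _ _ _ "{0<..}"]) (use 1 in auto)
  next
    case 2
    have "((\<lambda>u. 0) has_real_derivative (real (k + 2) * max 0 u ^ (k + 1))) (at u)"
      using 2 by simp
    then show ?thesis
      by (rule has_field_derivative_transform_within_open[of _ _ _ "{..<0}"]) (use 2 in auto)
  next
    case 3
    have "((\<lambda>h. (max 0 h ^ (k + 2)) / h) \<longlongrightarrow> 0) (at (0::real))"
    proof (rule Lim_null_comparison)
      show "\<forall>\<^sub>F h in at 0. norm (max 0 h ^ (k + 2) / h) \<le> \<bar>h\<bar> ^ (k + 1)"
        by (intro always_eventually allI) (auto simp: max_def power_Suc2 abs_mult intro!: mult_nonpos_nonneg zero_le_power)
      show "((\<lambda>h. \<bar>h\<bar> ^ (k + 1)) \<longlongrightarrow> 0) (at (0::real))"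
        by (auto intro!: tendsto_eq_intros)
    qed
    then show ?thesis using 3 by (simp add: DERIV_def)
  qed
qed

text \<open>Derivatives are taken up to order two, so class C^2 is the natural requirement. They are
  named functions with one common bound \<open>c\<close>, which keeps the later product estimates
  explicit.\<close>

locale C2_cutoff =
  fixes cut cut' cut'' :: "real \<Rightarrow> real" and c :: real
  assumes dcut: "(cut has_real_derivative cut' t) (at t)"
    and dcut': "(cut' has_real_derivative cut'' t) (at t)"
    and ccut'': "continuous_on UNIV cut''"
    and bnd: "\<bar>cut t\<bar> \<le> c" "\<bar>cut' t\<bar> \<le> c" "\<bar>cut'' t\<bar> \<le> c"
    and inner: "\<bar>t\<bar> \<le> 1 / 2 \<Longrightarrow> cut t = 1" "\<bar>t\<bar> \<le> 1 / 2 \<Longrightarrow> cut' t = 0" "\<bar>t\<bar> \<le> 1 / 2 \<Longrightarrow> cut'' t = 0"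
    and outer: "\<bar>t\<bar> \<ge> 1 \<Longrightarrow> cut t = 0" "\<bar>t\<bar> \<ge> 1 \<Longrightarrow> cut' t = 0" "\<bar>t\<bar> \<ge> 1 \<Longrightarrow> cut'' t = 0"

text \<open>The function is (1 - ((2 t^2 - 1)_+)^3)_+^3. Cubes of positive parts are C^2; the inner
  cube vanishes for |t| <= 1/2 and is at least 1 for |t| >= 1.\<close>

lemma ex_C2_cutoff: "\<exists>cut cut' cut'' c. C2_cutoff cut cut' cut'' c"
proof -
  define P where "P k u = max 0 u ^ k" for k and u :: real
  have dP: "(P 3 has_real_derivative 3 * P 2 u) (at u)" "(P 2 has_real_derivative 2 * P 1 u) (at u)" for u
    unfolding P_def using has_real_derivative_max_power[of 1 u] has_real_derivative_max_power[of 0 u]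
    by (simp_all add: numeral_eq_Suc)
  have cP: "continuous_on UNIV (\<lambda>t. P k (f t))" if "continuous_on UNIV f" for k f
    unfolding P_def using that by (intro continuous_intros)
  define a where "a t = 2 * t\<^sup>2 - 1" for t :: real
  define b where "b t = P 3 (a t)" for t
  define b' where "b' t = 3 * P 2 (a t) * (4 * t)" for t
  define b'' where "b'' t = 6 * P 1 (a t) * (4 * t) * (4 * t) + 12 * P 2 (a t)" for t
  define cut where "cut t = P 3 (1 - b t)" for t
  define cut' where "cut' t = 3 * P 2 (1 - b t) * (- b' t)" for t
  define cut'' where "cut'' t = 6 * P 1 (1 - b t) * (- b' t) * (- b' t) + 3 * P 2 (1 - b t) * (- b'' t)" for t
  have da: "(a has_real_derivative 4 * t) (at t)" for t
    unfolding a_def by (auto intro!: derivative_eq_intros)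
  have db: "(b has_real_derivative b' t) (at t)" for t
    unfolding b_def b'_def by (rule DERIV_chain2[OF dP(1) da])
  have dPa: "((\<lambda>t. P 2 (a t)) has_real_derivative 2 * P 1 (a t) * (4 * t)) (at t)" for t
    by (rule DERIV_chain2[OF dP(2) da])
  have db': "(b' has_real_derivative b'' t) (at t)" for t
    unfolding b'_def b''_def by (rule derivative_eq_intros dPa refl)+ simp
  have d1b: "((\<lambda>t. 1 - b t) has_real_derivative - b' t) (at t)" for t
    by (rule derivative_eq_intros db refl)+ simp
  have dcut: "(cut has_real_derivative cut' t) (at t)" for t
    unfolding cut_def cut'_def by (rule DERIV_chain2[OF dP(1) d1b])
  have dPb: "((\<lambda>t. P 2 (1 - b t)) has_real_derivative 2 * P 1 (1 - b t) * (- b' t)) (at t)" for t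
    by (rule DERIV_chain2[OF dP(2) d1b])
  have dcut': "(cut' has_real_derivative cut'' t) (at t)" for t
    unfolding cut'_def cut''_def by (rule derivative_eq_intros dPb db' refl)+ simp
  have ca: "continuous_on UNIV a" unfolding a_def by (intro continuous_intros)
  have cb: "continuous_on UNIV b" "continuous_on UNIV b'" "continuous_on UNIV b''"
    unfolding b_def b'_def b''_def by (intro continuous_intros cP ca)+
  have ccut: "continuous_on UNIV cut" "continuous_on UNIV cut'" "continuous_on UNIV cut''"
    unfolding cut_def cut'_def cut''_def by (intro continuous_intros cP cb)+
  have inner: "cut t = 1" "cut' t = 0" "cut'' t = 0" if "\<bar>t\<bar> \<le> 1 / 2" for t
  proof -
    have "t\<^sup>2 \<le> (1 / 2)\<^sup>2" using that by (subst abs_le_square_iff[symmetric]) simp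
    then have "a t < 0" by (simp add: a_def power2_eq_square)
    then show "cut t = 1" "cut' t = 0" "cut'' t = 0"
      by (simp_all add: cut_def cut'_def cut''_def b_def b'_def b''_def P_def)
  qed
  have outer: "cut t = 0" "cut' t = 0" "cut'' t = 0" if "\<bar>t\<bar> \<ge> 1" for t
  proof -
    have "1\<^sup>2 \<le> t\<^sup>2" using that by (subst abs_le_square_iff[symmetric]) simp
    then have "a t \<ge> 1" by (simp add: a_def)
    then have "b t \<ge> 1" by (simp add: b_def P_def one_le_power)
    then show "cut t = 0" "cut' t = 0" "cut'' t = 0"
      by (simp_all add: cut_def cut'_def cut''_def P_def)
  qed
  have bdd: "\<exists>c. \<forall>t. \<bar>f t\<bar> \<le> c" if "continuous_on UNIV f" "\<And>t. \<bar>t\<bar> \<ge> 1 \<Longrightarrow> f t = 0" for f :: "real \<Rightarrow> real"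
  proof -
    have "supp f \<subseteq> {-1..1}" by (rule supp_subsetI) (auto intro: that(2))
    then have "compact (supp f)" by (rule compact_supp_subset[OF compact_Icc])
    from bounded_compact_supp[OF that(1) this] show ?thesis by (metis real_norm_def)
  qed
  obtain c1 c2 c3 where "\<And>t. \<bar>cut t\<bar> \<le> c1" "\<And>t. \<bar>cut' t\<bar> \<le> c2" "\<And>t. \<bar>cut'' t\<bar> \<le> c3"
    using bdd ccut outer by metis
  then have "C2_cutoff cut cut' cut'' (max c1 (max c2 c3))"
    using dcut dcut' ccut inner outer by unfold_locales (auto simp: le_max_iff_disj)
  then show ?thesis by blast
qed

text \<open>The k-th derivative of y^p / p!, which is zero for k > p.\<close>

definition div_power :: "nat \<Rightarrow> nat \<Rightarrow> real \<Rightarrow> real" where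
  "div_power k p y = (if k \<le> p then y ^ (p - k) / fact (p - k) else 0)"

lemma has_real_derivative_div_power:
  "(div_power k p has_real_derivative div_power (Suc k) p y) (at y)"
proof (cases "k \<le> p")
  case True
  define j where "j = p - k"
  have "((\<lambda>y. y ^ j / fact j) has_real_derivative (if j = 0 then 0 else y ^ (j - 1) / fact (j - 1))) (at y)"
    using DERIV_cdivide[OF DERIV_pow[of j y], of "fact j"] by (cases j) (simp_all del: of_nat_Suc)
  moreover have "div_power k p = (\<lambda>y. y ^ j / fact j)"
    using True by (auto simp: div_power_def j_def)
  moreover have "div_power (Suc k) p y = (if j = 0 then 0 else y ^ (j - 1) / fact (j - 1))"
    using True by (auto simp: div_power_def j_def)
  ultimately show ?thesis by simp
next
  case False
  then show ?thesis by (simp add: div_power_def[abs_def])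
qed

lemma continuous_on_div_power [continuous_intros]: "continuous_on S (div_power k p)"
  by (intro continuous_at_imp_continuous_on ballI DERIV_isCont[OF has_real_derivative_div_power])

text \<open>A derivative that falls on the cut-off costs a factor r, which one power of |y| <= 1/r
  repays. With at most two derivatives the size stays |y|^(p-2) / (p-2)!. For p < 2 there are too
  few powers of y, so r^2 is kept and p - 2 is truncated to 0.\<close>

lemma div_power_le:
  assumes r: "r \<ge> 1" and "\<bar>r * y\<bar> \<le> 1" and jk: "j + k \<le> 2"
  shows "r ^ j * \<bar>div_power k p y\<bar> \<le> (if p < 2 then r\<^sup>2 else 1) * (\<bar>y\<bar> ^ (p - 2) / fact (p - 2))"
proof -
  have ry: "r * \<bar>y\<bar> \<le> 1" using assms by (simp add: abs_mult)
  have y1: "\<bar>y\<bar> \<le> 1"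
  proof -
    have "\<bar>y\<bar> \<le> r * \<bar>y\<bar>" using r by (simp add: mult_le_cancel_right1)
    with ry show ?thesis by simp
  qed
  show ?thesis
  proof (cases "p < 2")
    case True
    have "\<bar>div_power k p y\<bar> \<le> 1"
      using True y1 by (auto simp: div_power_def less_2_cases_iff le_Suc_eq)
    moreover have "r ^ j \<le> r\<^sup>2" using r jk by (intro power_increasing) auto
    ultimately have "r ^ j * \<bar>div_power k p y\<bar> \<le> r\<^sup>2 * 1" using r by (intro mult_mono) auto
    then show ?thesis using True by simp
  next
    case False
    then have k: "k \<le> p" "p - k = (p - 2) + (2 - k)" using jk by auto
    have "r ^ j * \<bar>y\<bar> ^ (2 - k) \<le> r ^ (2 - k) * \<bar>y\<bar> ^ (2 - k)"
      using r jk by (intro mult_right_mono power_increasing) auto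
    also have "\<dots> = (r * \<bar>y\<bar>) ^ (2 - k)" by (simp add: power_mult_distrib)
    also have "\<dots> \<le> 1" using ry r by (intro power_le_one) auto
    finally have *: "r ^ j * \<bar>y\<bar> ^ (2 - k) \<le> 1" .
    have "r ^ j * \<bar>div_power k p y\<bar> = (r ^ j * \<bar>y\<bar> ^ (2 - k)) * (\<bar>y\<bar> ^ (p - 2) / fact (p - k))"
    proof -
      have "\<bar>y\<bar> ^ (p - k) = \<bar>y\<bar> ^ (p - 2) * \<bar>y\<bar> ^ (2 - k)"
        unfolding k(2) by (rule power_add)
      then show ?thesis using k(1) by (simp add: div_power_def power_abs)
    qed
    also have "\<dots> \<le> 1 * (\<bar>y\<bar> ^ (p - 2) / fact (p - 2))"
      using * jk r by (intro mult_mono divide_left_mono fact_mono) auto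
    finally show ?thesis using False by simp
  qed
qed

section \<open>Cut-off monomials and the coefficients of the Laplacian\<close>

context C2_cutoff
begin

text \<open>\<open>g0\<close>, \<open>g1\<close>, \<open>g2\<close> are y^p / p! cut off at height
  1/r and its first two derivatives.\<close>

definition g0 :: "real \<Rightarrow> nat \<Rightarrow> real \<Rightarrow> real" where
  "g0 r p y = div_power 0 p y * cut (r * y)"

definition g1 :: "real \<Rightarrow> nat \<Rightarrow> real \<Rightarrow> real" where
  "g1 r p y = div_power 1 p y * cut (r * y) + r * div_power 0 p y * cut' (r * y)"

definition g2 :: "real \<Rightarrow> nat \<Rightarrow> real \<Rightarrow> real" where
  "g2 r p y = div_power 2 p y * cut (r * y) + 2 * r * div_power 1 p y * cut' (r * y) +
     r\<^sup>2 * div_power 0 p y * cut'' (r * y)"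

lemma dg0: "(g0 r p has_real_derivative g1 r p y) (at y)"
proof -
  have "((\<lambda>y. cut (r * y)) has_real_derivative cut' (r * y) * r) (at y)"
    by (rule DERIV_chain2[OF dcut]) (auto intro!: derivative_eq_intros)
  from DERIV_mult[OF has_real_derivative_div_power[of 0 p y] this]
  show ?thesis unfolding g0_def[abs_def] g1_def by (simp add: algebra_simps)
qed

lemma dg1: "(g1 r p has_real_derivative g2 r p y) (at y)"
proof -
  have 1: "((\<lambda>y. cut (r * y)) has_real_derivative cut' (r * y) * r) (at y)"
    by (rule DERIV_chain2[OF dcut]) (auto intro!: derivative_eq_intros)
  have 2: "((\<lambda>y. cut' (r * y)) has_real_derivative cut'' (r * y) * r) (at y)"
    by (rule DERIV_chain2[OF dcut']) (auto intro!: derivative_eq_intros)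
  note 3 = DERIV_mult[OF has_real_derivative_div_power[of 1 p y] 1]
  note 4 = DERIV_mult[OF DERIV_cmult[OF has_real_derivative_div_power[of 0 p y], of r] 2]
  from DERIV_add[OF 3 4] show ?thesis
    unfolding g1_def[abs_def] g2_def by (simp add: algebra_simps power2_eq_square numeral_2_eq_2)
qed

lemma continuous_g2: "continuous_on UNIV (g2 r p)"
proof -
  have "continuous_on UNIV cut" "continuous_on UNIV cut'"
    by (intro continuous_at_imp_continuous_on ballI DERIV_isCont[OF dcut] DERIV_isCont[OF dcut'])+
  then have "continuous_on UNIV (\<lambda>y. cut (r * y))" "continuous_on UNIV (\<lambda>y. cut' (r * y))"
    "continuous_on UNIV (\<lambda>y. cut'' (r * y))"
    using ccut'' by (auto elim!: continuous_on_compose2 intro!: continuous_intros)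
  then show ?thesis unfolding g2_def[abs_def] by (intro continuous_intros)
qed

text \<open>The 4 counts the terms of \<open>g2\<close> with their coefficients, 1 + 2 + 1; the rest
  comes from \<open>div_power_le\<close>.\<close>

definition g_bound :: "real \<Rightarrow> nat \<Rightarrow> real \<Rightarrow> real" where
  "g_bound r p y = 4 * c * (if p < 2 then r\<^sup>2 else 1) * (\<bar>y\<bar> ^ (p - 2) / fact (p - 2))"

lemma c_nonneg: "c \<ge> 0"
  using bnd(1)[of 0] by simp

lemma g_outer:
  assumes "\<bar>r * y\<bar> \<ge> 1"
  shows "g0 r p y = 0" "g1 r p y = 0" "g2 r p y = 0"
  using outer[OF assms] by (simp_all add: g0_def g1_def g2_def)

lemma g_inner:
  assumes "\<bar>r * y\<bar> \<le> 1 / 2"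
  shows "g0 r p y = div_power 0 p y" "g1 r p y = div_power 1 p y" "g2 r p y = div_power 2 p y"
  using inner[OF assms] by (simp_all add: g0_def g1_def g2_def)

lemma g_le:
  assumes "r \<ge> 1" "\<bar>r * y\<bar> \<le> 1"
  shows "\<bar>g0 r p y\<bar> \<le> g_bound r p y" "\<bar>g1 r p y\<bar> \<le> g_bound r p y" "\<bar>g2 r p y\<bar> \<le> g_bound r p y"
proof -
  define b where "b = (if p < 2 then r\<^sup>2 else 1) * (\<bar>y\<bar> ^ (p - 2) / fact (p - 2))"
  have b0: "b \<ge> 0" by (simp add: b_def)
  have gb: "g_bound r p y = 4 * (b * c)" by (simp add: g_bound_def b_def)
  have t: "\<bar>r ^ j * div_power k p y * s\<bar> \<le> b * c" if "j + k \<le> 2" "\<bar>s\<bar> \<le> c" for j k s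
  proof -
    have "\<bar>r ^ j * div_power k p y * s\<bar> = (r ^ j * \<bar>div_power k p y\<bar>) * \<bar>s\<bar>"
      using assms by (simp add: abs_mult)
    also have "\<dots> \<le> b * c"
      using div_power_le[OF assms that(1), of p] that(2) b0 by (intro mult_mono) (auto simp: b_def)
    finally show ?thesis .
  qed
  have bc: "b * c \<ge> 0" using b0 c_nonneg by simp
  show "\<bar>g0 r p y\<bar> \<le> g_bound r p y"
    using t[of 0 0, OF _ bnd(1)[of "r * y"]] bc by (simp add: g0_def gb)
  show "\<bar>g1 r p y\<bar> \<le> g_bound r p y"
    using t[of 0 1, OF _ bnd(1)[of "r * y"]] t[of 1 0, OF _ bnd(2)[of "r * y"]] bc
    by (simp add: g1_def gb)
  show "\<bar>g2 r p y\<bar> \<le> g_bound r p y"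
    using t[of 0 2, OF _ bnd(1)[of "r * y"]] t[of 1 1, OF _ bnd(2)[of "r * y"]] t[of 2 0, OF _ bnd(3)[of "r * y"]]
    by (simp add: g2_def gb mult.assoc)
qed

text \<open>\<open>g_bound\<close> does not decrease as |y| grows, and the functions vanish from
  height 1/r on, so its value at 1/r serves for all y.\<close>

lemma g_le_uniform:
  assumes "r \<ge> 1"
  shows "\<bar>g0 r p y\<bar> \<le> g_bound r p (1 / r)" "\<bar>g1 r p y\<bar> \<le> g_bound r p (1 / r)"
    "\<bar>g2 r p y\<bar> \<le> g_bound r p (1 / r)"
proof -
  have mono: "g_bound r p y \<le> g_bound r p (1 / r)" if "\<bar>r * y\<bar> \<le> 1"
  proof -
    have "\<bar>y\<bar> \<le> \<bar>1 / r\<bar>" using that assms by (simp add: abs_mult field_simps)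
    then show ?thesis unfolding g_bound_def using c_nonneg
      by (intro mult_left_mono divide_right_mono power_mono) auto
  qed
  have nn: "g_bound r p (1 / r) \<ge> 0" unfolding g_bound_def using c_nonneg by simp
  show "\<bar>g0 r p y\<bar> \<le> g_bound r p (1 / r)" "\<bar>g1 r p y\<bar> \<le> g_bound r p (1 / r)"
    "\<bar>g2 r p y\<bar> \<le> g_bound r p (1 / r)"
    using g_le[OF assms, of y p] g_outer[of r y p] mono nn by (cases "\<bar>r * y\<bar> \<le> 1"; force)+
qed

text \<open>The coefficient of b_p in the Laplacian of the series: the second y-derivative of term p
  gives \<open>g2\<close>, and term p - 2 gives -\<open>g0\<close> because the x-Laplacian sends
  b_(p-2) to -b_p. Here \<open>r\<close> is the whole sequence of scales.\<close>

definition e_term :: "(nat \<Rightarrow> real) \<Rightarrow> nat \<Rightarrow> real \<Rightarrow> real" where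
  "e_term r p y = g2 (r p) p y - (if p < 2 then 0 else g0 (r (p - 2)) (p - 2) y)"

text \<open>As \<open>r\<close> increases, both cut-offs vanish for |y| >= 1/r_(p-2), and both equal
  1 for |y| <= 1/(2 r_p), where the second derivative of y^p / p! cancels y^(p-2) / (p-2)!, or is
  itself zero if p < 2.\<close>

lemma e_term_eq_0:
  assumes r: "mono r" "\<And>p. r p \<ge> 1" and "r (p - 2) * \<bar>y\<bar> \<ge> 1 \<or> 2 * r p * \<bar>y\<bar> \<le> 1"
  shows "e_term r p y = 0"
proof -
  have le: "r (p - 2) * \<bar>y\<bar> \<le> r p * \<bar>y\<bar>" using r(1) by (intro mult_right_mono) (auto simp: mono_def)
  have abs: "\<bar>r q * y\<bar> = r q * \<bar>y\<bar>" for q using r(2)[of q] by (simp add: abs_mult)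
  show ?thesis
  proof (cases "r (p - 2) * \<bar>y\<bar> \<ge> 1")
    case True
    then show ?thesis using le by (simp add: e_term_def g_outer abs)
  next
    case False
    with assms(3) have "r p * \<bar>y\<bar> \<le> 1 / 2" by simp
    with le show ?thesis
      by (auto simp: e_term_def g_inner abs div_power_def numeral_2_eq_2 less_Suc_eq_le not_le)
  qed
qed

text \<open>5 = 4 + 1 adds the bounds of \<open>g2\<close> and \<open>g0\<close>. The factor (r 1)^2
  absorbs the r_p^2 that remains for p < 2.\<close>

lemma e_term_le:
  assumes r: "mono r" "\<And>p. r p \<ge> 1" and y: "r (p - 2) * \<bar>y\<bar> \<le> 1"
  shows "\<bar>e_term r p y\<bar> \<le> 5 * c * (r 1)\<^sup>2 * (\<bar>y\<bar> ^ (p - 2) / fact (p - 2))"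
proof -
  have abs: "\<bar>r q * y\<bar> = r q * \<bar>y\<bar>" for q using r(2)[of q] by (simp add: abs_mult)
  let ?b = "\<bar>y\<bar> ^ (p - 2) / fact (p - 2)"
  have r1: "(r 1)\<^sup>2 \<ge> 1" using r(2)[of 1] by (simp add: one_le_power)
  have "\<bar>g2 (r p) p y\<bar> \<le> 4 * c * (r 1)\<^sup>2 * ?b"
  proof (cases "r p * \<bar>y\<bar> \<le> 1")
    case True
    have "(if p < 2 then (r p)\<^sup>2 else 1) \<le> (r 1)\<^sup>2"
      using r r1 by (auto intro!: power_mono simp: mono_def order.trans[OF zero_le_one])
    then have "g_bound (r p) p y \<le> 4 * c * (r 1)\<^sup>2 * ?b"
      unfolding g_bound_def using c_nonneg by (intro mult_right_mono mult_left_mono) auto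
    then show ?thesis using g_le(3)[OF r(2)[of p], of y p] True abs by simp
  next
    case False
    then show ?thesis using g_outer(3)[of "r p" y p] abs c_nonneg by simp
  qed
  moreover have "\<bar>if p < 2 then 0 else g0 (r (p - 2)) (p - 2) y\<bar> \<le> c * (r 1)\<^sup>2 * ?b"
  proof (cases "p < 2")
    case False
    have "\<bar>g0 (r (p - 2)) (p - 2) y\<bar> = \<bar>cut (r (p - 2) * y)\<bar> * ?b"
      by (simp add: g0_def div_power_def abs_mult power_abs)
    also have "\<dots> \<le> (c * (r 1)\<^sup>2) * ?b"
    proof (rule mult_right_mono)
      have "\<bar>cut (r (p - 2) * y)\<bar> \<le> c * 1" using bnd(1) by simp
      also have "\<dots> \<le> c * (r 1)\<^sup>2" using r1 c_nonneg by (intro mult_left_mono) auto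
      finally show "\<bar>cut (r (p - 2) * y)\<bar> \<le> c * (r 1)\<^sup>2" .
    qed simp
    finally show ?thesis using False by simp
  qed (use c_nonneg in simp)
  moreover have "4 * c * (r 1)\<^sup>2 * ?b + c * (r 1)\<^sup>2 * ?b = 5 * c * (r 1)\<^sup>2 * ?b"
    by (simp add: algebra_simps)
  ultimately show ?thesis
    unfolding e_term_def
    using abs_triangle_ineq4[of "g2 (r p) p y" "if p < 2 then 0 else g0 (r (p - 2)) (p - 2) y"] by linarith
qed

end

section \<open>Almost harmonic series\<close>

lemma has_derivative_tensor:
  fixes a :: "'a::real_normed_vector \<Rightarrow> complex"
  assumes "a differentiable (at (fst z))" "(h has_real_derivative h') (at (snd z))"
  shows "((\<lambda>z. a (fst z) * of_real (h (snd z))) has_derivative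
    (\<lambda>v. dir_deriv (fst v) a (fst z) * of_real (h (snd z)) + a (fst z) * of_real (h' * snd v))) (at z)"
proof -
  have 1: "((\<lambda>z. a (fst z)) has_derivative (\<lambda>v. dir_deriv (fst v) a (fst z))) (at z)"
    by (rule has_derivative_compose[OF has_derivative_fst[OF has_derivative_ident]
          has_derivative_dir_deriv[OF assms(1)]])
  have 2: "((\<lambda>z. h (snd z)) has_derivative (\<lambda>v. h' * snd v)) (at z)"
    using has_derivative_compose[OF has_derivative_snd[OF has_derivative_ident]
        assms(2)[unfolded has_field_derivative_def], of UNIV] by simp
  show ?thesis
    by (rule has_derivative_eq_rhs[OF has_derivative_mult[OF 1 has_derivative_of_real[OF 2]]])
       (simp add: add.commute)
qed

text \<open>Abstract input of the construction. The recursion moves the index by two, so even and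
  odd coefficients are independent and carry the two Cauchy data. One \<open>B p\<close> bounds b_p
  up to second order, and \<open>sm\<close> yields convergence in C^2.\<close>

locale harmonic_series = C2_cutoff +
  fixes b :: "nat \<Rightarrow> 'a::euclidean_space \<Rightarrow> complex" and B r :: "nat \<Rightarrow> real" and K :: "'a set"
  assumes smooth_b: "smooth (b p)"
    and b0: "norm (b p x) \<le> B p"
    and b1: "norm (dir_deriv v (b p) x) \<le> B p * norm v"
    and b2: "norm (dir_deriv w (dir_deriv v (b p)) x) \<le> B p * norm v * norm w"
    and lap_b: "laplacian (b p) x = - b (p + 2) x"
    and supp_b: "supp (b p) \<subseteq> K" and K: "compact K"
    and r: "mono r" "r p \<ge> 1"
    and sm: "summable (\<lambda>p. B p * g_bound (r p) p (1 / r p))"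
begin

definition F :: "nat \<Rightarrow> 'a \<times> real \<Rightarrow> complex" where
  "F p z = b p (fst z) * of_real (g0 (r p) p (snd z))"

text \<open>\<open>DF v\<close> and \<open>DDF w v\<close> are the first and second directional
  derivatives of \<open>F\<close>, written out so that each product can be bounded
  separately.\<close>

definition DF :: "'a \<times> real \<Rightarrow> nat \<Rightarrow> 'a \<times> real \<Rightarrow> complex" where
  "DF v p z = dir_deriv (fst v) (b p) (fst z) * of_real (g0 (r p) p (snd z)) +
     b p (fst z) * of_real (g1 (r p) p (snd z) * snd v)"

definition DDF :: "'a \<times> real \<Rightarrow> 'a \<times> real \<Rightarrow> nat \<Rightarrow> 'a \<times> real \<Rightarrow> complex" where
  "DDF w v p z = dir_deriv (fst w) (dir_deriv (fst v) (b p)) (fst z) * of_real (g0 (r p) p (snd z)) +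
     dir_deriv (fst v) (b p) (fst z) * of_real (g1 (r p) p (snd z) * snd w) +
     (dir_deriv (fst w) (b p) (fst z) * of_real (g1 (r p) p (snd z)) +
      b p (fst z) * of_real (g2 (r p) p (snd z) * snd w)) * of_real (snd v)"

abbreviation "MF p \<equiv> B p * g_bound (r p) p (1 / r p)"

lemma B_nonneg: "B p \<ge> 0"
  using b0[of p undefined] norm_ge_zero order.trans by blast

lemma dF: "(F p has_derivative (\<lambda>v. DF v p z)) (at z)"
  unfolding F_def DF_def
  by (rule has_derivative_tensor[OF smooth_differentiable[OF smooth_b] dg0])

lemma dDF: "(DF v p has_derivative (\<lambda>w. DDF w v p z)) (at z)"
proof -
  have 1: "((\<lambda>z. dir_deriv (fst v) (b p) (fst z) * of_real (g0 (r p) p (snd z))) has_derivative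
      (\<lambda>w. dir_deriv (fst w) (dir_deriv (fst v) (b p)) (fst z) * of_real (g0 (r p) p (snd z)) +
        dir_deriv (fst v) (b p) (fst z) * of_real (g1 (r p) p (snd z) * snd w))) (at z)"
    by (rule has_derivative_tensor[OF smooth_differentiable[OF smooth_dir_deriv[OF smooth_b]] dg0])
  have 2: "((\<lambda>z. b p (fst z) * of_real (g1 (r p) p (snd z)) * of_real (snd v)) has_derivative
      (\<lambda>w. (dir_deriv (fst w) (b p) (fst z) * of_real (g1 (r p) p (snd z)) +
        b p (fst z) * of_real (g2 (r p) p (snd z) * snd w)) * of_real (snd v))) (at z)"
    by (rule has_derivative_mult_left[OF has_derivative_tensor[OF smooth_differentiable[OF smooth_b] dg1]])
  have eq: "DF v p = (\<lambda>z. dir_deriv (fst v) (b p) (fst z) * of_real (g0 (r p) p (snd z)) +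
      b p (fst z) * of_real (g1 (r p) p (snd z)) * of_real (snd v))"
    by (simp add: DF_def fun_eq_iff mult.assoc)
  show ?thesis unfolding eq DDF_def by (rule has_derivative_add[OF 1 2])
qed

lemma norm_snd_le': "\<bar>snd v\<bar> \<le> norm (v :: 'a \<times> real)" and norm_fst_le': "norm (fst v) \<le> norm (v :: 'a \<times> real)"
  using norm_snd_le[of "snd v" "fst v"] norm_fst_le[of "fst v" "snd v"] by auto

lemma prod_bound:
  assumes "norm u \<le> B p * s" "\<bar>g\<bar> \<le> g_bound (r p) p (1 / r p)" "s \<ge> 0"
  shows "norm (u * of_real g :: complex) \<le> MF p * s"
proof -
  have "norm u * \<bar>g\<bar> \<le> (B p * s) * g_bound (r p) p (1 / r p)"
    using assms B_nonneg by (intro mult_mono) auto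
  then show ?thesis by (simp add: norm_mult mult_ac)
qed

lemma MF_nonneg: "MF p \<ge> 0"
  using B_nonneg[of p] c_nonneg r(2)[of p] by (simp add: g_bound_def)

lemmas g_unif = g_le_uniform[OF r(2)]

lemma norm_F_le: "norm (F p z) \<le> MF p"
  unfolding F_def using prod_bound[of _ p 1] b0 g_unif(1) by simp

lemma norm_DF_le: "norm (DF v p z) \<le> 2 * MF p * norm v"
proof -
  have "norm (dir_deriv (fst v) (b p) (fst z) * of_real (g0 (r p) p (snd z))) \<le> MF p * norm (fst v)"
    by (intro prod_bound b1 g_unif) auto
  also have "\<dots> \<le> MF p * norm v" by (intro mult_left_mono norm_fst_le' MF_nonneg)
  finally have 1: "norm (dir_deriv (fst v) (b p) (fst z) * of_real (g0 (r p) p (snd z))) \<le> MF p * norm v" .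
  have "norm ((b p (fst z) * of_real (g1 (r p) p (snd z))) * of_real (snd v)) \<le> MF p * norm v"
    unfolding norm_mult[of _ "of_real (snd v)"] norm_of_real
    using prod_bound[of _ p 1 "g1 (r p) p (snd z)"] b0 g_unif(2)
    by (intro mult_mono norm_snd_le' MF_nonneg) auto
  with 1 show ?thesis
    unfolding DF_def by (intro order.trans[OF norm_triangle_ineq]) (simp add: mult.assoc)
qed

lemma norm_DDF_le: "norm (DDF w v p z) \<le> 4 * MF p * norm v * norm w"
proof -
  let ?x = "fst z" and ?y = "snd z"
  have bound: "norm (u * of_real g * of_real t) \<le> MF p * (norm v * norm w)"
    if "norm u \<le> B p * s" "\<bar>g\<bar> \<le> g_bound (r p) p (1 / r p)" "s \<ge> 0" "s * \<bar>t\<bar> \<le> norm v * norm w"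
    for u :: complex and g s t
  proof -
    have "norm (u * of_real g * of_real t) \<le> MF p * s * \<bar>t\<bar>"
      unfolding norm_mult[of _ "of_real t"] norm_of_real
      by (intro mult_right_mono prod_bound that) auto
    also have "\<dots> \<le> MF p * (norm v * norm w)"
      unfolding mult.assoc[of "MF p"] by (intro mult_left_mono that MF_nonneg)
    finally show ?thesis .
  qed
  have 1: "norm (dir_deriv (fst w) (dir_deriv (fst v) (b p)) ?x * of_real (g0 (r p) p ?y) * of_real 1)
      \<le> MF p * (norm v * norm w)"
    using b2[of "fst w" "fst v" p ?x]
    by (intro bound[where s = "norm (fst v) * norm (fst w)"] g_unif)
       (auto simp: mult.assoc intro!: mult_mono norm_fst_le')
  have 2: "norm (dir_deriv (fst v) (b p) ?x * of_real (g1 (r p) p ?y) * of_real (snd w)) \<le> MF p * (norm v * norm w)"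
    by (intro bound[OF b1] g_unif mult_mono norm_fst_le' norm_snd_le') auto
  have "norm (fst w) * \<bar>snd v\<bar> \<le> norm w * norm v"
    by (intro mult_mono norm_fst_le' norm_snd_le') auto
  then have 3: "norm (dir_deriv (fst w) (b p) ?x * of_real (g1 (r p) p ?y) * of_real (snd v)) \<le> MF p * (norm v * norm w)"
    by (intro bound[OF b1] g_unif) (auto simp: mult.commute)
  have 4: "norm (b p ?x * of_real (g2 (r p) p ?y) * of_real (snd v * snd w)) \<le> MF p * (norm v * norm w)"
    using b0 by (intro bound[where s = 1] g_unif) (auto simp: abs_mult intro!: mult_mono norm_snd_le')
  have eq: "DDF w v p z = dir_deriv (fst w) (dir_deriv (fst v) (b p)) ?x * of_real (g0 (r p) p ?y) * of_real 1 +
      dir_deriv (fst v) (b p) ?x * of_real (g1 (r p) p ?y) * of_real (snd w) +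
      dir_deriv (fst w) (b p) ?x * of_real (g1 (r p) p ?y) * of_real (snd v) +
      b p ?x * of_real (g2 (r p) p ?y) * of_real (snd v * snd w)"
    by (simp add: DDF_def algebra_simps)
  have "norm (DDF w v p z) \<le> MF p * (norm v * norm w) + MF p * (norm v * norm w) +
      MF p * (norm v * norm w) + MF p * (norm v * norm w)"
    unfolding eq by (intro norm_triangle_mono 1 2 3 4)
  then show ?thesis by (simp add: mult_ac)
qed

definition \<Phi> :: "'a \<times> real \<Rightarrow> complex" where
  "\<Phi> z = (\<Sum>p. F p z)"

lemma summable_F: "summable (\<lambda>p. F p z)"
  by (rule summable_comparison_test'[OF sm]) (rule norm_F_le)

lemma summable_DF: "summable (\<lambda>p. DF v p z)"
  by (rule summable_comparison_test'[OF summable_mult[OF sm, of "2 * norm v"]])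
     (use norm_DF_le[of v _ z] in \<open>simp add: mult_ac\<close>)

lemma summable_DDF: "summable (\<lambda>p. DDF w v p z)"
  by (rule summable_comparison_test'[OF summable_mult[OF sm, of "4 * norm v * norm w"]])
     (use norm_DDF_le[of w v _ z] in \<open>simp add: mult_ac\<close>)

lemma differentiable_\<Phi>: "\<Phi> differentiable (at z)"
  and dir_deriv_\<Phi>: "dir_deriv v \<Phi> = (\<lambda>z. \<Sum>p. DF v p z)"
proof -
  have d: "F p differentiable (at z)" "dir_deriv v (F p) z = DF v p z" for p v z
    unfolding differentiable_def using dF by (blast, rule dir_deriv_eqI)
  note * = d(1) d(2)[THEN arg_cong[where f = norm], THEN eq_refl, THEN order.trans, OF norm_DF_le]
    summable_mult[OF sm, of 2] summable_F
  show "\<Phi> differentiable (at z)"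
    using differentiable_series[OF *(1) _ *(3) *(4)] *(2) unfolding \<Phi>_def[abs_def] by (simp add: mult.assoc)
  show "dir_deriv v \<Phi> = (\<lambda>z. \<Sum>p. DF v p z)"
    using dir_deriv_series[OF *(1) _ *(3) *(4)] *(2) unfolding \<Phi>_def[abs_def] by (intro ext) (simp add: mult.assoc d(2))
qed

lemma differentiable_dir_deriv_\<Phi>: "dir_deriv v \<Phi> differentiable (at z)"
  and dir_deriv2_\<Phi>: "dir_deriv w (dir_deriv v \<Phi>) = (\<lambda>z. \<Sum>p. DDF w v p z)"
proof -
  have d: "DF v p differentiable (at z)" "dir_deriv w (DF v p) z = DDF w v p z" for p w z
    unfolding differentiable_def using dDF by (blast, rule dir_deriv_eqI)
  note * = d(1) d(2)[THEN arg_cong[where f = norm], THEN eq_refl, THEN order.trans, OF norm_DDF_le]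
    summable_mult[OF sm, of "4 * norm v"] summable_DF[of v]
  show "dir_deriv v \<Phi> differentiable (at z)"
    using differentiable_series[OF *(1) _ *(3) *(4)] *(2) unfolding dir_deriv_\<Phi> by (simp add: mult_ac)
  show "dir_deriv w (dir_deriv v \<Phi>) = (\<lambda>z. \<Sum>p. DDF w v p z)"
    using dir_deriv_series[OF *(1) _ *(3) *(4)] *(2) unfolding dir_deriv_\<Phi> by (intro ext) (simp add: mult_ac d(2))
qed

lemma continuous_DDF: "continuous_on UNIV (DDF w v p)"
proof -
  have c: "continuous_on UNIV (\<lambda>z::'a \<times> real. f (fst z))" if "smooth f" for f :: "'a \<Rightarrow> complex"
    using smooth_continuous[OF that] by (rule continuous_on_compose2) (auto intro!: continuous_intros)
  have c': "continuous_on UNIV (\<lambda>z::'a \<times> real. h (snd z))" if "continuous_on UNIV h" for h :: "real \<Rightarrow> real"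
    using that by (rule continuous_on_compose2) (auto intro!: continuous_intros)
  have g: "continuous_on UNIV (g0 (r p) p)" "continuous_on UNIV (g1 (r p) p)"
    by (intro continuous_at_imp_continuous_on ballI DERIV_isCont[OF dg0] DERIV_isCont[OF dg1])+
  show ?thesis
    unfolding DDF_def
    by (intro continuous_intros c c' g continuous_g2 smooth_dir_deriv smooth_b)
qed

lemma C2_\<Phi>: "Ck_on 2 UNIV \<Phi>"
proof -
  have "continuous_on UNIV (dir_deriv w (dir_deriv v \<Phi>))" for w v
    unfolding dir_deriv2_\<Phi>
    by (rule continuous_on_series[OF continuous_DDF _ summable_mult[OF sm, of "4 * norm v * norm w"]])
       (use norm_DDF_le[of w v] in \<open>simp add: mult_ac\<close>)
  then show ?thesis
    by (simp add: numeral_2_eq_2 differentiable_\<Phi> differentiable_dir_deriv_\<Phi>)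
qed

lemma supp_\<Phi>: "supp \<Phi> \<subseteq> K \<times> {- 1 / r 0..1 / r 0}"
proof (rule supp_subsetI)
  show "closed (K \<times> {- 1 / r 0..1 / r 0})" using K by (intro closed_Times) (auto intro: compact_imp_closed)
  fix z assume z: "z \<notin> K \<times> {- 1 / r 0..1 / r 0}"
  have "F p z = 0" for p
  proof (cases "fst z \<in> K")
    case False
    then have "b p (fst z) = 0" using supp_b[of p] by (intro eq_0_outside_supp) auto
    then show ?thesis by (simp add: F_def)
  next
    case True
    with z have "\<bar>snd z\<bar> > 1 / r 0" by (cases z) (auto simp: abs_if)
    then have "1 \<le> r 0 * \<bar>snd z\<bar>" using r(2)[of 0] by (simp add: field_simps)
    also have "\<dots> \<le> r p * \<bar>snd z\<bar>" using r(1) by (intro mult_right_mono) (auto simp: mono_def)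
    finally have "\<bar>r p * snd z\<bar> \<ge> 1" using r(2)[of p] by (simp add: abs_mult)
    then show ?thesis by (simp add: F_def g_outer)
  qed
  then show "\<Phi> z = 0" by (simp add: \<Phi>_def)
qed

text \<open>At y = 0 every cut-off equals 1, and y^p / p! vanishes there unless p = 0.\<close>

lemma \<Phi>_0: "\<Phi> (x, 0) = b 0 x"
proof -
  have "\<Phi> (x, 0) = (\<Sum>p\<in>{0}. F p (x, 0))"
    unfolding \<Phi>_def by (rule suminf_finite) (auto simp: F_def g_inner div_power_def)
  then show ?thesis by (simp add: F_def g_inner div_power_def)
qed

lemma dy_\<Phi>_0: "dir_deriv (0, 1) \<Phi> (x, 0) = b 1 x"
proof -
  have "dir_deriv (0, 1) \<Phi> (x, 0) = (\<Sum>p\<in>{1}. DF (0, 1) p (x, 0))"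
    unfolding dir_deriv_\<Phi>
    by (rule suminf_finite) (auto simp: DF_def g_inner div_power_def dir_deriv_0 smooth_differentiable smooth_b)
  then show ?thesis by (simp add: DF_def g_inner div_power_def dir_deriv_0 smooth_differentiable smooth_b)
qed

text \<open>The x-Laplacian of term p is -b_(p+2) times its cut-off monomial. Moved to index p + 2
  and joined with the y-derivatives there, it gives \<open>e_term\<close>.\<close>

lemma laplacian_\<Phi>: "laplacian \<Phi> (x, y) = (\<Sum>p. b p x * of_real (e_term r p y))"
proof -
  have 1: "DDF (u, 0) (u, 0) p (x, y) = dir_deriv u (dir_deriv u (b p)) x * of_real (g0 (r p) p y)" for u p
    by (simp add: DDF_def)
  have dz: "dir_deriv 0 (b p) = (\<lambda>x. 0)" for p
    by (intro ext dir_deriv_0 smooth_differentiable smooth_b)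
  have 2: "DDF (0, 1) (0, 1) p (x, y) = b p x * of_real (g2 (r p) p y)" for p
    by (simp add: DDF_def dz)
  have s1: "summable (\<lambda>p. dir_deriv u (dir_deriv u (b p)) x * of_real (g0 (r p) p y))" for u
    using summable_DDF[of "(u, 0)" "(u, 0)" "(x, y)"] unfolding 1 .
  have s2: "summable (\<lambda>p. b p x * of_real (g2 (r p) p y))"
    using summable_DDF[of "(0, 1)" "(0, 1)" "(x, y)"] unfolding 2 .
  have lb: "(\<Sum>u\<in>Basis. dir_deriv u (dir_deriv u (b p)) x * of_real (g0 (r p) p y)) =
      - (b (p + 2) x * of_real (g0 (r p) p y))" for p
    using lap_b[of p x] by (simp add: laplacian_def flip: sum_distrib_right)
  \<comment> \<open>The shifted sequence, padded by zeros at 0 and 1 so that its sum from index 2 on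
    is its full sum.\<close>
  define h where "h p = (if p < 2 then 0 else b p x * of_real (g0 (r (p - 2)) (p - 2) y))" for p
  have hs: "h (p + 2) = b (p + 2) x * of_real (g0 (r p) p y)" for p by (simp add: h_def)
  have "summable (\<lambda>p. \<Sum>u\<in>Basis. dir_deriv u (dir_deriv u (b p)) x * of_real (g0 (r p) p y))"
    by (intro summable_sum s1)
  then have sh2: "summable (\<lambda>p. h (p + 2))" unfolding lb hs by (simp add: summable_minus_iff)
  then have sh: "summable h" by (subst (asm) summable_iff_shift)
  have "laplacian \<Phi> (x, y) = (\<Sum>u\<in>Basis. \<Sum>p. dir_deriv u (dir_deriv u (b p)) x * of_real (g0 (r p) p y)) +
      (\<Sum>p. b p x * of_real (g2 (r p) p y))"
    unfolding laplacian_prod dir_deriv2_\<Phi> 1 2 ..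
  also have "(\<Sum>u\<in>Basis. \<Sum>p. dir_deriv u (dir_deriv u (b p)) x * of_real (g0 (r p) p y)) = - (\<Sum>p. h (p + 2))"
  proof -
    have "(\<Sum>u\<in>Basis. \<Sum>p. dir_deriv u (dir_deriv u (b p)) x * of_real (g0 (r p) p y)) =
        (\<Sum>p. \<Sum>u\<in>Basis. dir_deriv u (dir_deriv u (b p)) x * of_real (g0 (r p) p y))"
      by (rule suminf_sum[symmetric]) (rule s1)
    also have "\<dots> = (\<Sum>p. - h (p + 2))" by (simp only: lb hs)
    also have "\<dots> = - (\<Sum>p. h (p + 2))" by (rule suminf_minus[OF sh2])
    finally show ?thesis .
  qed
  also have "(\<Sum>p. h (p + 2)) = (\<Sum>p. h p)"
  proof -
    have "(\<Sum>i<2. h i) = 0" by (simp add: h_def numeral_2_eq_2)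
    then show ?thesis using suminf_split_initial_segment[OF sh, of 2] by simp
  qed
  also have "- (\<Sum>p. h p) + (\<Sum>p. b p x * of_real (g2 (r p) p y)) = (\<Sum>p. b p x * of_real (g2 (r p) p y) - h p)"
    by (simp add: suminf_diff[OF s2 sh, symmetric])
  finally have "laplacian \<Phi> (x, y) = (\<Sum>p. b p x * of_real (g2 (r p) p y) - h p)" .
  moreover have eq: "b p x * of_real (g2 (r p) p y) - h p = b p x * of_real (e_term r p y)" for p
    by (simp add: h_def e_term_def algebra_simps)
  ultimately show ?thesis by simp
qed

end

section \<open>Construction of the extension\<close>

lemma sum_Basis_vec: "(\<Sum>b\<in>(Basis::(real ^ 'd) set). F b) = (\<Sum>i\<in>UNIV. F (axis i 1))"
proof -
  have B: "(Basis::(real ^ 'd) set) = range (\<lambda>i. axis i 1)"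
    by (auto simp: Basis_vec_def)
  have "inj (\<lambda>i::'d. axis i (1::real))"
    by (auto intro!: injI simp: axis_eq_axis)
  then show ?thesis unfolding B by (simp add: sum.reindex)
qed

lemma laplacian_eq_iter_deriv: "laplacian f = (\<lambda>x. \<Sum>i\<in>UNIV. iter_deriv [i, i] f x)"
  by (simp add: laplacian_def sum_Basis_vec fun_eq_iff)

lemma smooth_laplacian: "smooth f \<Longrightarrow> smooth (laplacian (f :: real ^ 'd \<Rightarrow> complex))"
  unfolding laplacian_eq_iter_deriv by (intro smooth_sum smooth_iter_deriv)

lemma smooth_laplacian_power: "smooth f \<Longrightarrow> smooth ((laplacian ^^ j) (f :: real ^ 'd \<Rightarrow> complex))"
  by (induction j) (auto intro: smooth_laplacian)

lemma supp_laplacian_power: "supp ((laplacian ^^ j) f) \<subseteq> supp f"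
  by (induction j) (use supp_laplacian in \<open>force+\<close>)

lemma iter_deriv_sum:
  assumes "\<And>i. i \<in> I \<Longrightarrow> smooth (f i)"
  shows "iter_deriv is (\<lambda>x. \<Sum>i\<in>I. f i x) = (\<lambda>x. \<Sum>i\<in>I. iter_deriv is (f i) x)"
proof (induction "is")
  case (Cons a "is")
  have "dir_deriv (axis a 1) (\<lambda>x. \<Sum>i\<in>I. iter_deriv is (f i) x) x =
      (\<Sum>i\<in>I. dir_deriv (axis a 1) (iter_deriv is (f i)) x)" for x
    by (intro dir_deriv_sum smooth_differentiable smooth_iter_deriv assms)
  then show ?case by (simp add: Cons)
qed simp

lemma iter_deriv_cmult:
  assumes "smooth f"
  shows "iter_deriv is (\<lambda>x. a * f x) = (\<lambda>x. a * iter_deriv is f x)"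
proof (induction "is")
  case (Cons i "is")
  have "dir_deriv (axis i 1) (\<lambda>x. a * iter_deriv is f x) x = a * dir_deriv (axis i 1) (iter_deriv is f) x" for x
    by (intro dir_deriv_cmult smooth_differentiable smooth_iter_deriv assms)
  then show ?case by (simp add: Cons)
qed simp

lemma iter_deriv_laplacian:
  assumes "smooth f"
  shows "iter_deriv is (laplacian f) x = (\<Sum>i\<in>UNIV. iter_deriv (is @ [i, i]) f x)"
  unfolding laplacian_eq_iter_deriv iter_deriv_append
  by (subst iter_deriv_sum) (auto intro: smooth_iter_deriv smooth_dir_deriv assms)

text \<open>Each Laplacian is a sum of d second derivatives. They are appended to the list, which is
  why the induction leaves it arbitrary.\<close>

lemma norm_iter_deriv_laplacian_power_le:
  fixes f :: "real ^ 'd \<Rightarrow> complex"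
  assumes f: "smooth f" and S: "\<And>is x. norm (iter_deriv is f x) \<le> S (length is)"
  shows "norm (iter_deriv is ((laplacian ^^ j) f) x) \<le> real CARD('d) ^ j * S (length is + 2 * j)"
proof (induction j arbitrary: "is")
  case (Suc j)
  have "norm (iter_deriv is ((laplacian ^^ Suc j) f) x) \<le>
      (\<Sum>i\<in>UNIV. norm (iter_deriv (is @ [i, i]) ((laplacian ^^ j) f) x))"
    by (simp add: iter_deriv_laplacian[OF smooth_laplacian_power[OF f]] norm_sum)
  also have "\<dots> \<le> (\<Sum>i\<in>(UNIV::'d set). real CARD('d) ^ j * S (length is + 2 * Suc j))"
  proof (rule sum_mono)
    fix i :: 'd
    show "norm (iter_deriv (is @ [i, i]) ((laplacian ^^ j) f) x) \<le> real CARD('d) ^ j * S (length is + 2 * Suc j)"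
      using Suc[of "is @ [i, i]"] by simp
  qed
  finally show ?case by simp
qed (simp add: S)

text \<open>Passes from coordinate derivatives to arbitrary directions, the form that
  \<open>harmonic_series\<close> demands; d^2 is a common factor for both orders.\<close>

lemma
  fixes f :: "real ^ 'd \<Rightarrow> complex"
  assumes f: "smooth f" and B: "\<And>is x. length is \<le> 2 \<Longrightarrow> norm (iter_deriv is f x) \<le> B"
  shows norm_dir_deriv_le_iter: "norm (dir_deriv v f x) \<le> real CARD('d) ^ 2 * B * norm v"
    and norm_dir_deriv2_le_iter: "norm (dir_deriv w (dir_deriv v f) x) \<le> real CARD('d) ^ 2 * B * norm v * norm w"
proof -
  let ?d = "real CARD('d)"
  have d1: "?d \<ge> 1" using one_le_card_finite[where 'a='d] by simp
  have B0: "B \<ge> 0" by (rule order.trans[OF norm_ge_zero B[of "[]" undefined]]) simp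
  have ax: "\<exists>i. u = axis i 1" if "u \<in> Basis" for u :: "real ^ 'd"
    using that by (auto simp: Basis_vec_def)
  have e1: "norm (dir_deriv u f x) \<le> B" if "u \<in> Basis" for u x
  proof -
    from ax[OF that] obtain i where "u = axis i 1" by blast
    then show ?thesis using B[of "[i]" x] by simp
  qed
  have e2: "norm (dir_deriv u' (dir_deriv u f) x) \<le> B" if "u \<in> Basis" "u' \<in> Basis" for u u' x
  proof -
    from ax[OF that(1)] ax[OF that(2)] obtain i j where "u = axis i 1" "u' = axis j 1" by blast
    then show ?thesis using B[of "[j, i]" x] by simp
  qed
  have "norm (dir_deriv v f x) \<le> ?d * B * norm v"
    using norm_dir_deriv_le[OF smooth_differentiable[OF f] e1] by simp
  also have "\<dots> \<le> ?d ^ 2 * B * norm v"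
    using d1 B0 by (intro mult_right_mono) (auto simp: power2_eq_square)
  finally show "norm (dir_deriv v f x) \<le> ?d ^ 2 * B * norm v" .
  have "norm (dir_deriv u (dir_deriv v f) x) \<le> ?d * B * norm v" if u: "u \<in> Basis" for u
  proof -
    have "dir_deriv v f = (\<lambda>x. \<Sum>c\<in>Basis. of_real (v \<bullet> c) * dir_deriv c f x)"
      unfolding scaleR_conv_of_real[symmetric] by (intro ext dir_deriv_Basis smooth_differentiable f)
    then have "dir_deriv u (dir_deriv v f) x = (\<Sum>c\<in>Basis. dir_deriv u (\<lambda>x. of_real (v \<bullet> c) * dir_deriv c f x) x)"
      by (simp only:) (intro dir_deriv_sum smooth_differentiable smooth_cmult smooth_dir_deriv f)
    also have "\<dots> = (\<Sum>c\<in>Basis. of_real (v \<bullet> c) * dir_deriv u (dir_deriv c f) x)"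
      by (intro sum.cong refl dir_deriv_cmult smooth_differentiable smooth_dir_deriv f)
    also have "norm \<dots> \<le> (\<Sum>c\<in>(Basis::(real ^ 'd) set). norm v * B)"
      by (intro sum_norm_le) (auto simp: norm_mult Basis_le_norm intro!: mult_mono e2 u)
    finally show ?thesis by (simp add: mult_ac)
  qed
  from norm_dir_deriv_le[OF smooth_differentiable[OF smooth_dir_deriv[OF f]] this, of w]
  show "norm (dir_deriv w (dir_deriv v f) x) \<le> ?d ^ 2 * B * norm v * norm w"
    by (simp add: power2_eq_square mult_ac)
qed

text \<open>The defining supremum runs over multi-indices; compactness of \<open>K\<close> makes
  \<open>iter_deriv_eq_multi_deriv\<close> available to pass to lists.\<close>

lemma DMh_imp_iter_deriv_le:
  assumes \<psi>: "\<psi> \<in> DMh K M h" and M: "weight_sequence M" and "h > 0" and "compact K"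
  obtains C where "smooth \<psi>" "supp \<psi> \<subseteq> K"
    "\<And>is x. norm (iter_deriv is \<psi> x) \<le> C * h ^ length is * M (length is)"
proof -
  have s: "smooth \<psi>" "supp \<psi> \<subseteq> K" using \<psi> by (auto simp: DMh_def smooth_def)
  from \<psi> have "bdd_above (range (\<lambda>(\<alpha>, x). norm (multi_deriv \<alpha> \<psi> x) / (h ^ order_of \<alpha> * M (order_of \<alpha>))))"
    by (simp add: DMh_def)
  then obtain C where C: "\<And>\<alpha> x. norm (multi_deriv \<alpha> \<psi> x) / (h ^ order_of \<alpha> * M (order_of \<alpha>)) \<le> C"
    unfolding bdd_above_def by (auto simp: split_beta)
  have "norm (iter_deriv is \<psi> x) \<le> C * h ^ length is * M (length is)" for "is" x
  proof -
    obtain \<alpha> where \<alpha>: "iter_deriv is \<psi> = multi_deriv \<alpha> \<psi>" "order_of \<alpha> = length is"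
      using iter_deriv_eq_multi_deriv[OF s(1) compact_supp_subset[OF \<open>compact K\<close> s(2)]] by blast
    have "h ^ length is * M (length is) > 0" using \<open>h > 0\<close> weight_sequenceD(1)[OF M] by simp
    then show ?thesis using C[of \<alpha> x] unfolding \<alpha> by (simp add: pos_divide_le_eq mult.assoc)
  qed
  with s that show ?thesis by blast
qed

lemma iter_deriv_le_imp_DMh:
  assumes "smooth \<psi>" "supp \<psi> \<subseteq> K" and M: "weight_sequence M" and "h > 0"
    and C: "\<And>is x. norm (iter_deriv is \<psi> x) \<le> C * h ^ length is * M (length is)"
  shows "\<psi> \<in> DMh K M h"
proof -
  have "norm (multi_deriv \<alpha> \<psi> x) / (h ^ order_of \<alpha> * M (order_of \<alpha>)) \<le> C" for \<alpha> x
  proof -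
    obtain "is" where "multi_deriv \<alpha> \<psi> = iter_deriv is \<psi>" "length is = order_of \<alpha>"
      using multi_deriv_eq_iter_deriv by blast
    then have le: "norm (multi_deriv \<alpha> \<psi> x) \<le> C * (h ^ order_of \<alpha> * M (order_of \<alpha>))"
      using C[of "is" x] by (simp add: mult.assoc)
    have "h ^ order_of \<alpha> * M (order_of \<alpha>) > 0" using \<open>h > 0\<close> weight_sequenceD(1)[OF M] by simp
    then show ?thesis using le by (simp add: pos_divide_le_eq)
  qed
  then show ?thesis
    using assms(1,2) by (auto simp: DMh_def smooth_def intro!: bdd_aboveI2[of _ _ C])
qed

definition small_laplacian ::
    "('a::euclidean_space \<times> real) set \<Rightarrow> (nat \<Rightarrow> real) \<Rightarrow> real \<Rightarrow> ('a \<times> real \<Rightarrow> complex) \<Rightarrow> bool" where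
  "small_laplacian V M h \<Phi> \<longleftrightarrow> bdd_above ((\<lambda>(x, y). norm (laplacian \<Phi> (x, y)) *
     exp (assoc_fun (seq_star M) (1 / (h * \<bar>y\<bar>)))) ` {(x, y) \<in> V. y \<noteq> 0})"

text \<open>\<open>L\<close> bounds the data, \<open>M\<close> fixes the cut-off heights,
  \<open>N\<close> dominates their running maximum, and \<open>N'\<close> measures the decay. In
  \<open>h'\<close> the number 4 d h H3 is 2A with A = 2 d h H3: the d comes from the powers of the
  Laplacian, one 2 from the geometric factor 2^(-n), the other from
  \<open>truncation_estimate\<close>.\<close>

theorem almost_harmonic_extension:
  fixes \<psi>0 \<psi>1 \<phi>0 \<phi>1 :: "real ^ 'd \<Rightarrow> complex" and L M N N' :: "nat \<Rightarrow> real"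
    and h h' C1 C2 C3 H2 H3 :: real
  assumes V: "open V" "V \<inter> (UNIV \<times> {0}) = \<Omega> \<times> {0}"
    and K01: "compact K0" "compact K1" "K0 \<subseteq> \<Omega>" "K1 \<subseteq> \<Omega>"
    and \<psi>: "\<psi>0 \<in> DMh K0 L h" "\<psi>1 \<in> DMh K1 L h"
    and \<phi>: "\<And>x. x \<in> \<Omega> \<Longrightarrow> \<phi>0 x = \<psi>0 x" "\<And>x. x \<in> \<Omega> \<Longrightarrow> \<phi>1 x = \<psi>1 x"
    and L: "weight_sequence L" and M: "weight_sequence M" and N: "weight_sequence N" "non_quasianalytic N"
    and N': "weight_sequence N'" "non_quasianalytic N'"
    and pos: "h > 0" "C1 > 0" "C2 > 0" "H2 > 0" "C3 > 0" "H3 > 0"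
    and LM: "\<And>p. L (p + 4) \<le> C3 * H3 ^ p * M p"
    and MN: "\<And>p q. 1 \<le> q \<Longrightarrow> q \<le> p \<Longrightarrow> quot_seq_star M q \<le> C1 * quot_seq_star N p"
    and NN': "\<And>p. N (p + 2) \<le> C2 * H2 ^ p * N' p"
    and h': "h' = 4 * CARD('d) * h * H3 * C1 * H2"
  shows "\<exists>\<Phi>\<in>C2c V. (\<forall>x\<in>\<Omega>. \<Phi> (x, 0) = \<phi>0 x) \<and> (\<forall>x\<in>\<Omega>. dir_deriv (0, 1) \<Phi> (x, 0) = \<phi>1 x) \<and>
    small_laplacian V N' h' \<Phi>"
proof -
  obtain C where s0: "smooth \<psi>0" "supp \<psi>0 \<subseteq> K0" and
    C: "\<And>is x. norm (iter_deriv is \<psi>0 x) \<le> C * h ^ length is * L (length is)"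
    using DMh_imp_iter_deriv_le[OF \<psi>(1) L pos(1) K01(1)] by blast
  obtain C' where s1: "smooth \<psi>1" "supp \<psi>1 \<subseteq> K1" and
    C': "\<And>is x. norm (iter_deriv is \<psi>1 x) \<le> C' * h ^ length is * L (length is)"
    using DMh_imp_iter_deriv_le[OF \<psi>(2) L pos(1) K01(2)] by blast
  have nn: "h ^ k * L k \<ge> 0" for k using pos(1) weight_sequenceD(1)[OF L, of k] by simp
  define C0 where "C0 = max C C'"
  have le: "a * (h ^ k * L k) \<le> C0 * (h ^ k * L k)" if "a \<le> C0" for a k
    by (rule mult_right_mono[OF that nn])
  have bound0: "norm (iter_deriv is \<psi>0 x) \<le> C0 * h ^ length is * L (length is)" for "is" x
    using C[of "is" x] le[of C "length is"]
    by (simp add: mult.assoc C0_def)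
  have bound1: "norm (iter_deriv is \<psi>1 x) \<le> C0 * h ^ length is * L (length is)" for "is" x
    using C'[of "is" x] le[of C' "length is"]
    by (simp add: mult.assoc C0_def)
  define K where "K = K0 \<union> K1"
  have K: "supp \<psi>0 \<subseteq> K" "supp \<psi>1 \<subseteq> K" "compact K"
    using s0 s1 K01 by (auto simp: K_def)
  have KV: "K \<times> {0} \<subseteq> V" using V(2) K01(3,4) unfolding K_def by blast
  define d where "d = real CARD('d)"
  have d1: "d \<ge> 1" using one_le_card_finite[where 'a='d] by (simp add: d_def)
  define \<eta> where "\<eta> = h * H3"
  have \<eta>: "\<eta> > 0" using pos by (simp add: \<eta>_def)
  define A where "A = 2 * (d * \<eta>)"
  have A: "A > 0" using d1 \<eta> by (simp add: A_def)
  have h'A: "h' = 2 * A * C1 * H2" by (simp add: h' A_def \<eta>_def d_def)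
  have h'pos: "h' > 0" using A pos by (simp add: h'A)
  have Mpos: "M p > 0" and Lpos: "L p > 0" for p using weight_sequenceD(1) L M by auto
  have C0: "C0 \<ge> 0"
  proof -
    have "0 \<le> C0 * h ^ length ([]::'d list) * L (length ([]::'d list))"
      by (rule order.trans[OF norm_ge_zero bound0[of "[]" undefined]])
    then show ?thesis by (simp add: weight_sequenceD(2)[OF L])
  qed
  \<comment> \<open>Model for h^k L_k after the shift by four. For k < 4 truncated subtraction gives
    M_0 = 1, and these k are absorbed into \<open>C4\<close>.\<close>
  define Q where "Q k = \<eta> ^ k * M (k - 4)" for k
  have Qpos: "Q k > 0" for k using \<eta> Mpos by (simp add: Q_def)
  define C4 where "C4 = C3 / H3 ^ 4 + (\<Sum>k<4. L k / H3 ^ k)"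
  have C4pos: "C4 > 0" unfolding C4_def using pos Lpos by (intro add_pos_nonneg sum_nonneg) (auto simp: less_imp_le)
  have LQ: "h ^ k * L k \<le> C4 * Q k" for k
  proof (cases "k < 4")
    case True
    have "L k / H3 ^ k \<le> (\<Sum>k<4. L k / H3 ^ k)"
      using True Lpos pos by (intro member_le_sum) (auto simp: less_imp_le)
    then have "L k / H3 ^ k \<le> C4" using pos by (simp add: C4_def add_increasing)
    then have "L k / H3 ^ k * Q k \<le> C4 * Q k" using Qpos[of k] by (intro mult_right_mono) auto
    moreover have "L k / H3 ^ k * Q k = h ^ k * L k"
      using True pos by (simp add: Q_def \<eta>_def power_mult_distrib weight_sequenceD(2)[OF M])
    ultimately show ?thesis by simp
  next
    case False
    define m where "m = k - 4"
    have k: "k = m + 4" using False by (simp add: m_def)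
    have "h ^ k * L k \<le> h ^ k * (C3 * H3 ^ m * M m)"
      unfolding k using LM[of m] pos by (intro mult_left_mono) auto
    also have "\<dots> = C3 / H3 ^ 4 * Q k"
      using pos by (simp add: Q_def \<eta>_def k power_mult_distrib power_add)
    also have "\<dots> \<le> C4 * Q k"
      unfolding C4_def using Qpos[of k] pos Lpos
      by (intro mult_right_mono) (auto intro!: sum_nonneg simp: less_imp_le)
    finally show ?thesis .
  qed
  define m1 where "m1 = quot_seq M 1"
  have m1: "m1 > 0" unfolding m1_def by (rule weight_sequenceD[OF M])
  \<comment> \<open>Makes \<open>Q\<close> increasing up to a constant: from k to k + 1 it is
    multiplied by \<eta> if k < 4 and by at least \<eta> m1 otherwise.\<close>
  define \<kappa> where "\<kappa> = max 1 (max (1 / \<eta>) (1 / (\<eta> * m1)))"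
  have \<kappa>1: "\<kappa> \<ge> 1" by (simp add: \<kappa>_def)
  have "1 / \<eta> \<le> \<kappa>" "1 / (\<eta> * m1) \<le> \<kappa>" by (simp_all add: \<kappa>_def)
  then have \<kappa>: "1 \<le> \<kappa> * \<eta>" "1 \<le> \<kappa> * \<eta> * m1"
    using \<eta> m1 by (simp_all add: divide_le_eq mult_ac)
  have Qstep: "Q k \<le> \<kappa> * Q (Suc k)" for k
  proof (cases "k < 4")
    case True
    then have "\<kappa> * Q (Suc k) = (\<kappa> * \<eta>) * Q k" by (simp add: Q_def)
    moreover have "1 * Q k \<le> (\<kappa> * \<eta>) * Q k" using \<kappa>(1) Qpos[of k] by (intro mult_right_mono) auto
    ultimately show ?thesis by linarith
  next
    case False
    define m where "m = k - 4"
    have k: "k = m + 4" using False by (simp add: m_def)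
    have "m1 \<le> quot_seq M (Suc m)" unfolding m1_def by (intro weight_sequenceD(3)[OF M]) auto
    then have "m1 * M m \<le> M (Suc m)" using Mpos[of m] by (simp add: quot_seq_def field_simps)
    then have "\<kappa> * (\<eta> * \<eta> ^ k) * (m1 * M m) \<le> \<kappa> * (\<eta> * \<eta> ^ k) * M (Suc m)"
      using \<kappa>1 \<eta> by (intro mult_left_mono) auto
    moreover have "Q k = \<eta> ^ k * M m" "Q (Suc k) = \<eta> * \<eta> ^ k * M (Suc m)"
    proof -
      have "k - 4 = m" "Suc k - 4 = Suc m" by (simp_all add: k)
      then show "Q k = \<eta> ^ k * M m" "Q (Suc k) = \<eta> * \<eta> ^ k * M (Suc m)"
        unfolding Q_def by (simp_all only: power_Suc)
    qed
    ultimately have "(\<kappa> * \<eta> * m1) * Q k \<le> \<kappa> * Q (Suc k)" by (simp add: mult_ac)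
    moreover have "1 * Q k \<le> (\<kappa> * \<eta> * m1) * Q k" using \<kappa>(2) Qpos[of k] by (intro mult_right_mono) auto
    ultimately show ?thesis by linarith
  qed
  have Qsteps: "Q k \<le> \<kappa> ^ i * Q (k + i)" for k i
  proof (induction i)
    case (Suc i)
    have "Q k \<le> \<kappa> ^ i * Q (k + i)" by (rule Suc)
    also have "\<dots> \<le> \<kappa> ^ i * (\<kappa> * Q (Suc (k + i)))" using \<kappa>1 Qstep by (intro mult_left_mono) auto
    finally show ?case by (simp add: mult_ac)
  qed simp
  \<comment> \<open>For a list of length at most 2, its length plus 2 (p div 2) lies between p - 1
    and p + 2, so at most three steps lead to p + 2.\<close>
  have Q3: "Q k \<le> \<kappa> ^ 3 * Q (p + 2)" if "p + 2 \<le> k + 3" "k \<le> p + 2" for k p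
  proof -
    define i where "i = p + 2 - k"
    have i: "i \<le> 3" "k + i = p + 2" using that by (auto simp: i_def)
    have "Q k \<le> \<kappa> ^ i * Q (p + 2)" using Qsteps[of k i] i by simp
    also have "\<dots> \<le> \<kappa> ^ 3 * Q (p + 2)"
      using i \<kappa>1 Qpos[of "p + 2"] by (intro mult_right_mono power_increasing) auto
    finally show ?thesis .
  qed
  \<comment> \<open>\<eta>^(p+2) exceeds \<eta>^(p-2) by four powers, or by fewer when p - 2 is
    truncated; \<epsilon> >= 1 bounds them uniformly by \<epsilon>^4.\<close>
  define \<epsilon> where "\<epsilon> = max 1 \<eta>"
  have dQ: "d ^ p * Q (p + 2) \<le> d\<^sup>2 * \<epsilon> ^ 4 * ((A / 2) ^ (p - 2) * M (p - 2))" for p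
  proof -
    have \<epsilon>: "\<epsilon> \<ge> 1" "\<eta> \<le> \<epsilon>" by (auto simp: \<epsilon>_def)
    have 1: "\<eta> ^ (p + 2) \<le> \<epsilon> ^ 4 * \<eta> ^ (p - 2)"
    proof (cases "p < 2")
      case True
      have "\<eta> ^ (p + 2) \<le> \<epsilon> ^ (p + 2)" using \<epsilon> \<eta> by (intro power_mono) auto
      also have "\<dots> \<le> \<epsilon> ^ 4" using True \<epsilon> by (intro power_increasing) auto
      finally show ?thesis using True by simp
    next
      case False
      then have "p + 2 = (p - 2) + 4" by simp
      then have "\<eta> ^ (p + 2) = \<eta> ^ (p - 2) * \<eta> ^ 4" by (metis power_add)
      also have "\<dots> \<le> \<eta> ^ (p - 2) * \<epsilon> ^ 4" using \<epsilon> \<eta> by (intro mult_left_mono power_mono) auto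
      finally show ?thesis by (simp add: mult_ac)
    qed
    have "d ^ p \<le> d ^ (2 + (p - 2))" using d1 by (intro power_increasing) auto
    then have 2: "d ^ p \<le> d\<^sup>2 * d ^ (p - 2)" by (simp only: power_add)
    have "d ^ p * Q (p + 2) = d ^ p * \<eta> ^ (p + 2) * M (p - 2)" by (simp add: Q_def)
    also have "\<dots> \<le> (d\<^sup>2 * d ^ (p - 2)) * (\<epsilon> ^ 4 * \<eta> ^ (p - 2)) * M (p - 2)"
      using 1 2 d1 \<eta> Mpos[of "p - 2"] by (intro mult_mono) (auto simp: less_imp_le \<epsilon>_def)
    finally show ?thesis by (simp add: A_def power_mult_distrib mult_ac)
  qed
  \<comment> \<open>Signs and powers are arranged so that the x-Laplacian sends b_p to -b_(p+2),
    starting from b_0 = \<psi>0 and b_1 = \<psi>1.\<close>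
  define b where "b p x = (-1) ^ (p div 2) * (laplacian ^^ (p div 2)) (if even p then \<psi>0 else \<psi>1) x" for p :: nat and x
  define C5 where "C5 = C0 * C4 * \<kappa> ^ 3"
  have C5: "C5 \<ge> 0" unfolding C5_def using C0 C4pos \<kappa>1 by simp
  define C7 where "C7 = d\<^sup>2 * (C5 * (d\<^sup>2 * \<epsilon> ^ 4))"
  have C7: "C7 \<ge> 0" unfolding C7_def using C5 by (simp add: \<epsilon>_def)
  \<comment> \<open>A / 2 = d \<eta> collects the powers of the Laplacian and the radius; the d^2
    inside \<open>C7\<close> accounts for arbitrary directions.\<close>
  define B where "B p = C7 * ((A / 2) ^ (p - 2) * M (p - 2))" for p
  have smb: "smooth (b p)" for p
    unfolding b_def by (intro smooth_cmult smooth_laplacian_power) (use s0(1) s1(1) in auto)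
  have itb: "norm (iter_deriv is (b p) x) \<le> C5 * (d\<^sup>2 * \<epsilon> ^ 4 * ((A / 2) ^ (p - 2) * M (p - 2)))"
    if len: "length is \<le> 2" for "is" p x
  proof -
    let ?j = "p div 2" and ?\<psi> = "if even p then \<psi>0 else \<psi>1"
    let ?k = "length is + 2 * ?j"
    have s: "smooth ?\<psi>" using s0(1) s1(1) by auto
    have bd: "norm (iter_deriv is ?\<psi> x) \<le> C0 * h ^ length is * L (length is)" for "is" x
      using bound0 bound1 by auto
    have "iter_deriv is (b p) = (\<lambda>x. (-1) ^ ?j * iter_deriv is ((laplacian ^^ ?j) ?\<psi>) x)"
      unfolding b_def by (intro iter_deriv_cmult smooth_laplacian_power s)
    then have "norm (iter_deriv is (b p) x) = norm (iter_deriv is ((laplacian ^^ ?j) ?\<psi>) x)"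
      by (simp add: norm_mult norm_power)
    also have "\<dots> \<le> d ^ ?j * (C0 * h ^ ?k * L ?k)"
      unfolding d_def by (rule norm_iter_deriv_laplacian_power_le[OF s bd])
    also have "\<dots> = C0 * (d ^ ?j * (h ^ ?k * L ?k))" by (simp add: mult_ac)
    also have "\<dots> \<le> C0 * (d ^ p * (C4 * (\<kappa> ^ 3 * Q (p + 2))))"
    proof (rule mult_left_mono[OF mult_mono C0])
      show "d ^ ?j \<le> d ^ p" using d1 by (intro power_increasing) auto
      have "C4 * Q ?k \<le> C4 * (\<kappa> ^ 3 * Q (p + 2))"
        using C4pos len by (intro mult_left_mono Q3) auto
      then show "h ^ ?k * L ?k \<le> C4 * (\<kappa> ^ 3 * Q (p + 2))" using LQ[of ?k] by simp
    qed (use d1 pos Lpos[of ?k] in \<open>auto simp: less_imp_le\<close>)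
    also have "\<dots> = C5 * (d ^ p * Q (p + 2))" by (simp add: C5_def mult_ac)
    also have "\<dots> \<le> C5 * (d\<^sup>2 * \<epsilon> ^ 4 * ((A / 2) ^ (p - 2) * M (p - 2)))"
      by (rule mult_left_mono[OF dQ C5])
    finally show ?thesis .
  qed
  \<comment> \<open>A tube of uniform radius e around K x {0} inside V; cut-off heights at most 1/R
    < e keep the support of \<Phi> within it.\<close>
  obtain e where "e > 0" and e: "(\<Union>z\<in>K \<times> {0}. ball z e) \<subseteq> V"
    using compact_subset_open_imp_ball_epsilon_subset[OF compact_Times[OF K(3) compact_sing] V(1) KV] by blast
  define R where "R = max 1 (2 / e)"
  have R: "R \<ge> 1" "1 / R < e"
  proof -
    show "R \<ge> 1" by (simp add: R_def)
    have "2 / e \<le> R" by (simp add: R_def)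
    then show "1 / R < e" using \<open>e > 0\<close> \<open>R \<ge> 1\<close> by (simp add: field_simps)
  qed
  \<comment> \<open>The floor R confines the support and ensures r_p >= 1; the other entry is the
    scale of \<open>truncation_estimate\<close>.\<close>
  define r where "r p = max R (A * max_quot M p)" for p
  have r_mono: "mono r" unfolding r_def mono_def
    by (intro allI impI max.mono mult_left_mono max_quot_mono order_refl) (use A in auto)
  have r1: "r p \<ge> 1" for p using R by (simp add: r_def le_max_iff_disj)
  \<comment> \<open>Below the cut-off height M*_n t^n is at most (max_quot M n * t)^n <= A^(-n),
    which leaves the summable 2^(-n).\<close>
  have half: "(A / 2) ^ n * seq_star M n * t ^ n \<le> (1 / 2) ^ n" if t: "0 \<le> t" "r n * t \<le> 1" for n t
  proof -
    have "A * max_quot M n * t \<le> r n * t" using t by (intro mult_right_mono) (auto simp: r_def)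
    then have 1: "A * max_quot M n * t \<le> 1" using t by simp
    have "(A / 2) ^ n * seq_star M n * t ^ n \<le> (A / 2) ^ n * (max_quot M n ^ n) * t ^ n"
      using seq_star_le_max_quot[OF M, of 0 n] A t
      by (intro mult_right_mono mult_left_mono) (auto simp: weight_sequenceD(6)[OF M])
    also have "\<dots> = (1 / 2) ^ n * (A * max_quot M n * t) ^ n"
      by (simp add: power_mult_distrib power_divide)
    also have "\<dots> \<le> (1 / 2) ^ n * 1"
      using 1 A t max_quot_pos[OF M, of n] by (intro mult_left_mono power_le_one) auto
    finally show ?thesis by simp
  qed
  have sum_half: "summable (\<lambda>p. (1 / 2 :: real) ^ (p - 2))"
    by (subst summable_iff_shift[of _ 2, symmetric]) (simp add: summable_geometric)
  obtain cut cut' cut'' c where cut: "C2_cutoff cut cut' cut'' c" using ex_C2_cutoff by blast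
  interpret C2_cutoff cut cut' cut'' c by (rule cut)
  interpret harmonic_series cut cut' cut'' c b B r K
  proof
    fix p x and v w :: "real ^ 'd"
    show "smooth (b p)" by (rule smb)
    have "norm (b p x) \<le> C5 * (d\<^sup>2 * \<epsilon> ^ 4 * ((A / 2) ^ (p - 2) * M (p - 2)))"
      using itb[of "[]" p x] by simp
    also have "\<dots> \<le> d\<^sup>2 * (C5 * (d\<^sup>2 * \<epsilon> ^ 4 * ((A / 2) ^ (p - 2) * M (p - 2))))"
      using d1 C5 A Mpos[of "p - 2"]
        mult_right_mono[of 1 "d\<^sup>2" "C5 * (d\<^sup>2 * \<epsilon> ^ 4 * ((A / 2) ^ (p - 2) * M (p - 2)))"]
      by (simp add: one_le_power less_imp_le \<epsilon>_def)
    finally show "norm (b p x) \<le> B p" by (simp add: B_def C7_def mult_ac)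
    show "norm (dir_deriv v (b p) x) \<le> B p * norm v"
      using norm_dir_deriv_le_iter[OF smb[of p] itb[where p = p], where v = v and x = x] by (simp add: B_def C7_def d_def mult_ac)
    show "norm (dir_deriv w (dir_deriv v (b p)) x) \<le> B p * norm v * norm w"
      using norm_dir_deriv2_le_iter[OF smb[of p] itb[where p = p], where w = w and v = v and x = x] by (simp add: B_def C7_def d_def mult_ac)
    show "laplacian (b p) x = - b (p + 2) x"
    proof -
      let ?f = "(laplacian ^^ (p div 2)) (if even p then \<psi>0 else \<psi>1)"
      have s: "smooth ?f" using s0(1) s1(1) by (intro smooth_laplacian_power) auto
      have "laplacian (b p) x = (\<Sum>i\<in>UNIV. (-1) ^ (p div 2) * iter_deriv [i, i] ?f x)"
        unfolding b_def laplacian_eq_iter_deriv[of "\<lambda>x. (-1) ^ (p div 2) * ?f x"]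
        by (subst iter_deriv_cmult[OF s]) simp
      also have "\<dots> = (-1) ^ (p div 2) * laplacian ?f x"
        by (simp add: laplacian_eq_iter_deriv sum_distrib_left)
      finally show ?thesis by (simp add: b_def)
    qed
    have "supp (b p) \<subseteq> supp ((laplacian ^^ (p div 2)) (if even p then \<psi>0 else \<psi>1))"
      unfolding b_def by (rule supp_subsetI[OF closed_supp]) (simp add: eq_0_outside_supp)
    also have "\<dots> \<subseteq> supp (if even p then \<psi>0 else \<psi>1)" by (rule supp_laplacian_power)
    finally show "supp (b p) \<subseteq> K" using K by (auto split: if_splits)
    show "compact K" by (rule K)
    show "mono r" by (rule r_mono)
    show "r p \<ge> 1" by (rule r1)
    show "summable (\<lambda>p. B p * g_bound (r p) p (1 / r p))"
    proof (rule summable_comparison_test'[OF summable_mult[OF sum_half, of "C7 * (4 * c * (r 1)\<^sup>2)"]])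
      fix p :: nat
      let ?n = "p - 2"
      have rn: "r ?n * (1 / r p) \<le> 1" using r1[of p] monoD[OF r_mono, of ?n p] by simp
      have \<rho>: "(if p < 2 then (r p)\<^sup>2 else 1) \<le> (r 1)\<^sup>2"
        using r1[of p] r1[of 1] monoD[OF r_mono, of p 1] by (auto intro!: power_mono one_le_power)
      have "B p * g_bound (r p) p (1 / r p) =
          C7 * (4 * c * (if p < 2 then (r p)\<^sup>2 else 1)) * ((A / 2) ^ ?n * seq_star M ?n * (1 / r p) ^ ?n)"
        using r1[of p] by (simp add: B_def g_bound_def seq_star_def)
      also have "\<dots> \<le> C7 * (4 * c * (r 1)\<^sup>2) * (1 / 2) ^ ?n"
        using \<rho> half[OF _ rn] C7 c_nonneg r1[of p] A weight_sequenceD(5)[OF M, of ?n]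
        by (intro mult_mono mult_left_mono) (auto simp: less_imp_le)
      finally have "B p * g_bound (r p) p (1 / r p) \<le> C7 * (4 * c * (r 1)\<^sup>2) * (1 / 2) ^ ?n" .
      moreover have "0 \<le> B p * g_bound (r p) p (1 / r p)"
        using C7 A Mpos[of ?n] c_nonneg r1[of p] by (simp add: B_def g_bound_def less_imp_le)
      ultimately show "norm (B p * g_bound (r p) p (1 / r p)) \<le> C7 * (4 * c * (r 1)\<^sup>2) * (1 / 2) ^ ?n"
        by simp
    qed
  qed
  define C8 where "C8 = C7 * (5 * c * (r 1)\<^sup>2)"
  have C8: "C8 \<ge> 0" using C7 c_nonneg by (simp add: C8_def)
  have tbound: "norm (b p x * of_real (e_term r p y)) \<le> C8 * ((A / 2) ^ (p - 2) * seq_star M (p - 2) * \<bar>y\<bar> ^ (p - 2))"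
    if "r (p - 2) * \<bar>y\<bar> \<le> 1" for p x y
  proof -
    have "norm (b p x * of_real (e_term r p y)) \<le> B p * (5 * c * (r 1)\<^sup>2 * (\<bar>y\<bar> ^ (p - 2) / fact (p - 2)))"
      unfolding norm_mult norm_of_real
      using b0 e_term_le[OF r_mono r1 that] B_nonneg by (intro mult_mono) auto
    then show ?thesis by (simp add: B_def C8_def seq_star_def mult_ac)
  qed
  define Sg where "Sg = (\<Sum>p. (1 / 2 :: real) ^ (p - 2))"
  have lap_le: "norm (laplacian \<Phi> (x, y)) \<le> X * Sg"
    if "\<And>p. norm (b p x * of_real (e_term r p y)) \<le> X * (1 / 2) ^ (p - 2)" for X x y
    unfolding laplacian_\<Phi> Sg_def
    by (subst suminf_mult[OF sum_half, symmetric])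
       (intro norm_suminf_le[OF that] summable_mult sum_half)
  have Sg: "Sg \<ge> 0" unfolding Sg_def by (intro suminf_nonneg sum_half) auto
  obtain ct where "ct > 0" and ct: "\<And>n q y. 0 < y \<Longrightarrow> y < 1 \<Longrightarrow> A * max_quot M n * y \<le> 1 \<Longrightarrow>
      1 \<le> 2 * A * max_quot M (n + 2) * y \<Longrightarrow>
      (A / 2) ^ n * seq_star M n * y ^ n \<le> ct * (1 / 2) ^ n * (h' * y) ^ q * seq_star N' q"
    unfolding h'A using truncation_estimate[OF M N MN pos(2) A NN' N'(1) pos(3,4)] by blast
  \<comment> \<open>For |y| >= 1/(2R) the target (h' |y|)^q N'*_q is at least 1/Bd, uniformly in q,
    so that a plain bound of the Laplacian suffices there.\<close>
  obtain Bd where "Bd > 0" and Bd: "\<And>q. (2 * R / h') ^ q / seq_star N' q \<le> Bd"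
    using power_div_seq_star_bounded[OF N', of "2 * R / h'"] R h'pos by auto
  have N'pos: "seq_star N' q > 0" for q by (rule weight_sequenceD[OF N'(1)])
  define D where "D = C8 * Sg * (ct + Bd)"
  have main: "norm (laplacian \<Phi> (x, y)) \<le> D * ((h' * \<bar>y\<bar>) ^ q * seq_star N' q)" if "y \<noteq> 0" for x y q
  proof -
    let ?E = "(h' * \<bar>y\<bar>) ^ q * seq_star N' q"
    have E: "?E > 0" using h'pos that N'pos by simp
    show ?thesis
    proof (cases "2 * R * \<bar>y\<bar> < 1")
      case True
      have y1: "\<bar>y\<bar> < 1" using True R mult_right_mono[of 1 "2 * R" "\<bar>y\<bar>"] by simp
      have "norm (b p x * of_real (e_term r p y)) \<le> (C8 * ct * ?E) * (1 / 2) ^ (p - 2)" for p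
      proof (cases "r (p - 2) * \<bar>y\<bar> \<ge> 1 \<or> 2 * r p * \<bar>y\<bar> \<le> 1")
        case True
        then show ?thesis using e_term_eq_0[OF r_mono r1 True] C8 \<open>ct > 0\<close> E by simp
      next
        case False
        then have f1: "r (p - 2) * \<bar>y\<bar> \<le> 1" and f2: "2 * r p * \<bar>y\<bar> > 1" by auto
        have "A * max_quot M (p - 2) * \<bar>y\<bar> \<le> r (p - 2) * \<bar>y\<bar>"
          by (intro mult_right_mono) (auto simp: r_def)
        then have a1: "A * max_quot M (p - 2) * \<bar>y\<bar> \<le> 1" using f1 by simp
        \<comment> \<open>2 R |y| < 1 < 2 r_p |y| excludes the floor, so r_p is \<open>A\<close>
          times the running maximum.\<close>
        have "r p \<noteq> R" using f2 True by auto
        then have "r p = A * max_quot M p" unfolding r_def max_def by (simp split: if_splits)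
        \<comment> \<open>For p < 2 the truncated expression p - 2 + 2 is 2 and exceeds p;
          monotonicity covers this.\<close>
        also have "\<dots> \<le> A * max_quot M (p - 2 + 2)"
          using A by (intro mult_left_mono max_quot_mono) auto
        finally have "2 * r p * \<bar>y\<bar> \<le> 2 * (A * max_quot M (p - 2 + 2)) * \<bar>y\<bar>"
          by (intro mult_right_mono) auto
        then have a2: "1 \<le> 2 * A * max_quot M (p - 2 + 2) * \<bar>y\<bar>" using f2 by (simp add: mult.assoc)
        have "norm (b p x * of_real (e_term r p y)) \<le>
            C8 * ((A / 2) ^ (p - 2) * seq_star M (p - 2) * \<bar>y\<bar> ^ (p - 2))" by (rule tbound[OF f1])
        also have "\<dots> \<le> C8 * (ct * (1 / 2) ^ (p - 2) * (h' * \<bar>y\<bar>) ^ q * seq_star N' q)"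
          using that y1 by (intro mult_left_mono C8 ct a1 a2) auto
        finally show ?thesis by (simp add: mult_ac)
      qed
      then have "norm (laplacian \<Phi> (x, y)) \<le> (C8 * ct * ?E) * Sg" by (rule lap_le)
      also have "\<dots> \<le> D * ?E"
        using C8 Sg \<open>Bd > 0\<close> E by (simp add: D_def algebra_simps)
      finally show ?thesis .
    next
      case False
      have "norm (b p x * of_real (e_term r p y)) \<le> C8 * (1 / 2) ^ (p - 2)" for p
      proof (cases "r (p - 2) * \<bar>y\<bar> \<ge> 1")
        case True
        then show ?thesis using e_term_eq_0[OF r_mono r1, of p y] C8 by simp
      next
        case False
        then have f1: "r (p - 2) * \<bar>y\<bar> \<le> 1" by simp
        show ?thesis
          by (rule order.trans[OF tbound[OF f1] mult_left_mono[OF half C8]]) (use f1 in auto)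
      qed
      then have "norm (laplacian \<Phi> (x, y)) \<le> C8 * Sg" by (rule lap_le)
      also have "\<dots> \<le> C8 * Sg * (Bd * ?E)"
      proof -
        have "1 / \<bar>y\<bar> \<le> 2 * R" using False that by (simp add: field_simps)
        then have "1 / \<bar>y\<bar> / h' \<le> 2 * R / h'" using h'pos by (intro divide_right_mono) auto
        then have "(1 / (h' * \<bar>y\<bar>)) ^ q \<le> (2 * R / h') ^ q"
          using h'pos by (intro power_mono) (auto simp: mult.commute)
        also have "\<dots> \<le> Bd * seq_star N' q" using Bd[of q] N'pos[of q] by (simp add: pos_divide_le_eq del: power_divide)
        finally have "1 \<le> Bd * ?E"
          using h'pos that by (simp add: power_divide field_simps)
        then show ?thesis using C8 Sg mult_left_mono[of 1 "Bd * ?E" "C8 * Sg"] by simp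
      qed
      also have "\<dots> \<le> D * ?E"
        using C8 Sg \<open>ct > 0\<close> E by (simp add: D_def algebra_simps)
      finally show ?thesis .
    qed
  qed
  show ?thesis
  proof (intro bexI[of _ \<Phi>] conjI ballI)
    show "\<Phi> (x, 0) = \<phi>0 x" if "x \<in> \<Omega>" for x by (simp add: \<Phi>_0 b_def \<phi> that)
    show "dir_deriv (0, 1) \<Phi> (x, 0) = \<phi>1 x" if "x \<in> \<Omega>" for x by (simp add: dy_\<Phi>_0 b_def \<phi> that)
    have strip: "K \<times> {- 1 / r 0..1 / r 0} \<subseteq> V"
    proof
      fix z assume z: "z \<in> K \<times> {- 1 / r 0..1 / r 0}"
      have "\<bar>snd z\<bar> \<le> 1 / r 0" using z by (auto simp: abs_le_iff)
      also have "\<dots> \<le> 1 / R" using R r1[of 0] by (intro divide_left_mono) (auto simp: r_def)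
      finally have "\<bar>snd z\<bar> < e" using R by simp
      then have "z \<in> ball (fst z, 0) e" by (simp add: dist_prod_def dist_commute)
      moreover have "(fst z, 0) \<in> K \<times> {0}" using z by auto
      ultimately show "z \<in> V" using e by blast
    qed
    have "compact (supp \<Phi>)"
      by (rule compact_supp_subset[OF _ supp_\<Phi>]) (intro compact_Times K compact_Icc)
    then show "\<Phi> \<in> C2c V"
      unfolding C2c_def using Ck_on_subset[OF C2_\<Phi>] supp_\<Phi> strip by auto
    show "small_laplacian V N' h' \<Phi>"
      unfolding small_laplacian_def
    proof (rule bdd_aboveI2[of _ _ D])
      fix z assume "z \<in> {(x, y) \<in> V. y \<noteq> 0}"
      then obtain x y where z: "z = (x, y)" "y \<noteq> 0" by auto
      have "norm (laplacian \<Phi> (x, y)) * exp (assoc_fun (seq_star N') (1 / (h' * \<bar>y\<bar>))) \<le> D"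
      proof (rule mult_exp_assoc_fun_le[OF N'(1)])
        show "1 / (h' * \<bar>y\<bar>) > 0" using h'pos z by simp
        fix q
        have "norm (laplacian \<Phi> (x, y)) * (1 / (h' * \<bar>y\<bar>)) ^ q \<le>
            D * ((h' * \<bar>y\<bar>) ^ q * seq_star N' q) * (1 / (h' * \<bar>y\<bar>)) ^ q"
          using h'pos by (intro mult_right_mono main z) auto
        also have "\<dots> = D * seq_star N' q" using h'pos z by (simp add: power_divide)
        finally show "norm (laplacian \<Phi> (x, y)) * (1 / (h' * \<bar>y\<bar>)) ^ q \<le> D * seq_star N' q" .
      qed simp
      then show "(case z of (x, y) \<Rightarrow> norm (laplacian \<Phi> (x, y)) *
          exp (assoc_fun (seq_star N') (1 / (h' * \<bar>y\<bar>)))) \<le> D" by (simp add: z)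
    qed
  qed
qed

section \<open>Ultradifferentiable classes\<close>

text \<open>\<psi>0 and \<psi>1 are the trace and the normal derivative of \<Phi>, which vanish off
  \<Omega> because the support of \<Phi> lies in V. Their own supports serve as compact sets, and
  the shift by 2d is that of \<open>ft_decay_imp_smooth\<close>.\<close>

lemma boundary_values_in_DMh:
  fixes \<Phi> :: "(real ^ 'd) \<times> real \<Rightarrow> complex"
  assumes V: "open V" "V \<inter> (UNIV \<times> {0}) = \<Omega> \<times> {0}" and \<Phi>: "\<Phi> \<in> C2c V"
    and M: "weight_sequence M" "non_quasianalytic M" and N: "weight_sequence N" "non_quasianalytic N"
    and h: "h > 0" and C: "C > 0" and H: "H > 0"
    and MN: "\<And>p. M (p + 2 * CARD('d)) \<le> C * H ^ p * N p"
    and bdd: "small_laplacian V M h \<Phi>"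
    and \<phi>0: "\<And>x. x \<in> \<Omega> \<Longrightarrow> \<Phi> (x, 0) = \<phi>0 x"
    and \<phi>1: "\<And>x. x \<in> \<Omega> \<Longrightarrow> dir_deriv (0, 1) \<Phi> (x, 0) = \<phi>1 x"
  defines "\<psi>0 \<equiv> \<lambda>x. if x \<in> \<Omega> then \<phi>0 x else 0" and "\<psi>1 \<equiv> \<lambda>x. if x \<in> \<Omega> then \<phi>1 x else 0"
  shows "compact (supp \<psi>0) \<and> supp \<psi>0 \<subseteq> \<Omega> \<and> \<psi>0 \<in> DMh (supp \<psi>0) N (h * H)"
    and "compact (supp \<psi>1) \<and> supp \<psi>1 \<subseteq> \<Omega> \<and> \<psi>1 \<in> DMh (supp \<psi>1) N (h * H)"
proof -
  have supp: "compact (supp \<Phi>)" "supp \<Phi> \<subseteq> V" and C2: "Ck_on 2 UNIV \<Phi>"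
    using \<Phi> Ck_on_extend[OF V(1)] by (auto simp: C2c_def)
  have C2': "Ck_on (Suc (Suc 0)) UNIV \<Phi>" using C2 by (simp add: numeral_2_eq_2)
  note d = Ck_on_SucD2(1,2)[OF C2', OF UNIV_I]
  have c0: "continuous_on UNIV \<Phi>" and c1: "continuous_on UNIV (dir_deriv (0, 1) \<Phi>)"
    by (intro continuous_at_imp_continuous_on ballI differentiable_imp_continuous_within d)+
  have s1: "compact (supp (dir_deriv (0, 1) \<Phi>))" by (rule compact_supp_subset[OF supp(1) supp_dir_deriv])
  have mem: "(x, 0) \<in> V \<longleftrightarrow> x \<in> \<Omega>" for x using V(2) by blast
  have nin: "(x, 0) \<notin> supp \<Phi>" if "x \<notin> \<Omega>" for x using supp(2) mem that by blast
  have \<psi>0: "\<psi>0 = (\<lambda>x. \<Phi> (x, 0))"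
    unfolding \<psi>0_def using \<phi>0 nin by (auto simp: fun_eq_iff eq_0_outside_supp)
  have \<psi>1: "\<psi>1 = (\<lambda>x. dir_deriv (0, 1) \<Phi> (x, 0))"
    unfolding \<psi>1_def using \<phi>1 nin by (auto simp: fun_eq_iff dir_deriv_eq_0_outside_supp)
  have cs: "compact (supp \<psi>0)" "compact (supp \<psi>1)" and cc: "continuous_on UNIV \<psi>0" "continuous_on UNIV \<psi>1"
    unfolding \<psi>0 \<psi>1
    by (rule compact_supp_slice[OF c0 supp(1)] compact_supp_slice[OF c1 s1]
        continuous_on_slice[OF c0 supp(1)] continuous_on_slice[OF c1 s1])+
  have K: "compact {x. (x, 0) \<in> supp \<Phi>}"
  proof -
    have "{x. (x, 0) \<in> supp \<Phi>} = fst ` (supp \<Phi> \<inter> (UNIV \<times> {0}))" by force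
    then show ?thesis
      using supp(1) by (auto intro!: compact_continuous_image compact_Int_closed closed_Times continuous_intros)
  qed
  have sub: "supp \<psi>0 \<subseteq> \<Omega>" "supp \<psi>1 \<subseteq> \<Omega>"
  proof -
    have "supp \<psi>0 \<subseteq> {x. (x, 0) \<in> supp \<Phi>}" "supp \<psi>1 \<subseteq> {x. (x, 0) \<in> supp \<Phi>}"
      unfolding \<psi>0 \<psi>1
      by (intro supp_subsetI compact_imp_closed[OF K]; simp add: eq_0_outside_supp dir_deriv_eq_0_outside_supp)+
    then show "supp \<psi>0 \<subseteq> \<Omega>" "supp \<psi>1 \<subseteq> \<Omega>" using nin by blast+
  qed
  have Mpos: "M p > 0" and Npos: "N p > 0" for p using weight_sequenceD(1) M N by auto
  obtain B0 where B0: "\<And>x y. (x, y) \<in> V \<Longrightarrow> y \<noteq> 0 \<Longrightarrow>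
      norm (laplacian \<Phi> (x, y)) * exp (assoc_fun (seq_star M) (1 / (h * \<bar>y\<bar>))) \<le> B0"
    using bdd unfolding small_laplacian_def bdd_above_def by fastforce
  \<comment> \<open>The maximum with 1 gives a positive constant even when V has no point with y
    \<noteq> 0 that constrains \<open>B0\<close>.\<close>
  define B1 where "B1 = max 1 B0"
  define D where "D p = B1 * (h ^ p * M p)" for p
  have lap: "norm (laplacian \<Phi> (x, y)) \<le> D p * (\<bar>y\<bar> ^ p / fact p)" if y: "y \<noteq> 0" for p x y
  proof (cases "(x, y) \<in> V")
    case True
    let ?t = "1 / (h * \<bar>y\<bar>)"
    have t: "?t > 0" using h y by simp
    have "norm (laplacian \<Phi> (x, y)) * (?t ^ p / seq_star M p) \<le>
        norm (laplacian \<Phi> (x, y)) * exp (assoc_fun (seq_star M) ?t)"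
      by (intro mult_left_mono exp_assoc_fun_ge[OF M t]) simp
    also have "\<dots> \<le> B1" using B0[OF True y] by (simp add: B1_def)
    finally have "norm (laplacian \<Phi> (x, y)) * (?t ^ p / seq_star M p) \<le> B1" .
    moreover have "?t ^ p / seq_star M p = fact p / ((h * \<bar>y\<bar>) ^ p * M p)"
      by (simp add: seq_star_def power_divide)
    moreover have "(h * \<bar>y\<bar>) ^ p * M p > 0" using h y Mpos by simp
    ultimately show ?thesis
      by (simp add: D_def power_mult_distrib pos_divide_le_eq pos_le_divide_eq mult_ac)
  next
    case False
    then have "(x, y) \<notin> supp (laplacian \<Phi>)" using supp supp_laplacian by blast
    then show ?thesis using h Mpos[of p] by (simp add: eq_0_outside_supp D_def B1_def less_imp_le)
  qed
  obtain B where "B > 0" and B: "\<And>p \<xi>. norm \<xi> ^ p * norm (ft \<psi>1 \<xi>) \<le> B * D p"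
      "\<And>p \<xi>. norm \<xi> ^ Suc p * norm (ft \<psi>0 \<xi>) \<le> B * D p"
    unfolding \<psi>0 \<psi>1 using boundary_ft_estimate[OF C2 supp(1) lap] by blast
  define m1 where "m1 = quot_seq M 1"
  have m1: "m1 > 0" unfolding m1_def by (rule weight_sequenceD[OF M(1)])
  define I0 where "I0 = (LINT x|lborel. norm (\<psi>0 x))"
  \<comment> \<open>\<open>I0\<close> serves \<psi>0 at p = 0, since its boundary estimate starts
    with one factor |\<xi>|; \<open>B * B1\<close> serves \<psi>1; the last entry serves \<psi>0 at
    p = q + 1, where m1 M_q <= M_(q+1) raises the index.\<close>
  define E where "E = max I0 (max (B * B1) (B * B1 / (h * m1)))"
  have Epos: "E > 0" using \<open>B > 0\<close> by (auto simp: E_def B1_def less_max_iff_disj)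
  have e1: "norm \<xi> ^ p * norm (ft \<psi>1 \<xi>) \<le> E * (h ^ p * M p)" for p \<xi>
  proof -
    have "norm \<xi> ^ p * norm (ft \<psi>1 \<xi>) \<le> B * B1 * (h ^ p * M p)"
      using B(1)[of \<xi> p] by (simp add: D_def mult_ac)
    also have "\<dots> \<le> E * (h ^ p * M p)"
      using h Mpos[of p] by (intro mult_right_mono) (auto simp: E_def)
    finally show ?thesis .
  qed
  have e0: "norm \<xi> ^ p * norm (ft \<psi>0 \<xi>) \<le> E * (h ^ p * M p)" for p \<xi>
  proof (cases p)
    case 0
    have "norm (ft \<psi>0 \<xi>) \<le> I0" unfolding I0_def by (rule norm_ft_le)
    also have "\<dots> \<le> E" by (simp add: E_def)
    finally show ?thesis by (simp add: 0 weight_sequenceD(2)[OF M(1)])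
  next
    case (Suc q)
    have "m1 \<le> quot_seq M (Suc q)" unfolding m1_def by (intro weight_sequenceD(3)[OF M(1)]) auto
    then have "m1 * M q \<le> M (Suc q)" using Mpos[of q] by (simp add: quot_seq_def pos_le_divide_eq)
    then have "B * B1 / (h * m1) * (h ^ Suc q * (m1 * M q)) \<le> B * B1 / (h * m1) * (h ^ Suc q * M (Suc q))"
      using h m1 \<open>B > 0\<close> by (intro mult_left_mono) (auto simp: B1_def)
    then have "B * D q \<le> B * B1 / (h * m1) * (h ^ Suc q * M (Suc q))"
      using h m1 by (simp add: D_def field_simps)
    also have "\<dots> \<le> E * (h ^ Suc q * M (Suc q))"
      using h Mpos[of "Suc q"] by (intro mult_right_mono) (auto simp: E_def)
    finally show ?thesis using B(2)[of \<xi> q] by (simp only: Suc)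
  qed
  define W where "W = 2 ^ CARD('d) * (LINT \<xi>|lborel. cauchy_weight (\<xi>::real ^ 'd))"
  have W: "W \<ge> 0" unfolding W_def
    by (intro mult_nonneg_nonneg Bochner_Integration.integral_nonneg less_imp_le[OF cauchy_weight_pos]) simp
  have hH: "h * H > 0" using h H by simp
  \<comment> \<open>The term \<open>A 0\<close> in the smoothness estimate is the same for every
    order n; it is absorbed because (h H)^n N_n stays away from 0.\<close>
  obtain Bd where "Bd > 0" and Bd: "\<And>n. (1 / (h * H)) ^ n / seq_star N n \<le> Bd"
    using power_div_seq_star_bounded[OF N, of "1 / (h * H)"] hH by auto
  have one: "1 \<le> Bd * ((h * H) ^ n * N n)" for n
  proof -
    have "(1 / (h * H)) ^ n / N n \<le> (1 / (h * H)) ^ n / seq_star N n"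
      using hH Npos[of n] by (intro divide_left_mono) (auto simp: seq_star_def divide_le_eq mult_le_cancel_left1)
    also have "\<dots> \<le> Bd" by (rule Bd)
    finally have "1 / ((h * H) ^ n * N n) \<le> Bd" by (simp add: power_divide)
    moreover have "(h * H) ^ n * N n > 0" using hH Npos[of n] by simp
    ultimately show ?thesis by (simp only: pos_divide_le_eq)
  qed
  have final: "\<psi> \<in> DMh (supp \<psi>) N (h * H)"
    if c: "continuous_on UNIV \<psi>" "compact (supp \<psi>)" and A: "\<And>p \<xi>. norm \<xi> ^ p * norm (ft \<psi> \<xi>) \<le> E * (h ^ p * M p)"
    for \<psi> :: "real ^ 'd \<Rightarrow> complex"
  proof (rule iter_deriv_le_imp_DMh[OF _ _ N(1) hH])
    show "smooth \<psi>" by (rule ft_decay_imp_smooth(1)[OF c A])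
    fix "is" :: "'d list" and x
    let ?n = "length is"
    let ?Q = "(h * H) ^ ?n * N ?n"
    have "norm (iter_deriv is \<psi> x) \<le> W * (E * (h ^ 0 * M 0) + E * (h ^ (?n + 2 * CARD('d)) * M (?n + 2 * CARD('d))))"
      unfolding W_def by (rule ft_decay_imp_smooth(2)[OF c A])
    also have "\<dots> \<le> W * (E * (Bd * ?Q) + E * (h ^ (?n + 2 * CARD('d)) * (C * H ^ ?n * N ?n)))"
      using W Epos h one[of ?n] MN[of ?n]
      by (intro mult_left_mono add_mono) (auto simp: weight_sequenceD(2)[OF M(1)])
    also have "\<dots> = (W * E * (Bd + h ^ (2 * CARD('d)) * C)) * (h * H) ^ ?n * N ?n"
      by (simp add: power_add power_mult_distrib algebra_simps)
    finally show "norm (iter_deriv is \<psi> x) \<le> (W * E * (Bd + h ^ (2 * CARD('d)) * C)) * (h * H) ^ ?n * N ?n" .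
  qed simp
  show "compact (supp \<psi>0) \<and> supp \<psi>0 \<subseteq> \<Omega> \<and> \<psi>0 \<in> DMh (supp \<psi>0) N (h * H)"
    using cs sub final[OF cc(1) cs(1) e0] by blast
  show "compact (supp \<psi>1) \<and> supp \<psi>1 \<subseteq> \<Omega> \<and> \<psi>1 \<in> DMh (supp \<psi>1) N (h * H)"
    using cs sub final[OF cc(2) cs(2) e1] by blast
qed

text \<open>For the Roumieu case, where the two data come with different sequences and radii and
  must be brought into one class.\<close>

lemma DMh_mono:
  fixes K :: "(real ^ 'd) set"
  assumes \<psi>: "\<psi> \<in> DMh K M h" and M: "weight_sequence M" and N: "weight_sequence N"
    and le: "M \<le> N" "0 < h" "h \<le> h'" and "compact K"
  shows "\<psi> \<in> DMh K N h'"
proof -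
  obtain C where s: "smooth \<psi>" "supp \<psi> \<subseteq> K"
    and C: "\<And>is x. norm (iter_deriv is \<psi> x) \<le> C * h ^ length is * M (length is)"
    using DMh_imp_iter_deriv_le[OF \<psi> M le(2) \<open>compact K\<close>] by blast
  have "0 \<le> C * h ^ length ([]::'d list) * M (length ([]::'d list))"
    by (rule order.trans[OF norm_ge_zero C[of "[]" undefined]])
  then have "C \<ge> 0" by (simp add: weight_sequenceD(2)[OF M])
  show ?thesis
  proof (rule iter_deriv_le_imp_DMh[OF s N])
    show "h' > 0" using le by simp
    fix "is" :: "'d list" and x
    have "C * h ^ length is * M (length is) \<le> C * h' ^ length is * N (length is)"
      using le \<open>C \<ge> 0\<close> weight_sequenceD(1)[OF M, of "length is"]
      by (intro mult_mono power_mono) (auto simp: le_fun_def less_imp_le)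
    then show "norm (iter_deriv is \<psi> x) \<le> C * h' ^ length is * N (length is)" using C[of "is" x] by simp
  qed
qed

section \<open>Choice of the sequences in the Beurling and the Roumieu case\<close>

theorem theorem3p2:
  fixes \<MM> :: "(nat \<Rightarrow> real) set"
    and \<Omega> :: "(real ^ 'd) set"
    and V :: "((real ^ 'd) \<times> real) set"
    and \<phi>0 \<phi>1 :: "real ^ 'd \<Rightarrow> complex"
  assumes "weight_matrix \<MM>" and "nqa_matrix \<MM>"
    and "open \<Omega>" and "open V" and "V \<inter> (UNIV \<times> {0}) = \<Omega> \<times> {0}"
  shows
    "(M1_star_w_B \<MM> \<and> M2_prime_B \<MM> \<longrightarrow>
       (\<phi>0 \<in> D_B \<MM> \<Omega> \<and> \<phi>1 \<in> D_B \<MM> \<Omega> \<longleftrightarrow>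
         (\<forall>M\<in>\<MM>. \<forall>h>0. \<exists>\<Phi>\<in>C2c V.
            (\<forall>x\<in>\<Omega>. \<Phi> (x, 0) = \<phi>0 x) \<and>
            (\<forall>x\<in>\<Omega>. dir_deriv (0, 1) \<Phi> (x, 0) = \<phi>1 x) \<and>
            bdd_above ((\<lambda>(x, y). norm (laplacian \<Phi> (x, y)) *
                exp (assoc_fun (seq_star M) (1 / (h * \<bar>y\<bar>)))) ` {(x, y) \<in> V. y \<noteq> 0})))) \<and>
     (M1_star_w_R \<MM> \<and> M2_prime_R \<MM> \<longrightarrow>
       (\<phi>0 \<in> D_R \<MM> \<Omega> \<and> \<phi>1 \<in> D_R \<MM> \<Omega> \<longleftrightarrow>
         (\<exists>M\<in>\<MM>. \<exists>h>0. \<exists>\<Phi>\<in>C2c V.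
            (\<forall>x\<in>\<Omega>. \<Phi> (x, 0) = \<phi>0 x) \<and>
            (\<forall>x\<in>\<Omega>. dir_deriv (0, 1) \<Phi> (x, 0) = \<phi>1 x) \<and>
            bdd_above ((\<lambda>(x, y). norm (laplacian \<Phi> (x, y)) *
                exp (assoc_fun (seq_star M) (1 / (h * \<bar>y\<bar>)))) ` {(x, y) \<in> V. y \<noteq> 0}))))"
proof -
  have w: "weight_sequence M" "non_quasianalytic M" if "M \<in> \<MM>" for M
    using assms(1,2) that by (auto simp: weight_matrix_def nqa_matrix_def)
  define Ext where "Ext M h \<longleftrightarrow> (\<exists>\<Phi>\<in>C2c V.
    (\<forall>x\<in>\<Omega>. \<Phi> (x, 0) = \<phi>0 x) \<and> (\<forall>x\<in>\<Omega>. dir_deriv (0, 1) \<Phi> (x, 0) = \<phi>1 x) \<and>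
    small_laplacian V M h \<Phi>)" for M h
  \<comment> \<open>Extension by zero depends on the data alone. In the Beurling case \<Phi> varies
    with M and h, yet all these \<Phi> must certify one and the same function.\<close>
  define \<psi>0 where "\<psi>0 = (\<lambda>x. if x \<in> \<Omega> then \<phi>0 x else 0)"
  define \<psi>1 where "\<psi>1 = (\<lambda>x. if x \<in> \<Omega> then \<phi>1 x else 0)"
  let ?good = "\<lambda>\<psi> N h. compact (supp \<psi>) \<and> supp \<psi> \<subseteq> \<Omega> \<and> \<psi> \<in> DMh (supp \<psi>) N h"
  have converse: "?good \<psi>0 N (h * H) \<and> ?good \<psi>1 N (h * H)"
    if "Ext M h" "M \<in> \<MM>" "N \<in> \<MM>" "h > 0" "C > 0" "H > 0" "\<And>p. M (p + 2 * CARD('d)) \<le> C * H ^ p * N p"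
    for M N h C H
    using that boundary_values_in_DMh[OF assms(4,5) _ w[OF that(2)] w[OF that(3)] that(4-7), of _ \<phi>0 \<phi>1]
    unfolding \<psi>0_def \<psi>1_def Ext_def by blast
  have B: "\<phi>0 \<in> D_B \<MM> \<Omega> \<and> \<phi>1 \<in> D_B \<MM> \<Omega> \<longleftrightarrow> (\<forall>M\<in>\<MM>. \<forall>h>0. Ext M h)"
    if M1: "M1_star_w_B \<MM>" and M2: "M2_prime_B \<MM>"
  proof
    assume "\<phi>0 \<in> D_B \<MM> \<Omega> \<and> \<phi>1 \<in> D_B \<MM> \<Omega>"
    then obtain K0 K1 u0 u1 where K: "compact K0" "compact K1" "K0 \<subseteq> \<Omega>" "K1 \<subseteq> \<Omega>"
      and u: "u0 \<in> DK_B \<MM> K0" "u1 \<in> DK_B \<MM> K1"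
      and eq: "\<And>x. x \<in> \<Omega> \<Longrightarrow> \<phi>0 x = u0 x" "\<And>x. x \<in> \<Omega> \<Longrightarrow> \<phi>1 x = u1 x"
      unfolding D_B_def by blast
    show "\<forall>M\<in>\<MM>. \<forall>h>0. Ext M h"
    proof (intro ballI allI impI)
      fix N' and h' :: real assume N': "N' \<in> \<MM>" and h': "h' > 0"
      \<comment> \<open>The chain is built backwards from the prescribed \<open>N'\<close>, and the
        initial radius is then solved from the linear formula for h'.\<close>
      obtain N C2 H2 where N: "N \<in> \<MM>" and c2: "C2 > 0" "H2 > 0" "\<And>p. N (p + 2) \<le> C2 * H2 ^ p * N' p"
        using M2_prime_B_shift[OF M2 N', of 2] unfolding shift_dominated_def by blast
      from M1 N obtain M C1 where M: "M \<in> \<MM>" and c1: "C1 > 0"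
        "\<forall>p\<ge>1. \<forall>q. 1 \<le> q \<and> q \<le> p \<longrightarrow> quot_seq_star M q \<le> C1 * quot_seq_star N p"
        unfolding M1_star_w_B_def by blast
      have MN: "quot_seq_star M q \<le> C1 * quot_seq_star N p" if "1 \<le> q" "q \<le> p" for p q
        using c1(2) that order.trans[OF that] by blast
      obtain L C3 H3 where L: "L \<in> \<MM>" and c3: "C3 > 0" "H3 > 0" "\<And>p. L (p + 4) \<le> C3 * H3 ^ p * M p"
        using M2_prime_B_shift[OF M2 M, of 4] unfolding shift_dominated_def by blast
      define h where "h = h' / (4 * CARD('d) * H3 * C1 * H2)"
      have h: "h > 0" using h' c1 c2 c3 by (simp add: h_def)
      have h'eq: "h' = 4 * CARD('d) * h * H3 * C1 * H2" using c1 c2 c3 by (simp add: h_def)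
      have D: "u0 \<in> DMh K0 L h" "u1 \<in> DMh K1 L h" using u L h by (auto simp: DK_B_def)
      show "Ext N' h'"
        unfolding Ext_def by (rule almost_harmonic_extension[OF assms(4,5) K D eq w(1)[OF L] w(1)[OF M] w[OF N] w[OF N'] h c1(1) c2(1,2) c3 MN c2(3) h'eq])
    qed
  next
    assume ext: "\<forall>M\<in>\<MM>. \<forall>h>0. Ext M h"
    have good: "?good \<psi>0 N h \<and> ?good \<psi>1 N h" if N: "N \<in> \<MM>" and h: "h > 0" for N h
    proof -
      obtain M C H where M: "M \<in> \<MM>" and c: "C > 0" "H > 0" "\<And>p. M (p + 2 * CARD('d)) \<le> C * H ^ p * N p"
        using M2_prime_B_shift[OF M2 N] unfolding shift_dominated_def by blast
      \<comment> \<open>The passage to boundary values multiplies the radius by \<open>H\<close>, so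
        the hypothesis is used at h / H.\<close>
      have hH: "h / H > 0" using h c by simp
      from ext M hH have "Ext M (h / H)" by blast
      from converse[OF this M N hH c] show ?thesis using c by simp
    qed
    \<comment> \<open>Any member yields compactness of the two supports, which do not depend on
      it.\<close>
    obtain N where "N \<in> \<MM>" using assms(1) by (auto simp: weight_matrix_def)
    from good[OF this zero_less_one] have k: "compact (supp \<psi>0)" "supp \<psi>0 \<subseteq> \<Omega>" "compact (supp \<psi>1)" "supp \<psi>1 \<subseteq> \<Omega>"
      by blast+
    have "\<psi>0 \<in> DK_B \<MM> (supp \<psi>0)" "\<psi>1 \<in> DK_B \<MM> (supp \<psi>1)" using good by (auto simp: DK_B_def)
    moreover have "\<forall>x\<in>\<Omega>. \<phi>0 x = \<psi>0 x" "\<forall>x\<in>\<Omega>. \<phi>1 x = \<psi>1 x" by (simp_all add: \<psi>0_def \<psi>1_def)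
    ultimately show "\<phi>0 \<in> D_B \<MM> \<Omega> \<and> \<phi>1 \<in> D_B \<MM> \<Omega>" unfolding D_B_def using k by blast
  qed
  have R: "\<phi>0 \<in> D_R \<MM> \<Omega> \<and> \<phi>1 \<in> D_R \<MM> \<Omega> \<longleftrightarrow> (\<exists>M\<in>\<MM>. \<exists>h>0. Ext M h)"
    if M1: "M1_star_w_R \<MM>" and M2: "M2_prime_R \<MM>"
  proof
    assume "\<phi>0 \<in> D_R \<MM> \<Omega> \<and> \<phi>1 \<in> D_R \<MM> \<Omega>"
    then obtain K0 K1 u0 u1 where K: "compact K0" "compact K1" "K0 \<subseteq> \<Omega>" "K1 \<subseteq> \<Omega>"
      and u: "u0 \<in> DK_R \<MM> K0" "u1 \<in> DK_R \<MM> K1"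
      and eq: "\<And>x. x \<in> \<Omega> \<Longrightarrow> \<phi>0 x = u0 x" "\<And>x. x \<in> \<Omega> \<Longrightarrow> \<phi>1 x = u1 x"
      unfolding D_R_def by blast
    obtain L0 h0 L1 h1 where L01: "L0 \<in> \<MM>" "L1 \<in> \<MM>" and h01: "h0 > 0" "h1 > 0"
      and D01: "u0 \<in> DMh K0 L0 h0" "u1 \<in> DMh K1 L1 h1"
      using u unfolding DK_R_def by auto
    obtain L where L: "L \<in> \<MM>" "L0 \<le> L" "L1 \<le> L"
      using assms(1) L01 unfolding weight_matrix_def by (metis order_refl)
    define h where "h = max h0 h1"
    have h: "h > 0" "h0 \<le> h" "h1 \<le> h" using h01 by (auto simp: h_def)
    have D: "u0 \<in> DMh K0 L h" "u1 \<in> DMh K1 L h"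
      using DMh_mono[OF D01(1) w(1) w(1) L(2) h01(1) h(2) K(1)] DMh_mono[OF D01(2) w(1) w(1) L(3) h01(2) h(3) K(2)] L01 L(1)
      by auto
    \<comment> \<open>Here the chain is built forwards from \<open>L\<close>, and the resulting
      radius is accepted as it comes.\<close>
    obtain M C3 H3 where M: "M \<in> \<MM>" and c3: "C3 > 0" "H3 > 0" "\<And>p. L (p + 4) \<le> C3 * H3 ^ p * M p"
      using M2_prime_R_shift[OF M2 L(1), of 4] unfolding shift_dominated_def by blast
    from M1 M obtain N C1 where N: "N \<in> \<MM>" and c1: "C1 > 0"
      "\<forall>p\<ge>1. \<forall>q. 1 \<le> q \<and> q \<le> p \<longrightarrow> quot_seq_star M q \<le> C1 * quot_seq_star N p"
      unfolding M1_star_w_R_def by blast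
    have MN: "quot_seq_star M q \<le> C1 * quot_seq_star N p" if "1 \<le> q" "q \<le> p" for p q
      using c1(2) that order.trans[OF that] by blast
    obtain N' C2 H2 where N': "N' \<in> \<MM>" and c2: "C2 > 0" "H2 > 0" "\<And>p. N (p + 2) \<le> C2 * H2 ^ p * N' p"
      using M2_prime_R_shift[OF M2 N, of 2] unfolding shift_dominated_def by blast
    have "Ext N' (4 * CARD('d) * h * H3 * C1 * H2)"
      unfolding Ext_def by (rule almost_harmonic_extension[OF assms(4,5) K D eq w(1)[OF L(1)] w(1)[OF M] w[OF N] w[OF N'] h(1) c1(1) c2(1,2) c3 MN c2(3) refl])
    moreover have "4 * CARD('d) * h * H3 * C1 * H2 > 0" using h c1 c2 c3 by simp
    ultimately show "\<exists>M\<in>\<MM>. \<exists>h>0. Ext M h" using N' by blast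
  next
    assume "\<exists>M\<in>\<MM>. \<exists>h>0. Ext M h"
    then obtain M h where M: "M \<in> \<MM>" and h: "h > 0" and ext: "Ext M h" by blast
    obtain N C H where N: "N \<in> \<MM>" and c: "C > 0" "H > 0" "\<And>p. M (p + 2 * CARD('d)) \<le> C * H ^ p * N p"
      using M2_prime_R_shift[OF M2 M] unfolding shift_dominated_def by blast
    have good: "?good \<psi>0 N (h * H) \<and> ?good \<psi>1 N (h * H)" by (rule converse[OF ext M N h c])
    have "h * H > 0" using h c by simp
    then have "\<psi>0 \<in> DK_R \<MM> (supp \<psi>0)" "\<psi>1 \<in> DK_R \<MM> (supp \<psi>1)"
      using good N unfolding DK_R_def by blast+
    moreover have "\<forall>x\<in>\<Omega>. \<phi>0 x = \<psi>0 x" "\<forall>x\<in>\<Omega>. \<phi>1 x = \<psi>1 x" by (simp_all add: \<psi>0_def \<psi>1_def)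
    ultimately show "\<phi>0 \<in> D_R \<MM> \<Omega> \<and> \<phi>1 \<in> D_R \<MM> \<Omega>" unfolding D_R_def using good by blast
  qed
  show ?thesis unfolding small_laplacian_def[symmetric] Ext_def[symmetric] using B R by blast
qed

end
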